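(* Let $A$ be a local Noetherian domain, not a DVR, that is tightly dominated by a DVR $V$. Let $F$ denote the quotient field of $A$, let $P$ be the kernel of the canonical homomorphism $\widehat A\to\widehat V$, and let $R=F\cap(\widehat A/P^{(2)})$, where $P^{(2)}$ is the second symbolic power of $P$. Then the embedding dimension of $R$ is $1$ more than the embedding dimension of $\widehat A_P$.
   Context: All rings are commutative with identity. A quasilocal ring is a ring with a unique maximal ideal (not necessarily Noetherian); its embedding dimension is the cardinality of a minimal generating set of its maximal ideal. $\widehat A$ and $\widehat V$ denote the completions of $A$ and $V$ in the topologies given by powers of their maximal ideals, and $A$ is identified with its image in $\widehat A$. With $\mathfrak m$ the maximal ideal of $A$: $V$ tightly dominates $A$ means that $A\subseteq V$ have the same quotient field, $\mathfrak m$ is contained in the maximal ideal of $V$, $V/\mathfrak mV$ is a finite $A$-module, and $V=A+\mathfrak mV$. In this situation $P\cap A=0$. If $I$ is an ideal of $\widehat A$ every associated prime of which contracts to $0$ in $A$ (such as $I=P^{(2)}$), then $A$ embeds in $\widehat A/I$, $F$ embeds in the total quotient ring of $\widehat A/I$, and $F\cap(\widehat A/I)=\{a/b\in F: a,b\in A,\ b\neq 0,\ a\in b\widehat A+I\}$. *)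

theory Defs
  imports "HOL-Algebra.Ring_Divisibility" "HOL-Algebra.Ideal_Product" "HOL-Algebra.Subrings"
begin

section \<open>Quasilocal rings, discrete valuation rings, embedding dimension\<close>

definition quasilocal_ring :: "('a, 'm) ring_scheme \<Rightarrow> bool"
  where "quasilocal_ring R \<longleftrightarrow> cring R \<and> (\<exists>!M. maximalideal M R)"

definition max_ideal :: "('a, 'm) ring_scheme \<Rightarrow> 'a set"
  where "max_ideal R = (THE M. maximalideal M R)"

definition discrete_valuation_ring :: "('a, 'm) ring_scheme \<Rightarrow> bool"
  where "discrete_valuation_ring R \<longleftrightarrow>
    principal_domain R \<and> quasilocal_ring R \<and> \<not> field R"

definition minimal_generating_set :: "('a, 'm) ring_scheme \<Rightarrow> 'a set \<Rightarrow> 'a set \<Rightarrow> bool"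
  where "minimal_generating_set R I S \<longleftrightarrow>
    S \<subseteq> carrier R \<and> genideal R S = I \<and> (\<forall>T. T \<subset> S \<longrightarrow> genideal R T \<noteq> I)"

text \<open>
  The relation below says that the embedding dimension exists, is well defined, and is the
  natural number n: the maximal ideal has a minimal (with respect to inclusion) generating set,
  and all such sets have exactly n elements.  In particular n is also the least number of
  generators whenever the maximal ideal is finitely generated.
\<close>

definition has_embedding_dimension :: "('a, 'm) ring_scheme \<Rightarrow> nat \<Rightarrow> bool"
  where "has_embedding_dimension R n \<longleftrightarrow>
    quasilocal_ring R \<and>
    (\<exists>S. minimal_generating_set R (max_ideal R) S) \<and>
    (\<forall>S. minimal_generating_set R (max_ideal R) S \<longrightarrow> finite S \<and> card S = n)"


section \<open>Powers of ideals and symbolic powers\<close>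

text \<open>
  The library's monoid of ideals has the product of ideals as multiplication and the whole ring
  as unit, so its iterated product gives the usual powers, with exponent 0 giving the ring.
\<close>

abbreviation ideal_power :: "('a, 'm) ring_scheme \<Rightarrow> 'a set \<Rightarrow> nat \<Rightarrow> 'a set"
  where "ideal_power R I n \<equiv> I [^]\<^bsub>ideals_set R\<^esub> n"

definition symbolic_power :: "('a, 'm) ring_scheme \<Rightarrow> 'a set \<Rightarrow> nat \<Rightarrow> 'a set"
  where "symbolic_power R P n =
    {x \<in> carrier R. \<exists>s \<in> carrier R - P. s \<otimes>\<^bsub>R\<^esub> x \<in> ideal_power R P n}"


section \<open>Localization\<close>

definition loc_rel :: "('a, 'm) ring_scheme \<Rightarrow> 'a set \<Rightarrow> (('a \<times> 'a) \<times> ('a \<times> 'a)) set"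
  where "loc_rel R S =
    {((r, s), (r', s')). r \<in> carrier R \<and> s \<in> S \<and> r' \<in> carrier R \<and> s' \<in> S \<and>
       (\<exists>t \<in> S. t \<otimes>\<^bsub>R\<^esub> ((r \<otimes>\<^bsub>R\<^esub> s') \<ominus>\<^bsub>R\<^esub> (r' \<otimes>\<^bsub>R\<^esub> s)) = \<zero>\<^bsub>R\<^esub>)}"

definition loc_frac :: "('a, 'm) ring_scheme \<Rightarrow> 'a set \<Rightarrow> 'a \<Rightarrow> 'a \<Rightarrow> ('a \<times> 'a) set"
  where "loc_frac R S r s = loc_rel R S `` {(r, s)}"

definition localization :: "('a, 'm) ring_scheme \<Rightarrow> 'a set \<Rightarrow> ('a \<times> 'a) set ring"
  where "localization R S =
    \<lparr>carrier = (carrier R \<times> S) // loc_rel R S,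
     mult = (\<lambda>C D. \<Union>p \<in> C. \<Union>q \<in> D.
               loc_frac R S (fst p \<otimes>\<^bsub>R\<^esub> fst q) (snd p \<otimes>\<^bsub>R\<^esub> snd q)),
     one = loc_frac R S \<one>\<^bsub>R\<^esub> \<one>\<^bsub>R\<^esub>,
     zero = loc_frac R S \<zero>\<^bsub>R\<^esub> \<one>\<^bsub>R\<^esub>,
     add = (\<lambda>C D. \<Union>p \<in> C. \<Union>q \<in> D.
              loc_frac R S ((fst p \<otimes>\<^bsub>R\<^esub> snd q) \<oplus>\<^bsub>R\<^esub> (fst q \<otimes>\<^bsub>R\<^esub> snd p))
                (snd p \<otimes>\<^bsub>R\<^esub> snd q))\<rparr>"

definition localization_at :: "('a, 'm) ring_scheme \<Rightarrow> 'a set \<Rightarrow> ('a \<times> 'a) set ring"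
  where "localization_at R P = localization R (carrier R - P)"


section \<open>Completion\<close>

text \<open>
  The completion in the topology given by the powers of I is the inverse limit of the quotients
  by these powers.  An element is a sequence of cosets, and it is compatible with the projections
  precisely if each coset is contained in its predecessor.
\<close>

definition adic_completion :: "('a, 'm) ring_scheme \<Rightarrow> 'a set \<Rightarrow> (nat \<Rightarrow> 'a set) ring"
  where "adic_completion R I =
    \<lparr>carrier = {f. (\<forall>n. f n \<in> carrier (R Quot ideal_power R I n)) \<and> (\<forall>n. f (Suc n) \<subseteq> f n)},
     mult = (\<lambda>f g n. f n \<otimes>\<^bsub>R Quot ideal_power R I n\<^esub> g n),
     one = (\<lambda>n. \<one>\<^bsub>R Quot ideal_power R I n\<^esub>),
     zero = (\<lambda>n. \<zero>\<^bsub>R Quot ideal_power R I n\<^esub>),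
     add = (\<lambda>f g n. f n \<oplus>\<^bsub>R Quot ideal_power R I n\<^esub> g n)\<rparr>"

definition completion :: "('a, 'm) ring_scheme \<Rightarrow> (nat \<Rightarrow> 'a set) ring"
  where "completion R = adic_completion R (max_ideal R)"

definition to_completion :: "('a, 'm) ring_scheme \<Rightarrow> 'a \<Rightarrow> nat \<Rightarrow> 'a set"
  where "to_completion R a = (\<lambda>n. ideal_power R (max_ideal R) n +>\<^bsub>R\<^esub> a)"

text \<open>
  For a local inclusion of A into V, the canonical map of completions sends, in degree n, the
  coset of a modulo the n-th power of the maximal ideal of A to the coset of a modulo the n-th
  power of the maximal ideal of V; the latter is the sum of the former and that power.
\<close>

definition completion_map :: "('a, 'm) ring_scheme \<Rightarrow> (nat \<Rightarrow> 'a set) \<Rightarrow> nat \<Rightarrow> 'a set"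
  where "completion_map V f = (\<lambda>n. ideal_power V (max_ideal V) n <+>\<^bsub>V\<^esub> f n)"


section \<open>Tight domination\<close>

abbreviation subring_of :: "('a, 'm) ring_scheme \<Rightarrow> 'a set \<Rightarrow> ('a, 'm) ring_scheme"
  where "subring_of F A \<equiv> F\<lparr>carrier := A\<rparr>"

definition is_quotient_field :: "('a, 'm) ring_scheme \<Rightarrow> 'a set \<Rightarrow> bool"
  where "is_quotient_field F A \<longleftrightarrow> field F \<and> subring A F \<and>
    carrier F = {a \<otimes>\<^bsub>F\<^esub> inv\<^bsub>F\<^esub> b | a b. a \<in> A \<and> b \<in> A - {\<zero>\<^bsub>F\<^esub>}}"

definition finite_module :: "('a, 'm) ring_scheme \<Rightarrow> ('a, 'b, 'n) module_scheme \<Rightarrow> bool"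
  where "finite_module R M \<longleftrightarrow> module R M \<and>
    (\<exists>S. finite S \<and> S \<subseteq> carrier M \<and>
      (\<forall>x \<in> carrier M. \<exists>c \<in> S \<rightarrow> carrier R. x = (\<Oplus>\<^bsub>M\<^esub>s\<in>S. c s \<odot>\<^bsub>M\<^esub> s)))"

text \<open>The quotient of R by I, with scalars acting through their residue classes.\<close>

definition quotient_module :: "('a, 'm) ring_scheme \<Rightarrow> 'a set \<Rightarrow> ('a, 'a set) module"
  where "quotient_module R I =
    \<lparr>carrier = carrier (R Quot I), mult = mult (R Quot I), one = one (R Quot I),
     zero = zero (R Quot I), add = add (R Quot I),
     smult = (\<lambda>a C. (I +>\<^bsub>R\<^esub> a) \<otimes>\<^bsub>R Quot I\<^esub> C)\<rparr>"

text \<open>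
  A and V are subrings of an ambient field F, which is required to be the quotient field of both.
\<close>

definition tightly_dominates :: "('a, 'm) ring_scheme \<Rightarrow> 'a set \<Rightarrow> 'a set \<Rightarrow> bool"
  where "tightly_dominates F V A \<longleftrightarrow>
    (let m = max_ideal (subring_of F A); mV = genideal (subring_of F V) m in
      A \<subseteq> V \<and> is_quotient_field F A \<and> is_quotient_field F V \<and>
      m \<subseteq> max_ideal (subring_of F V) \<and>
      finite_module (subring_of F A) (quotient_module (subring_of F V) mV) \<and>
      V = A <+>\<^bsub>F\<^esub> mV)"


section \<open>The intersection of the quotient field with a quotient of the completion\<close>

text \<open>
  Let I be an ideal of the completion of A whose associated primes contract to 0 in A.  Then
  nonzero elements b of A are regular modulo I, and a fraction a / b of F lies in the quotient of
  the completion by I, inside the total quotient ring of the latter, if and only if a lies in the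
  sum of I and the principal ideal generated by b.
\<close>

definition field_inter_completion_quot ::
    "('a, 'm) ring_scheme \<Rightarrow> 'a set \<Rightarrow> (nat \<Rightarrow> 'a set) set \<Rightarrow> 'a set"
  where "field_inter_completion_quot F A I =
    (let Ahat = completion (subring_of F A); \<iota> = to_completion (subring_of F A) in
      {a \<otimes>\<^bsub>F\<^esub> inv\<^bsub>F\<^esub> b | a b. a \<in> A \<and> b \<in> A - {\<zero>\<^bsub>F\<^esub>} \<and>
         \<iota> a \<in> cgenideal Ahat (\<iota> b) <+>\<^bsub>Ahat\<^esub> I})"

end

theory Submission
  imports Defs
begin

text \<open>
  Let \<open>m\<close> and \<open>n\<close> be the maximal ideals of \<open>A\<close> and \<open>V\<close>, and let \<open>S\<close> be the completion of \<open>A\<close>.  Tight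
  domination forces \<open>n = m V\<close>, so \<open>n = t V\<close> for some \<open>t\<close> in \<open>m\<close>, and \<open>V = A + t V\<close>.  Hence \<open>S\<close> maps onto
  the completion of \<open>V\<close>: the quotient \<open>S / P\<close> is a discrete valuation ring with uniformizer \<open>t\<close>, and
  the maximal ideal of \<open>S\<close> is \<open>t S + P\<close> (lemma \<open>dvr_quotient_completion\<close>).  Moreover \<open>P\<close> is finitely
  generated: subtracting multiples of \<open>t\<close> from generators of \<open>m\<close> gives elements of \<open>P\<close> that generate \<open>P\<close>
  modulo \<open>t P\<close>, and completeness does the rest (lemma \<open>P_finitely_generated\<close>).

  Put \<open>Q = P\<^sup>(\<^sup>2\<^sup>)\<close>.  The module \<open>P / Q\<close> is finitely generated and torsion-free over \<open>S / P\<close>, hence free.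
  Let \<open>G\<close> lift a basis.  Both embedding dimensions are read off from \<open>G\<close>.  Localizing at \<open>P\<close> extends
  the scalars of \<open>P / Q\<close> to the fraction field of \<open>S / P\<close>, and the result is the cotangent space of the
  localization; so its embedding dimension is the size of \<open>G\<close> (lemma \<open>embedding_dimension_localization\<close>).
  The cotangent space of \<open>S / Q\<close> has the basis \<open>t\<close> and \<open>G\<close>.  Since \<open>t\<^sup>2 S + Q\<close> contains a power of the
  maximal ideal, \<open>S = A + t\<^sup>2 S + Q\<close>.  So \<open>R\<close> and \<open>S / Q\<close> have the same quotient by \<open>t\<^sup>2\<close>, and with it the
  same cotangent space (lemma \<open>embedding_dimension_R\<close>).

  That all minimal generating sets of the maximal ideal have the size of a basis of the cotangent
  space (lemma \<open>has_embedding_dimension_basis\<close>) comes from the exchange property of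
  generation modulo the square of the maximal ideal.
\<close>


section \<open>Maximal ideals and units\<close>

lemma (in cring) proper_ideal_in_maximalideal:
  assumes I: "ideal I R" "\<one> \<notin> I"
  obtains M where "maximalideal M R" "I \<subseteq> M"
proof -
  let ?A = "{J. ideal J R \<and> I \<subseteq> J \<and> \<one> \<notin> J}"
  have "\<exists>M\<in>?A. \<forall>X\<in>?A. M \<subseteq> X \<longrightarrow> X = M"
  proof (rule subset_Zorn_nonempty)
    show "?A \<noteq> {}" using I by blast
    fix C assume C: "C \<noteq> {}" "subset.chain ?A C"
    have "subset.chain {J. ideal J R} C"
      using C unfolding subset.chain_def by auto
    then have "ideal (\<Union>C) R" using chain_Union_is_ideal[of C] C(1) by auto
    moreover have "\<forall>J\<in>C. I \<subseteq> J \<and> \<one> \<notin> J"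
      using C unfolding subset.chain_def by auto
    then have "I \<subseteq> \<Union>C" "\<one> \<notin> \<Union>C" using C(1) by blast+
    ultimately show "\<Union>C \<in> ?A" by blast
  qed
  then obtain M where M: "ideal M R" "I \<subseteq> M" "\<one> \<notin> M"
    and max: "\<And>X. ideal X R \<Longrightarrow> \<one> \<notin> X \<Longrightarrow> M \<subseteq> X \<Longrightarrow> X = M" by auto
  have "maximalideal M R"
    using M max ideal.one_imp_carrier by (intro maximalidealI) blast+
  with M that show ?thesis by blast
qed

lemma max_ideal_maximalideal:
  "quasilocal_ring R \<Longrightarrow> maximalideal (max_ideal R) R"
  unfolding quasilocal_ring_def max_ideal_def by (metis theI')

lemma quasilocal_Units:
  assumes "quasilocal_ring R" "x \<in> carrier R" "x \<notin> max_ideal R"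
  shows "x \<in> Units R"
proof -
  interpret cring R using assms unfolding quasilocal_ring_def by blast
  have "\<one>\<^bsub>R\<^esub> \<in> PIdl\<^bsub>R\<^esub> x"
  proof (rule ccontr)
    assume "\<one>\<^bsub>R\<^esub> \<notin> PIdl\<^bsub>R\<^esub> x"
    then obtain M where M: "maximalideal M R" "PIdl\<^bsub>R\<^esub> x \<subseteq> M"
      using proper_ideal_in_maximalideal cgenideal_ideal assms(2) by metis
    then have "M = max_ideal R"
      using assms(1) max_ideal_maximalideal unfolding quasilocal_ring_def by blast
    with M assms show False using cgenideal_self by blast
  qed
  then obtain y where "y \<in> carrier R" "y \<otimes>\<^bsub>R\<^esub> x = \<one>\<^bsub>R\<^esub>"
    unfolding cgenideal_def by auto
  moreover from this have "x \<otimes>\<^bsub>R\<^esub> y = \<one>\<^bsub>R\<^esub>" using m_comm assms(2) by simp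
  ultimately show ?thesis using assms(2) unfolding Units_def by blast
qed

lemma quasilocalI:
  assumes "cring R" "ideal N R" "\<one>\<^bsub>R\<^esub> \<notin> N"
    and units: "\<And>x. x \<in> carrier R \<Longrightarrow> x \<notin> N \<Longrightarrow> x \<in> Units R"
  shows "quasilocal_ring R" and "max_ideal R = N"
proof -
  interpret cring R by fact
  interpret N: ideal N R by fact
  have proper: "J \<subseteq> N" if J: "ideal J R" "J \<noteq> carrier R" for J
  proof
    interpret J: ideal J R by fact
    fix x assume x: "x \<in> J"
    show "x \<in> N"
    proof (rule ccontr)
      assume "x \<notin> N"
      then have "x \<in> Units R" using units x J.Icarr by blast
      then have "inv\<^bsub>R\<^esub> x \<otimes>\<^bsub>R\<^esub> x = \<one>\<^bsub>R\<^esub>" "inv\<^bsub>R\<^esub> x \<in> carrier R" by auto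
      then have "\<one>\<^bsub>R\<^esub> \<in> J" using J.I_l_closed x by metis
      then show False using J.one_imp_carrier J by blast
    qed
  qed
  have max: "maximalideal N R"
    using assms(2,3) proper by (intro maximalidealI) auto
  have uniq: "M = N" if "maximalideal M R" for M
  proof -
    interpret M: maximalideal M R by fact
    have "M \<subseteq> N" using proper M.ideal_axioms M.I_notcarr by metis
    then show ?thesis using M.I_maximal[of N] assms(2,3) N.a_subset by auto
  qed
  show "quasilocal_ring R" unfolding quasilocal_ring_def
    using max uniq is_cring by blast
  show "max_ideal R = N" unfolding max_ideal_def
    using max uniq by (rule the_equality)
qed

section \<open>Minimal generating sets\<close>

lemma set_add_closedI:
  fixes R (structure)
  shows "a \<in> I \<Longrightarrow> b \<in> J \<Longrightarrow> a \<oplus> b \<in> I <+>\<^bsub>R\<^esub> J"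
  unfolding set_add_def' by auto

lemma (in cring) genideal_insert:
  assumes "x \<in> carrier R" "U \<subseteq> carrier R"
  shows "y \<in> Idl (insert x U) \<longleftrightarrow> (\<exists>c\<in>carrier R. \<exists>z\<in>Idl U. y = c \<otimes> x \<oplus> z)"
proof -
  have I: "ideal (PIdl x) R" "ideal (Idl U) R"
    using assms by (auto intro: cgenideal_ideal genideal_ideal)
  have "Idl (insert x U) = PIdl x <+> Idl U"
  proof
    have "x \<in> PIdl x <+> Idl U"
      using cgenideal_self[OF assms(1)] additive_subgroup.zero_closed[OF ideal.axioms(1)[OF I(2)]] assms(1)
      unfolding set_add_def' by fastforce
    moreover have "U \<subseteq> PIdl x <+> Idl U"
      using genideal_self[OF assms(2)] additive_subgroup.zero_closed[OF ideal.axioms(1)[OF I(1)]] assms(2)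
      unfolding set_add_def' by fastforce
    ultimately show "Idl (insert x U) \<subseteq> PIdl x <+> Idl U"
      by (intro genideal_minimal add_ideals I) auto
    have J: "ideal (Idl (insert x U)) R" using assms by (auto intro: genideal_ideal)
    have "PIdl x \<subseteq> Idl (insert x U)" "Idl U \<subseteq> Idl (insert x U)"
      using assms genideal_self[of "insert x U"] J subset_Idl_subset[of "insert x U" U]
        cgenideal_minimal[OF J] by auto
    then show "PIdl x <+> Idl U \<subseteq> Idl (insert x U)"
      using additive_subgroup.a_closed[OF ideal.axioms(1)[OF J]] unfolding set_add_def' by auto
  qed
  then show ?thesis unfolding set_add_def' cgenideal_def by auto
qed

text \<open>A closure operator with the exchange property, that is, a matroid.  Applied to generation modulo
  the square of the maximal ideal of a local ring, it compares the sizes of generating sets without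
  forming the cotangent space over the residue field.\<close>

locale exchange_closure =
  fixes E :: "'a set" and cl :: "'a set \<Rightarrow> 'a set"
  assumes extensive: "T \<subseteq> E \<Longrightarrow> T \<subseteq> cl T"
    and closed: "T \<subseteq> E \<Longrightarrow> cl T \<subseteq> E"
    and mono: "T \<subseteq> U \<Longrightarrow> U \<subseteq> E \<Longrightarrow> cl T \<subseteq> cl U"
    and idem: "T \<subseteq> E \<Longrightarrow> cl (cl T) \<subseteq> cl T"
    and exchange: "T \<subseteq> E \<Longrightarrow> x \<in> E \<Longrightarrow> y \<in> cl (insert x T) \<Longrightarrow> y \<notin> cl T \<Longrightarrow> x \<in> cl (insert y T)"
begin

definition indep :: "'a set \<Rightarrow> bool"
  where "indep S \<longleftrightarrow> S \<subseteq> E \<and> (\<forall>x\<in>S. x \<notin> cl (S - {x}))"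

lemma indep_subset: "indep S \<Longrightarrow> T \<subseteq> S \<Longrightarrow> indep T"
  unfolding indep_def
proof (intro conjI ballI)
  assume S: "S \<subseteq> E \<and> (\<forall>x\<in>S. x \<notin> cl (S - {x}))" and T: "T \<subseteq> S"
  show "T \<subseteq> E" using S T by blast
  fix x assume x: "x \<in> T"
  have "cl (T - {x}) \<subseteq> cl (S - {x})" using S T by (intro mono) auto
  then show "x \<notin> cl (T - {x})" using S T x by blast
qed

lemma indep_insert:
  assumes J: "indep J" and g: "g \<in> E" "g \<notin> cl J"
  shows "indep (insert g J)"
  unfolding indep_def
proof (intro conjI ballI)
  have JE: "J \<subseteq> E" using J indep_def by blast
  then show "insert g J \<subseteq> E" using g by blast
  have gJ: "g \<notin> J" using extensive[OF JE] g by blast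
  fix x assume x: "x \<in> insert g J"
  show "x \<notin> cl (insert g J - {x})"
  proof (cases "x = g")
    case True
    then show ?thesis using g gJ by simp
  next
    case False
    show ?thesis
    proof
      assume "x \<in> cl (insert g J - {x})"
      then have "x \<in> cl (insert g (J - {x}))" using False by (simp add: insert_Diff_if)
      moreover have "x \<notin> cl (J - {x})" using J x False indep_def by blast
      ultimately have "g \<in> cl (insert x (J - {x}))" using exchange JE g by (metis Diff_subset subset_trans)
      then show False using g x False by (simp add: insert_absorb)
    qed
  qed
qed

text \<open>Steinitz exchange: the elements of \<open>S\<close> outside \<open>G\<close> are traded one by one for elements of \<open>G\<close>,
  which keeps \<open>S\<close> independent and does not change its size.\<close>

lemma indep_card_le_finite:
  assumes G: "finite G" "G \<subseteq> E" and "indep S" "finite S" "S \<subseteq> cl G"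
  shows "card S \<le> card G"
  using assms(3-)
proof (induction "card (S - G)" arbitrary: S rule: less_induct)
  case less
  show ?case
  proof (cases "S \<subseteq> G")
    case True
    then show ?thesis using G card_mono by blast
  next
    case False
    then obtain x where x: "x \<in> S" "x \<notin> G" by blast
    let ?J = "S - {x}"
    have SE: "S \<subseteq> E" using less.prems indep_def by blast
    have J: "indep ?J" using indep_subset less.prems by blast
    have "\<not> G \<subseteq> cl ?J"
    proof
      assume "G \<subseteq> cl ?J"
      then have "cl G \<subseteq> cl (cl ?J)" using mono closed SE by (metis Diff_subset subset_trans)
      then have "x \<in> cl ?J" using idem[of ?J] SE less.prems x by blast
      then show False using less.prems x indep_def by blast
    qed
    then obtain g where g: "g \<in> G" "g \<notin> cl ?J" by blast
    then have gS: "g \<notin> ?J" using extensive[of ?J] SE by blast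
    let ?S = "insert g ?J"
    have "card (?S - G) < card (S - G)"
      using less.prems x g by (intro psubset_card_mono) auto
    moreover have "indep ?S" using indep_insert J g G by blast
    moreover have "?S \<subseteq> cl G" using less.prems extensive G g by blast
    ultimately have "card ?S \<le> card G" by (intro less.hyps) (use less.prems(2) in simp_all)
    moreover have "card ?S = card S" using gS less.prems(2) x(1)
        card_insert_disjoint[of ?J g] card_Suc_Diff1[of S x] by simp
    ultimately show ?thesis by simp
  qed
qed

lemma indep_card_le:
  assumes G: "finite G" "G \<subseteq> E" and S: "indep S" "S \<subseteq> cl G"
  shows "finite S" "card S \<le> card G"
proof -
  show "finite S"
  proof (rule ccontr)
    assume "infinite S"
    then obtain T where T: "T \<subseteq> S" "finite T" "card T = Suc (card G)"
      using infinite_arbitrarily_large by metis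
    then show False using indep_card_le_finite[OF G indep_subset[OF S(1) T(1)]] S by auto
  qed
  then show "card S \<le> card G" by (rule indep_card_le_finite[OF G S(1) _ S(2)])
qed

end

locale local_ring = cring R for R (structure) +
  fixes N
  assumes N: "ideal N R" and one_notin: "\<one> \<notin> N"
    and Units_N: "x \<in> carrier R \<Longrightarrow> x \<notin> N \<Longrightarrow> x \<in> Units R"
begin

sublocale N: ideal N R by (rule N)

lemma max_ideal_N: "max_ideal R = N" and quasilocal_N: "quasilocal_ring R"
  using quasilocalI[OF is_cring N one_notin Units_N] by blast+

text \<open>A set spans the cotangent space \<open>N / N\<^sup>2\<close> if its closure contains \<open>N\<close>, and \<open>indep\<close> below means
  linear independence there.\<close>

definition cl :: "'a set \<Rightarrow> 'a set"
  where "cl T = Idl (T \<union> N \<cdot> N)"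

lemma NN: "ideal (N \<cdot> N) R" "N \<cdot> N \<subseteq> N" "N \<cdot> N \<subseteq> carrier R"
  using ideal_prod_is_ideal[OF N N] ideal_prod_inter[OF N N] ideal_prod_in_carrier[OF N N] by auto

lemma cl_ideal: "T \<subseteq> carrier R \<Longrightarrow> ideal (cl T) R"
  unfolding cl_def using NN by (auto intro: genideal_ideal)

lemma cl_self: "T \<subseteq> carrier R \<Longrightarrow> T \<subseteq> cl T" "T \<subseteq> carrier R \<Longrightarrow> N \<cdot> N \<subseteq> cl T"
  unfolding cl_def using NN genideal_self[of "T \<union> N \<cdot> N"] by auto

lemma cl_least: "ideal J R \<Longrightarrow> T \<subseteq> J \<Longrightarrow> N \<cdot> N \<subseteq> J \<Longrightarrow> cl T \<subseteq> J"
  unfolding cl_def by (intro genideal_minimal) auto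

lemma genideal_subset_cl: "T \<subseteq> carrier R \<Longrightarrow> Idl T \<subseteq> cl T"
  using cl_self cl_ideal genideal_minimal by metis

lemma unit_solve:
  assumes c: "c \<in> carrier R" "c \<notin> N" and x: "x \<in> carrier R" and J: "ideal J R" "c \<otimes> x \<in> J"
  shows "x \<in> J"
proof -
  have "c \<in> Units R" using c Units_N by blast
  then have i: "inv c \<in> carrier R" "inv c \<otimes> c = \<one>" by auto
  then have "inv c \<otimes> (c \<otimes> x) \<in> J" using J ideal.I_l_closed by metis
  then show ?thesis using i c x by (simp add: m_assoc[symmetric])
qed

sublocale exchange_closure N cl
proof
  show ext: "T \<subseteq> cl T" if "T \<subseteq> N" for T using cl_self that N.a_subset by blast
  show closed: "cl T \<subseteq> N" if "T \<subseteq> N" for T using cl_least N NN that by blast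
  show "cl T \<subseteq> cl U" if "T \<subseteq> U" "U \<subseteq> N" for T U
  proof -
    have "U \<subseteq> carrier R" using that N.a_subset by blast
    then show ?thesis using that cl_self[of U] cl_ideal[of U] by (intro cl_least) auto
  qed
  show "cl (cl T) \<subseteq> cl T" if "T \<subseteq> N" for T
  proof -
    have "T \<subseteq> carrier R" using that N.a_subset by blast
    then show ?thesis using cl_self[of T] cl_ideal[of T] by (intro cl_least) auto
  qed
  fix T x y assume T: "T \<subseteq> N" "x \<in> N" and y: "y \<in> cl (insert x T)" "y \<notin> cl T"
  have Tc: "T \<subseteq> carrier R" "x \<in> carrier R" using T N.a_subset by auto
  have "cl (insert x T) = Idl (insert x (T \<union> N \<cdot> N))" unfolding cl_def by simp
  then obtain c z where c: "c \<in> carrier R" and z: "z \<in> cl T" and yc: "y = c \<otimes> x \<oplus> z"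
    using y genideal_insert[of x "T \<union> N \<cdot> N"] Tc NN unfolding cl_def by auto
  interpret T: ideal "cl T" R using cl_ideal Tc by blast
  have "c \<notin> N"
  proof
    assume "c \<in> N"
    then have "c \<otimes> x \<in> cl T" using T cl_self[OF Tc(1)] ideal_prod.prod[of c N x N R] by blast
    then show False using y yc z by simp
  qed
  have yc': "y \<in> carrier R" using yc c z Tc T.Icarr by auto
  then have iT: "insert y T \<subseteq> carrier R" using Tc by auto
  interpret U: ideal "cl (insert y T)" R using cl_ideal[OF iT] .
  have "cl T \<subseteq> cl (insert y T)" using cl_self[OF iT] by (intro cl_least U.ideal_axioms) auto
  then have "z \<in> cl (insert y T)" "y \<in> cl (insert y T)" using z cl_self[OF iT] by auto
  then have "y \<ominus> z \<in> cl (insert y T)" unfolding a_minus_def by auto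
  moreover have "y \<ominus> z = c \<otimes> x" using yc c Tc T.Icarr[OF z] by algebra
  ultimately show "x \<in> cl (insert y T)" using unit_solve[OF c \<open>c \<notin> N\<close> Tc(2) U.ideal_axioms] by simp
qed

text \<open>Nakayama's lemma for one redundant generator: if \<open>x\<close> lies in the ideal \<open>J\<close> generated
  by the others plus \<open>N \<cdot> N\<close>, then it lies in \<open>J + N x\<close>, and \<open>1 - n\<close> is a unit for \<open>n \<in> N\<close>.\<close>

lemma minimal_generating_set_indep:
  assumes "minimal_generating_set R N S"
  shows "indep S"
proof -
  have S: "S \<subseteq> carrier R" "Idl S = N" and min: "\<And>T. T \<subset> S \<Longrightarrow> Idl T \<noteq> N"
    using assms unfolding minimal_generating_set_def by auto
  have SN: "S \<subseteq> N" using S genideal_self by blast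
  have "x \<notin> cl (S - {x})" if x: "x \<in> S" for x
  proof
    assume xcl: "x \<in> cl (S - {x})"
    let ?T = "S - {x}"
    have T: "?T \<subseteq> carrier R" and xc: "x \<in> carrier R" using S x by auto
    interpret J: ideal "Idl ?T" R using genideal_ideal T by blast
    have iT: "insert x ?T = S" using x by blast
    let ?K = "N \<cdot> (PIdl x) <+>\<^bsub>R\<^esub> Idl ?T"
    have P: "ideal (PIdl x) R" using cgenideal_ideal xc .
    have NP: "ideal (N \<cdot> (PIdl x)) R" using ideal_prod_is_ideal N P .
    interpret K: ideal ?K R by (rule add_ideals[OF NP J.ideal_axioms])
    have sub1: "y \<in> ?K" if y: "y \<in> N \<cdot> (PIdl x)" for y
      using set_add_closedI[where R = R, OF y J.zero_closed] ideal.Icarr[OF NP y] by simp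
    have sub2: "z \<in> ?K" if z: "z \<in> Idl ?T" for z
      using set_add_closedI[where R = R, OF additive_subgroup.zero_closed[OF ideal.axioms(1)[OF NP]] z]
        J.Icarr[OF z] by simp
    have "N \<cdot> N \<subseteq> ?K"
    proof
      fix y assume "y \<in> N \<cdot> N"
      then show "y \<in> ?K"
      proof (induction rule: ideal_prod.induct)
        case (prod i j)
        then obtain c z where c: "c \<in> carrier R" and z: "z \<in> Idl ?T" and i: "i = c \<otimes> x \<oplus> z"
          using genideal_insert[OF xc T] S iT by auto
        have j: "j \<in> carrier R" using prod N.Icarr by blast
        have "j \<otimes> x \<in> ?K"
          using sub1 prod(2) cgenideal_self[OF xc] ideal_prod.prod[of j N x "PIdl x" R] by blast
        then have "c \<otimes> (j \<otimes> x) \<oplus> j \<otimes> z \<in> ?K"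
          using c j z sub2 J.I_l_closed K.I_l_closed by (intro K.a_closed) auto
        moreover have "c \<otimes> (j \<otimes> x) \<oplus> j \<otimes> z = i \<otimes> j"
          unfolding i using c j xc J.Icarr[OF z] by algebra
        ultimately show ?case by simp
      qed auto
    qed
    then have "cl ?T \<subseteq> ?K"
      using genideal_self[OF T] sub2 by (intro cl_least K.ideal_axioms) auto
    then obtain y z where y: "y \<in> N \<cdot> (PIdl x)" and z: "z \<in> Idl ?T" and xyz: "x = y \<oplus> z"
      using xcl unfolding set_add_def' by auto
    have "\<exists>n\<in>N. y = n \<otimes> x" using y
    proof (induction rule: ideal_prod.induct)
      case (prod i j)
      then obtain r where r: "r \<in> carrier R" "j = r \<otimes> x" unfolding cgenideal_def by auto
      then have "i \<otimes> j = (i \<otimes> r) \<otimes> x" using N.Icarr prod xc by (simp add: m_assoc)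
      then show ?case using N.I_r_closed prod r by blast
    next
      case (sum s1 s2)
      then obtain n1 n2 where n: "n1 \<in> N" "n2 \<in> N" and eq: "s1 = n1 \<otimes> x" "s2 = n2 \<otimes> x" by blast
      have "s1 \<oplus> s2 = (n1 \<oplus> n2) \<otimes> x" unfolding eq using n xc N.Icarr by (simp add: l_distr)
      then show ?case using n by blast
    qed
    then obtain n where n: "n \<in> N" "y = n \<otimes> x" by blast
    have nc: "n \<in> carrier R" using n N.Icarr by blast
    have "(\<one> \<ominus> n) \<otimes> x = x \<ominus> y" unfolding n using nc xc by algebra
    also have "\<dots> = (y \<oplus> z) \<ominus> y" using xyz by simp
    also have "\<dots> = z" unfolding n using nc xc J.Icarr[OF z] by algebra
    finally have "(\<one> \<ominus> n) \<otimes> x \<in> Idl ?T" using z by simp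
    moreover have "\<one> \<ominus> n \<notin> N"
    proof
      assume "\<one> \<ominus> n \<in> N"
      then have "(\<one> \<ominus> n) \<oplus> n \<in> N" using n by auto
      moreover have "(\<one> \<ominus> n) \<oplus> n = \<one>" using nc by algebra
      ultimately show False using one_notin by simp
    qed
    ultimately have "x \<in> Idl ?T"
      using unit_solve[OF minus_closed[OF one_closed nc] _ xc J.ideal_axioms] by blast
    then have "S \<subseteq> Idl ?T" using genideal_self[OF T] iT by blast
    then have "N \<subseteq> Idl ?T" using S genideal_minimal[OF J.ideal_axioms] by auto
    moreover have "Idl ?T \<subseteq> N" using SN genideal_minimal[OF N] by blast
    ultimately show False using min[of ?T] x by blast
  qed
  then show ?thesis using SN unfolding indep_def by blast
qed

lemma finite_contains_minimal_generating_set: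
  assumes "finite Y" "Y \<subseteq> carrier R" "Idl Y = I"
  shows "\<exists>S\<subseteq>Y. minimal_generating_set R I S"
  using assms
proof (induction Y rule: finite_psubset_induct)
  case (psubset Y)
  show ?case
  proof (cases "minimal_generating_set R I Y")
    case False
    then obtain T where "T \<subset> Y" "Idl T = I"
      using psubset.prems unfolding minimal_generating_set_def by blast
    then show ?thesis using psubset.IH[of T] psubset.prems by blast
  qed blast
qed

text \<open>A minimal generating set and a basis of the cotangent space are both independent and
  spanning, so they have the same size.  The set \<open>Y\<close> witnesses that \<open>N\<close> is finitely
  generated, and so takes the place of Nakayama's lemma, by which \<open>G\<close> itself would generate \<open>N\<close>.\<close>

lemma has_embedding_dimension_basis:
  assumes Y: "finite Y" "Y \<subseteq> carrier R" "Idl Y = N"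
    and G: "indep G" "finite G" "N \<subseteq> cl G"
  shows "has_embedding_dimension R (card G)"
proof -
  have "finite S \<and> card S = card G" if S: "minimal_generating_set R N S" for S
  proof -
    have iS: "indep S" using minimal_generating_set_indep S .
    have GN: "G \<subseteq> N" "S \<subseteq> N" using G iS indep_def by auto
    have S': "finite S" "card S \<le> card G" using indep_card_le[OF G(2) GN(1) iS] GN(2) G(3) by auto
    have "N \<subseteq> cl S" using S genideal_subset_cl[of S] unfolding minimal_generating_set_def by auto
    then have "card G \<le> card S" using indep_card_le[OF S'(1) GN(2) G(1)] GN(1) by auto
    with S' show ?thesis by simp
  qed
  then have "\<forall>S. minimal_generating_set R N S \<longrightarrow> finite S \<and> card S = card G" by blast
  moreover have "\<exists>S. minimal_generating_set R N S"
    using finite_contains_minimal_generating_set[OF Y] by blast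
  ultimately show ?thesis
    using quasilocal_N
    by (simp only: has_embedding_dimension_def max_ideal_N simp_thms)
qed

end

section \<open>Localization\<close>

locale mult_closed = cring R for R (structure) +
  fixes S
  assumes S_sub: "S \<subseteq> carrier R" and S_one: "\<one> \<in> S"
    and S_mult: "s \<in> S \<Longrightarrow> t \<in> S \<Longrightarrow> s \<otimes> t \<in> S"
begin

abbreviation L where "L \<equiv> localization R S"
abbreviation frac where "frac \<equiv> loc_frac R S"

lemma S_carr [simp]: "s \<in> S \<Longrightarrow> s \<in> carrier R" using S_sub by blast
declare S_one [simp] S_mult [simp]

lemma loc_rel_iff:
  "((r, s), (r', s')) \<in> loc_rel R S \<longleftrightarrow>
     r \<in> carrier R \<and> s \<in> S \<and> r' \<in> carrier R \<and> s' \<in> S \<and>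
     (\<exists>t\<in>S. t \<otimes> (r \<otimes> s') = t \<otimes> (r' \<otimes> s))"
proof -
  have "t \<otimes> (a \<ominus> b) = \<zero> \<longleftrightarrow> t \<otimes> a = t \<otimes> b"
    if "t \<in> carrier R" "a \<in> carrier R" "b \<in> carrier R" for t a b
  proof -
    have "t \<otimes> (a \<ominus> b) = t \<otimes> a \<ominus> t \<otimes> b" using that by algebra
    then show ?thesis using that by simp
  qed
  then show ?thesis unfolding loc_rel_def by auto
qed

lemma equiv_loc_rel: "equiv (carrier R \<times> S) (loc_rel R S)"
proof (rule equivI)
  show "loc_rel R S \<subseteq> (carrier R \<times> S) \<times> (carrier R \<times> S)" unfolding loc_rel_def by auto
  show "refl_on (carrier R \<times> S) (loc_rel R S)"
    unfolding refl_on_def using S_one by (auto simp: loc_rel_iff)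
  show "sym (loc_rel R S)"
    unfolding sym_def by (auto simp: loc_rel_iff) metis
  show "trans (loc_rel R S)"
  proof (rule transI, clarify)
    fix r s r' s' r'' s''
    assume "((r, s), (r', s')) \<in> loc_rel R S" "((r', s'), (r'', s'')) \<in> loc_rel R S"
    then obtain t u where c [simp]: "r \<in> carrier R" "s \<in> S" "r' \<in> carrier R" "s' \<in> S"
      "r'' \<in> carrier R" "s'' \<in> S" "t \<in> S" "u \<in> S"
      and t: "t \<otimes> (r \<otimes> s') = t \<otimes> (r' \<otimes> s)" and u: "u \<otimes> (r' \<otimes> s'') = u \<otimes> (r'' \<otimes> s')"
      by (auto simp: loc_rel_iff)
    have "(t \<otimes> u \<otimes> s') \<otimes> (r \<otimes> s'') = u \<otimes> s'' \<otimes> (t \<otimes> (r \<otimes> s'))" by (simp add: m_ac)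
    also have "\<dots> = t \<otimes> s \<otimes> (u \<otimes> (r' \<otimes> s''))" unfolding t by (simp add: m_ac)
    also have "\<dots> = (t \<otimes> u \<otimes> s') \<otimes> (r'' \<otimes> s)" unfolding u by (simp add: m_ac)
    finally show "((r, s), (r'', s'')) \<in> loc_rel R S"
      unfolding loc_rel_iff using S_mult by (intro conjI bexI[of _ "t \<otimes> u \<otimes> s'"]) auto
  qed
qed

lemma frac_eq_iff:
  assumes "r \<in> carrier R" "s \<in> S" "r' \<in> carrier R" "s' \<in> S"
  shows "frac r s = frac r' s' \<longleftrightarrow> (\<exists>t\<in>S. t \<otimes> (r \<otimes> s') = t \<otimes> (r' \<otimes> s))"
proof -
  have "frac r s = frac r' s' \<longleftrightarrow> ((r, s), (r', s')) \<in> loc_rel R S"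
    unfolding loc_frac_def using assms by (intro eq_equiv_class_iff[OF equiv_loc_rel]) auto
  then show ?thesis using assms by (simp add: loc_rel_iff)
qed

lemma frac_eqI:
  assumes "r \<in> carrier R" "s \<in> S" "r' \<in> carrier R" "s' \<in> S" "r \<otimes> s' = r' \<otimes> s"
  shows "frac r s = frac r' s'"
  using assms S_one by (subst frac_eq_iff) auto

lemma frac_cancel:
  assumes "r \<in> carrier R" "s \<in> S" "t \<in> S"
  shows "frac (t \<otimes> r) (t \<otimes> s) = frac r s"
  using assms by (intro frac_eqI) (auto simp: m_ac)

lemma frac_carr [simp]: "r \<in> carrier R \<Longrightarrow> s \<in> S \<Longrightarrow> frac r s \<in> carrier L"
  unfolding localization_def loc_frac_def by (auto intro: quotientI)

lemma carrierE:
  assumes "x \<in> carrier L"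
  obtains r s where "r \<in> carrier R" "s \<in> S" "x = frac r s"
  using assms unfolding localization_def loc_frac_def by (auto elim!: quotientE)

lemma one_frac: "\<one>\<^bsub>L\<^esub> = frac \<one> \<one>" and zero_frac: "\<zero>\<^bsub>L\<^esub> = frac \<zero> \<one>"
  by (simp_all add: localization_def)

lemma mult_frac:
  assumes "r \<in> carrier R" "s \<in> S" "r' \<in> carrier R" "s' \<in> S"
  shows "frac r s \<otimes>\<^bsub>L\<^esub> frac r' s' = frac (r \<otimes> r') (s \<otimes> s')"
proof -
  let ?f = "\<lambda>p q. frac (fst p \<otimes> fst q) (snd p \<otimes> snd q)"
  have "congruent2 (loc_rel R S) (loc_rel R S) ?f"
  proof (rule congruent2_commuteI[OF equiv_loc_rel])
    fix y z assume "y \<in> carrier R \<times> S" "z \<in> carrier R \<times> S"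
    then show "?f y z = ?f z y" by (auto simp: m_comm)
  next
    fix y z w assume w: "w \<in> carrier R \<times> S" and yz: "(y, z) \<in> loc_rel R S"
    obtain a b where w': "w = (a, b)" and c [simp]: "a \<in> carrier R" "b \<in> S" using w by auto
    obtain r s r' s' t where yz': "y = (r, s)" "z = (r', s')" 
      and d [simp]: "r \<in> carrier R" "s \<in> S" "r' \<in> carrier R" "s' \<in> S" "t \<in> S"
      and t: "t \<otimes> (r \<otimes> s') = t \<otimes> (r' \<otimes> s)"
      using yz by (cases y; cases z) (auto simp: loc_rel_iff)
    have "t \<otimes> ((a \<otimes> r) \<otimes> (b \<otimes> s')) = a \<otimes> b \<otimes> (t \<otimes> (r \<otimes> s'))" by (simp add: m_ac)
    also have "\<dots> = t \<otimes> ((a \<otimes> r') \<otimes> (b \<otimes> s))" unfolding t by (simp add: m_ac)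
    finally show "?f w y = ?f w z" unfolding w' yz'
      by (simp add: frac_eq_iff) (use d in blast)
  qed
  from UN_equiv_class2[OF equiv_loc_rel equiv_loc_rel this, of "(r, s)" "(r', s')"] assms
  show ?thesis by (simp add: localization_def loc_frac_def)
qed

lemma add_frac:
  assumes "r \<in> carrier R" "s \<in> S" "r' \<in> carrier R" "s' \<in> S"
  shows "frac r s \<oplus>\<^bsub>L\<^esub> frac r' s' = frac (r \<otimes> s' \<oplus> r' \<otimes> s) (s \<otimes> s')"
proof -
  let ?f = "\<lambda>p q. frac (fst p \<otimes> snd q \<oplus> fst q \<otimes> snd p) (snd p \<otimes> snd q)"
  have "congruent2 (loc_rel R S) (loc_rel R S) ?f"
  proof (rule congruent2_commuteI[OF equiv_loc_rel])
    fix y z assume "y \<in> carrier R \<times> S" "z \<in> carrier R \<times> S"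
    then show "?f y z = ?f z y" by (auto simp: m_comm a_comm)
  next
    fix y z w assume w: "w \<in> carrier R \<times> S" and yz: "(y, z) \<in> loc_rel R S"
    obtain a b where w': "w = (a, b)" and c [simp]: "a \<in> carrier R" "b \<in> S" using w by auto
    obtain r s r' s' t where yz': "y = (r, s)" "z = (r', s')" 
      and d [simp]: "r \<in> carrier R" "s \<in> S" "r' \<in> carrier R" "s' \<in> S" "t \<in> S"
      and t: "t \<otimes> (r \<otimes> s') = t \<otimes> (r' \<otimes> s)"
      using yz by (cases y; cases z) (auto simp: loc_rel_iff)
    have "t \<otimes> ((a \<otimes> s \<oplus> r \<otimes> b) \<otimes> (b \<otimes> s')) =
        t \<otimes> a \<otimes> b \<otimes> s \<otimes> s' \<oplus> b \<otimes> b \<otimes> (t \<otimes> (r \<otimes> s'))" by (simp add: m_ac l_distr r_distr)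
    also have "\<dots> = t \<otimes> ((a \<otimes> s' \<oplus> r' \<otimes> b) \<otimes> (b \<otimes> s))"
      unfolding t by (simp add: m_ac l_distr r_distr)
    finally show "?f w y = ?f w z" unfolding w' yz'
      by (simp add: frac_eq_iff) (use d in blast)
  qed
  from UN_equiv_class2[OF equiv_loc_rel equiv_loc_rel this, of "(r, s)" "(r', s')"] assms
  show ?thesis by (simp add: localization_def loc_frac_def)
qed

lemma localization_cring: "cring L"
proof (rule cringI)
  show "abelian_group L"
  proof (rule abelian_groupI)
    show "\<zero>\<^bsub>L\<^esub> \<in> carrier L" by (simp add: zero_frac)
    fix x assume "x \<in> carrier L"
    then obtain r s where x [simp]: "r \<in> carrier R" "s \<in> S" "x = frac r s" by (rule carrierE)
    show "\<zero>\<^bsub>L\<^esub> \<oplus>\<^bsub>L\<^esub> x = x" by (simp add: zero_frac add_frac)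
    have "frac (\<ominus> r) s \<oplus>\<^bsub>L\<^esub> x = \<zero>\<^bsub>L\<^esub>"
      unfolding x(3) by (simp add: zero_frac add_frac, rule frac_eqI) (simp_all add: l_minus l_neg)
    moreover have "frac (\<ominus> r) s \<in> carrier L" by simp
    ultimately show "\<exists>y\<in>carrier L. y \<oplus>\<^bsub>L\<^esub> x = \<zero>\<^bsub>L\<^esub>" by blast
    fix y assume "y \<in> carrier L"
    then obtain r' s' where y [simp]: "r' \<in> carrier R" "s' \<in> S" "y = frac r' s'" by (rule carrierE)
    show "x \<oplus>\<^bsub>L\<^esub> y \<in> carrier L" by (simp add: add_frac)
    show "x \<oplus>\<^bsub>L\<^esub> y = y \<oplus>\<^bsub>L\<^esub> x" by (simp add: add_frac m_comm a_comm)
    fix z assume "z \<in> carrier L"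
    then obtain r'' s'' where z [simp]: "r'' \<in> carrier R" "s'' \<in> S" "z = frac r'' s''" by (rule carrierE)
    show "x \<oplus>\<^bsub>L\<^esub> y \<oplus>\<^bsub>L\<^esub> z = x \<oplus>\<^bsub>L\<^esub> (y \<oplus>\<^bsub>L\<^esub> z)"
      by (simp add: add_frac m_ac a_ac l_distr r_distr)
  qed
  show "comm_monoid L"
  proof (rule comm_monoidI)
    show "\<one>\<^bsub>L\<^esub> \<in> carrier L" by (simp add: one_frac)
    fix x assume "x \<in> carrier L"
    then obtain r s where x [simp]: "r \<in> carrier R" "s \<in> S" "x = frac r s" by (rule carrierE)
    show "\<one>\<^bsub>L\<^esub> \<otimes>\<^bsub>L\<^esub> x = x" by (simp add: one_frac mult_frac)
    fix y assume "y \<in> carrier L"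
    then obtain r' s' where y [simp]: "r' \<in> carrier R" "s' \<in> S" "y = frac r' s'" by (rule carrierE)
    show "x \<otimes>\<^bsub>L\<^esub> y \<in> carrier L" by (simp add: mult_frac)
    show "x \<otimes>\<^bsub>L\<^esub> y = y \<otimes>\<^bsub>L\<^esub> x" by (simp add: mult_frac m_comm)
    fix z assume "z \<in> carrier L"
    then obtain r'' s'' where z [simp]: "r'' \<in> carrier R" "s'' \<in> S" "z = frac r'' s''" by (rule carrierE)
    show "x \<otimes>\<^bsub>L\<^esub> y \<otimes>\<^bsub>L\<^esub> z = x \<otimes>\<^bsub>L\<^esub> (y \<otimes>\<^bsub>L\<^esub> z)" by (simp add: mult_frac m_assoc)
  qed
  fix x y z assume "x \<in> carrier L" "y \<in> carrier L" "z \<in> carrier L"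
  then obtain r s r' s' r'' s'' where [simp]: "r \<in> carrier R" "s \<in> S" "x = frac r s"
    "r' \<in> carrier R" "s' \<in> S" "y = frac r' s'" "r'' \<in> carrier R" "s'' \<in> S" "z = frac r'' s''"
    by (metis carrierE)
  have "(x \<oplus>\<^bsub>L\<^esub> y) \<otimes>\<^bsub>L\<^esub> z = frac (s'' \<otimes> ((r \<otimes> s' \<oplus> r' \<otimes> s) \<otimes> r'')) (s'' \<otimes> (s \<otimes> s' \<otimes> s''))"
    by (simp add: add_frac mult_frac frac_cancel)
  also have "\<dots> = x \<otimes>\<^bsub>L\<^esub> z \<oplus>\<^bsub>L\<^esub> y \<otimes>\<^bsub>L\<^esub> z"
    by (simp add: add_frac mult_frac m_ac l_distr r_distr)
  finally show "(x \<oplus>\<^bsub>L\<^esub> y) \<otimes>\<^bsub>L\<^esub> z = x \<otimes>\<^bsub>L\<^esub> z \<oplus>\<^bsub>L\<^esub> y \<otimes>\<^bsub>L\<^esub> z" .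
qed

lemma localization_hom: "(\<lambda>r. frac r \<one>) \<in> ring_hom R L"
  by (rule ring_hom_memI) (simp_all add: one_frac mult_frac add_frac)

lemma frac_decompose:
  "r \<in> carrier R \<Longrightarrow> s \<in> S \<Longrightarrow> frac r s = frac \<one> s \<otimes>\<^bsub>L\<^esub> frac r \<one>"
  by (simp add: mult_frac)

text \<open>The extension of an ideal to the localization.  Asking only for a multiple of the numerator
  to lie in \<open>J\<close> makes membership of a fraction independent of its representation, which is the
  second statement.\<close>

lemma extended_ideal:
  assumes J: "ideal J R"
  shows "ideal {frac r s | r s. r \<in> carrier R \<and> s \<in> S \<and> (\<exists>c\<in>S. c \<otimes> r \<in> J)} L" (is "ideal ?J L")
    and "r \<in> carrier R \<Longrightarrow> s \<in> S \<Longrightarrow>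
      frac r s \<in> {frac r s | r s. r \<in> carrier R \<and> s \<in> S \<and> (\<exists>c\<in>S. c \<otimes> r \<in> J)} \<longleftrightarrow> (\<exists>c\<in>S. c \<otimes> r \<in> J)"
proof -
  interpret J: ideal J R by fact
  interpret L: cring L by (rule localization_cring)
  show mem: "frac r s \<in> ?J \<longleftrightarrow> (\<exists>c\<in>S. c \<otimes> r \<in> J)" if rs: "r \<in> carrier R" "s \<in> S" for r s
  proof
    assume "frac r s \<in> ?J"
    then obtain r' s' c where c: "r' \<in> carrier R" "s' \<in> S" "c \<in> S" "c \<otimes> r' \<in> J" "frac r s = frac r' s'"
      by auto
    then obtain t where t: "t \<in> S" "t \<otimes> (r \<otimes> s') = t \<otimes> (r' \<otimes> s)" using rs frac_eq_iff by auto
    have "(c \<otimes> t \<otimes> s') \<otimes> r = c \<otimes> (t \<otimes> (r \<otimes> s'))" using c t rs by (simp add: m_ac)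
    also have "\<dots> = (t \<otimes> s) \<otimes> (c \<otimes> r')" unfolding t(2) using c t rs by (simp add: m_ac)
    also have "\<dots> \<in> J" using c t rs J.I_l_closed[OF c(4), of "t \<otimes> s"] by simp
    finally show "\<exists>c\<in>S. c \<otimes> r \<in> J" using c t by (intro bexI[of _ "c \<otimes> t \<otimes> s'"]) auto
  qed (use rs in blast)
  show "ideal ?J L"
  proof (rule idealI)
    show "ring L" by (rule L.ring_axioms)
    show "subgroup ?J (add_monoid L)"
    proof (rule L.add.subgroupI)
      show "?J \<subseteq> carrier L" by auto
      have "\<one> \<otimes> \<zero> \<in> J" by simp
      then have "frac \<zero> \<one> \<in> ?J" using mem[OF zero_closed S_one] S_one by blast
      then show "?J \<noteq> {}" by blast
      fix x assume "x \<in> ?J"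
      then obtain r s c where x [simp]: "r \<in> carrier R" "s \<in> S" "c \<in> S" "x = frac r s"
        and xJ: "c \<otimes> r \<in> J" by auto
      have "frac (\<ominus> r) s \<oplus>\<^bsub>L\<^esub> x = \<zero>\<^bsub>L\<^esub>"
        unfolding x(4) by (simp add: zero_frac add_frac, rule frac_eqI) (simp_all add: l_minus l_neg)
      then have "\<ominus>\<^bsub>L\<^esub> x = frac (\<ominus> r) s" by (intro L.minus_equality) auto
      moreover have "frac (\<ominus> r) s \<in> ?J"
        using xJ by (subst mem) (auto simp: r_minus intro!: bexI[of _ c])
      ultimately show "\<ominus>\<^bsub>L\<^esub> x \<in> ?J" by simp
      fix y assume "y \<in> ?J"
      then obtain r' s' c' where y [simp]: "r' \<in> carrier R" "s' \<in> S" "c' \<in> S" "y = frac r' s'"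
        and yJ: "c' \<otimes> r' \<in> J" by auto
      have "(c \<otimes> c') \<otimes> (r \<otimes> s' \<oplus> r' \<otimes> s) = (c' \<otimes> s') \<otimes> (c \<otimes> r) \<oplus> (c \<otimes> s) \<otimes> (c' \<otimes> r')"
        by (simp add: m_ac r_distr)
      also have "\<dots> \<in> J" using J.I_l_closed[OF xJ, of "c' \<otimes> s'"] J.I_l_closed[OF yJ, of "c \<otimes> s"] by simp
      finally have "frac (r \<otimes> s' \<oplus> r' \<otimes> s) (s \<otimes> s') \<in> ?J"
        by (subst mem) (auto intro!: bexI[of _ "c \<otimes> c'"])
      then show "x \<oplus>\<^bsub>L\<^esub> y \<in> ?J" by (simp add: add_frac)
    qed
    fix a x assume a: "a \<in> ?J" and x: "x \<in> carrier L"
    obtain r s where x' [simp]: "r \<in> carrier R" "s \<in> S" "x = frac r s" using x by (rule carrierE)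
    obtain r' s' c' where y [simp]: "r' \<in> carrier R" "s' \<in> S" "c' \<in> S" "a = frac r' s'"
        and yJ: "c' \<otimes> r' \<in> J" using a by auto
    have "c' \<otimes> (r \<otimes> r') = r \<otimes> (c' \<otimes> r')" by (simp add: m_ac)
    also have "\<dots> \<in> J" using J.I_l_closed[OF yJ, of r] by simp
    finally have "frac (r \<otimes> r') (s \<otimes> s') \<in> ?J"
        by (subst mem) (auto intro!: bexI[of _ "c'"])
    then show "x \<otimes>\<^bsub>L\<^esub> a \<in> ?J" by (simp add: mult_frac)
    then show "a \<otimes>\<^bsub>L\<^esub> x \<in> ?J" using L.m_comm by simp
  qed
qed

end

lemma (in primeideal) mult_closed_compl: "mult_closed R (carrier R - I)"
  using I_notcarr one_imp_carrier I_prime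
  by unfold_locales auto

lemma (in primeideal) local_ring_localization_at:
  "local_ring (localization_at R I) {loc_frac R (carrier R - I) p s | p s. p \<in> I \<and> s \<in> carrier R - I}"
proof -
  interpret S: mult_closed R "carrier R - I" by (rule mult_closed_compl)
  let ?N = "{S.frac p s | p s. p \<in> I \<and> s \<in> carrier R - I}"
  have eq: "(\<exists>c\<in>carrier R - I. c \<otimes> r \<in> I) \<longleftrightarrow> r \<in> I" if "r \<in> carrier R" for r
    using that I_prime S.S_one by (auto intro: I_l_closed)
  have N: "?N = {S.frac r s | r s. r \<in> carrier R \<and> s \<in> carrier R - I \<and> (\<exists>c\<in>carrier R - I. c \<otimes> r \<in> I)}"
    by (intro Collect_cong ex_cong1) (metis eq Icarr)
  have mem: "S.frac r s \<in> ?N \<longleftrightarrow> r \<in> I" if "r \<in> carrier R" "s \<in> carrier R - I" for r s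
    unfolding N using S.extended_ideal(2)[OF ideal_axioms that] eq[OF that(1)] by simp
  have "local_ring S.L ?N"
  proof (intro local_ring.intro local_ring_axioms.intro S.localization_cring)
    show "ideal ?N S.L" unfolding N by (rule S.extended_ideal[OF ideal_axioms])
    show "\<one>\<^bsub>S.L\<^esub> \<notin> ?N" unfolding S.one_frac using S.S_one by (subst mem) auto
    fix x assume "x \<in> carrier S.L" "x \<notin> ?N"
    obtain r s where x: "r \<in> carrier R" "s \<in> carrier R - I" "x = S.frac r s"
      using \<open>x \<in> carrier S.L\<close> by (rule S.carrierE)
    then have r: "r \<in> carrier R - I" using \<open>x \<notin> ?N\<close> mem by blast
    with x have "S.frac s r \<otimes>\<^bsub>S.L\<^esub> x = \<one>\<^bsub>S.L\<^esub>" "x \<otimes>\<^bsub>S.L\<^esub> S.frac s r = \<one>\<^bsub>S.L\<^esub>"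
      using S.frac_eqI[of "r \<otimes> s" "r \<otimes> s" \<one> \<one>] r S.S_one S.S_mult[OF r x(2)]
      unfolding S.one_frac by (simp_all add: S.mult_frac m_comm)
    then show "x \<in> Units S.L" unfolding Units_def using x r
      by (intro CollectI conjI bexI[of _ "S.frac s r"]) auto
  qed
  then show ?thesis unfolding localization_at_def .
qed

section \<open>Completion\<close>

lemma (in cring) ideal_power_0: "ideal_power R I 0 = carrier R"
  and ideal_power_Suc: "ideal_power R I (Suc n) = ideal_power R I n \<cdot> I"
  by (simp_all add: ideals_set_def)

lemma (in cring) ideal_power_ideal: "ideal I R \<Longrightarrow> ideal (ideal_power R I n) R"
  by (induction n) (auto simp only: ideal_power_0 ideal_power_Suc intro: oneideal ideal_prod_is_ideal)

lemma (in cring) ideal_power_Suc_subset: "ideal I R \<Longrightarrow> ideal_power R I (Suc n) \<subseteq> ideal_power R I n"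
  using ideal_prod_inter ideal_power_ideal ideal_power_Suc by blast

lemma (in cring) ideal_power_1: "ideal I R \<Longrightarrow> ideal_power R I (Suc 0) = I"
  unfolding ideal_power_Suc ideal_power_0
  using ideal_prod_one ideal_prod_commute oneideal by metis

lemma (in cring) ideal_power_2: "ideal I R \<Longrightarrow> ideal_power R I 2 = I \<cdot> I"
  using ideal_power_1 ideal_power_Suc[of I "Suc 0"] by (simp add: numeral_2_eq_2)

lemma (in ring) minus_self [simp]: "x \<in> carrier R \<Longrightarrow> x \<ominus> x = \<zero>"
  by (simp add: a_minus_def r_neg)

locale adic = cring R for R (structure) +
  fixes I assumes I: "ideal I R"
begin

abbreviation C where "C \<equiv> adic_completion R I"
abbreviation pw where "pw n \<equiv> ideal_power R I n"

text \<open>Elements of the inverse limit are handled through sequences of representatives of their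
  cosets, on which the ring operations are pointwise.\<close>

definition coherent :: "(nat \<Rightarrow> 'a) \<Rightarrow> bool"
  where "coherent a \<longleftrightarrow> (\<forall>n. a n \<in> carrier R \<and> a (Suc n) \<ominus> a n \<in> pw n)"

definition cosets :: "(nat \<Rightarrow> 'a) \<Rightarrow> nat \<Rightarrow> 'a set"
  where "cosets a = (\<lambda>n. pw n +> a n)"

definition trunc_ker :: "nat \<Rightarrow> (nat \<Rightarrow> 'a set) set"
  where "trunc_ker n = {f \<in> carrier C. f n = pw n}"

lemma pw: "ideal (pw n) R" using ideal_power_ideal I .

lemma coset_subset_iff:
  assumes "a \<in> carrier R" "b \<in> carrier R"
  shows "pw (Suc n) +> b \<subseteq> pw n +> a \<longleftrightarrow> b \<ominus> a \<in> pw n"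
proof
  interpret p: ideal "pw n" R by (rule pw)
  interpret q: ideal "pw (Suc n)" R by (rule pw)
  {
    assume "pw (Suc n) +> b \<subseteq> pw n +> a"
    then have "b \<in> pw n +> a" using q.a_rcos_self assms by blast
    then have "pw n +> b = pw n +> a"
      using a_repr_independence[OF _ assms(1) p.a_subgroup] by blast
    then show "b \<ominus> a \<in> pw n" using quotient_eq_iff_same_a_r_cos[OF pw] assms by blast
  }
  {
    assume "b \<ominus> a \<in> pw n"
    then have "pw n +> b = pw n +> a" using quotient_eq_iff_same_a_r_cos[OF pw] assms by blast
    moreover have "pw (Suc n) +> b \<subseteq> pw n +> b"
      using ideal_power_Suc_subset[OF I, of n] unfolding a_r_coset_def' by blast
    ultimately show "pw (Suc n) +> b \<subseteq> pw n +> a" by simp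
  }
qed

lemma carrier_Quot: "X \<in> carrier (R Quot pw n) \<longleftrightarrow> (\<exists>a\<in>carrier R. X = pw n +> a)"
  unfolding FactRing_def A_RCOSETS_def' by auto

lemma cosets_carrier: "coherent a \<Longrightarrow> cosets a \<in> carrier C"
  unfolding adic_completion_def coherent_def cosets_def
  using coset_subset_iff carrier_Quot by auto

lemma carrierE:
  assumes "f \<in> carrier C"
  obtains a where "coherent a" "f = cosets a"
proof -
  have "\<forall>n. \<exists>a\<in>carrier R. f n = pw n +> a" and dec: "\<forall>n. f (Suc n) \<subseteq> f n"
    using assms unfolding adic_completion_def by (auto simp: carrier_Quot)
  then obtain a where a: "\<And>n. a n \<in> carrier R" "\<And>n. f n = pw n +> a n" by metis
  then have "coherent a" unfolding coherent_def using coset_subset_iff dec by metis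
  moreover have "f = cosets a" using a unfolding cosets_def by auto
  ultimately show ?thesis using that by blast
qed

lemma coherent_carr: "coherent a \<Longrightarrow> a n \<in> carrier R"
  unfolding coherent_def by blast

lemma coherent_add: assumes "coherent a" "coherent b" shows "coherent (\<lambda>n. a n \<oplus> b n)"
  unfolding coherent_def
proof (intro allI conjI)
  fix n
  interpret p: ideal "pw n" R by (rule pw)
  have c: "a n \<in> carrier R" "b n \<in> carrier R" "a (Suc n) \<in> carrier R" "b (Suc n) \<in> carrier R"
    using assms coherent_carr by auto
  then show "a n \<oplus> b n \<in> carrier R" by simp
  have "(a (Suc n) \<oplus> b (Suc n)) \<ominus> (a n \<oplus> b n) = (a (Suc n) \<ominus> a n) \<oplus> (b (Suc n) \<ominus> b n)"
    using c by algebra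
  also have "\<dots> \<in> pw n" using assms unfolding coherent_def by (intro p.a_closed) auto
  finally show "(a (Suc n) \<oplus> b (Suc n)) \<ominus> (a n \<oplus> b n) \<in> pw n" .
qed

lemma coherent_mult: assumes "coherent a" "coherent b" shows "coherent (\<lambda>n. a n \<otimes> b n)"
  unfolding coherent_def
proof (intro allI conjI)
  fix n
  interpret p: ideal "pw n" R by (rule pw)
  have c: "a n \<in> carrier R" "b n \<in> carrier R" "a (Suc n) \<in> carrier R" "b (Suc n) \<in> carrier R"
    using assms coherent_carr by auto
  then show "a n \<otimes> b n \<in> carrier R" by simp
  have "(a (Suc n) \<otimes> b (Suc n)) \<ominus> (a n \<otimes> b n) =
      a (Suc n) \<otimes> (b (Suc n) \<ominus> b n) \<oplus> (a (Suc n) \<ominus> a n) \<otimes> b n"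
    using c by algebra
  also have "\<dots> \<in> pw n" using assms c unfolding coherent_def
    by (intro p.a_closed p.I_l_closed p.I_r_closed) auto
  finally show "(a (Suc n) \<otimes> b (Suc n)) \<ominus> (a n \<otimes> b n) \<in> pw n" .
qed

lemma coherent_uminus: assumes "coherent a" shows "coherent (\<lambda>n. \<ominus> a n)"
  unfolding coherent_def
proof (intro allI conjI)
  fix n
  interpret p: ideal "pw n" R by (rule pw)
  have c: "a n \<in> carrier R" "a (Suc n) \<in> carrier R" using assms coherent_carr by auto
  then show "\<ominus> a n \<in> carrier R" by simp
  have "\<ominus> a (Suc n) \<ominus> \<ominus> a n = \<ominus> (a (Suc n) \<ominus> a n)" using c by algebra
  also have "\<dots> \<in> pw n" using assms unfolding coherent_def by (intro p.a_inv_closed) auto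
  finally show "\<ominus> a (Suc n) \<ominus> \<ominus> a n \<in> pw n" .
qed

lemma coherent_const: assumes "x \<in> carrier R" shows "coherent (\<lambda>n. x)"
  using assms additive_subgroup.zero_closed[OF ideal.axioms(1)[OF pw]]
  unfolding coherent_def by simp

lemma cosets_add:
  "coherent a \<Longrightarrow> coherent b \<Longrightarrow> cosets a \<oplus>\<^bsub>C\<^esub> cosets b = cosets (\<lambda>n. a n \<oplus> b n)"
  unfolding adic_completion_def cosets_def
  using ring_hom_add[OF ideal.rcos_ring_hom[OF pw]] coherent_carr by fastforce

lemma cosets_mult:
  "coherent a \<Longrightarrow> coherent b \<Longrightarrow> cosets a \<otimes>\<^bsub>C\<^esub> cosets b = cosets (\<lambda>n. a n \<otimes> b n)"
  unfolding adic_completion_def cosets_def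
  using ring_hom_mult[OF ideal.rcos_ring_hom[OF pw]] coherent_carr by fastforce

lemma cosets_one: "\<one>\<^bsub>C\<^esub> = cosets (\<lambda>n. \<one>)"
  unfolding adic_completion_def cosets_def by (simp add: FactRing_def)

lemma cosets_zero: "\<zero>\<^bsub>C\<^esub> = cosets (\<lambda>n. \<zero>)"
  unfolding adic_completion_def cosets_def
  using ideal.Icarr[OF pw] by (simp add: FactRing_def subset_iff)

lemma completion_cring: "cring C"
proof (rule cringI)
  note co = cosets_carrier coherent_add coherent_mult coherent_uminus coherent_const
    cosets_add cosets_mult cosets_one cosets_zero coherent_carr
  show "abelian_group C"
  proof (rule abelian_groupI)
    show "\<zero>\<^bsub>C\<^esub> \<in> carrier C" by (simp add: co)
    fix x assume "x \<in> carrier C"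
    then obtain a where x [simp]: "coherent a" "x = cosets a" by (rule carrierE)
    show "\<zero>\<^bsub>C\<^esub> \<oplus>\<^bsub>C\<^esub> x = x" by (simp add: co)
    have "cosets (\<lambda>n. \<ominus> a n) \<oplus>\<^bsub>C\<^esub> x = \<zero>\<^bsub>C\<^esub>" by (simp add: co l_neg)
    then show "\<exists>y\<in>carrier C. y \<oplus>\<^bsub>C\<^esub> x = \<zero>\<^bsub>C\<^esub>" using co x by blast
    fix y assume "y \<in> carrier C"
    then obtain b where y [simp]: "coherent b" "y = cosets b" by (rule carrierE)
    show "x \<oplus>\<^bsub>C\<^esub> y \<in> carrier C" by (simp add: co)
    show "x \<oplus>\<^bsub>C\<^esub> y = y \<oplus>\<^bsub>C\<^esub> x" by (simp add: co a_comm)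
    fix z assume "z \<in> carrier C"
    then obtain c where z [simp]: "coherent c" "z = cosets c" by (rule carrierE)
    show "x \<oplus>\<^bsub>C\<^esub> y \<oplus>\<^bsub>C\<^esub> z = x \<oplus>\<^bsub>C\<^esub> (y \<oplus>\<^bsub>C\<^esub> z)" by (simp add: co a_assoc)
  qed
  show "comm_monoid C"
  proof (rule comm_monoidI)
    show "\<one>\<^bsub>C\<^esub> \<in> carrier C" by (simp add: co)
    fix x assume "x \<in> carrier C"
    then obtain a where x [simp]: "coherent a" "x = cosets a" by (rule carrierE)
    show "\<one>\<^bsub>C\<^esub> \<otimes>\<^bsub>C\<^esub> x = x" by (simp add: co)
    fix y assume "y \<in> carrier C"
    then obtain b where y [simp]: "coherent b" "y = cosets b" by (rule carrierE)
    show "x \<otimes>\<^bsub>C\<^esub> y \<in> carrier C" by (simp add: co)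
    show "x \<otimes>\<^bsub>C\<^esub> y = y \<otimes>\<^bsub>C\<^esub> x" by (simp add: co m_comm)
    fix z assume "z \<in> carrier C"
    then obtain c where z [simp]: "coherent c" "z = cosets c" by (rule carrierE)
    show "x \<otimes>\<^bsub>C\<^esub> y \<otimes>\<^bsub>C\<^esub> z = x \<otimes>\<^bsub>C\<^esub> (y \<otimes>\<^bsub>C\<^esub> z)" by (simp add: co m_assoc)
  qed
  fix x y z assume "x \<in> carrier C" "y \<in> carrier C" "z \<in> carrier C"
  then obtain a b c where [simp]: "coherent a" "x = cosets a" "coherent b" "y = cosets b"
     "coherent c" "z = cosets c" by (meson carrierE)
  show "(x \<oplus>\<^bsub>C\<^esub> y) \<otimes>\<^bsub>C\<^esub> z = x \<otimes>\<^bsub>C\<^esub> z \<oplus>\<^bsub>C\<^esub> y \<otimes>\<^bsub>C\<^esub> z" by (simp add: co l_distr)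
qed

lemma cosets_uminus: assumes "coherent a" shows "\<ominus>\<^bsub>C\<^esub> cosets a = cosets (\<lambda>n. \<ominus> a n)"
proof -
  interpret C: cring C by (rule completion_cring)
  have "cosets (\<lambda>n. \<ominus> a n) \<oplus>\<^bsub>C\<^esub> cosets a = \<zero>\<^bsub>C\<^esub>"
    using assms coherent_carr[OF assms] by (simp add: cosets_add coherent_uminus cosets_zero l_neg)
  then show ?thesis using assms by (intro C.minus_equality) (auto intro: cosets_carrier coherent_uminus)
qed

lemma cosets_minus:
  "coherent a \<Longrightarrow> coherent b \<Longrightarrow> cosets a \<ominus>\<^bsub>C\<^esub> cosets b = cosets (\<lambda>n. a n \<ominus> b n)"
  by (simp add: a_minus_def cosets_uminus cosets_add coherent_uminus)

lemma coherent_minus: "coherent a \<Longrightarrow> coherent b \<Longrightarrow> coherent (\<lambda>n. a n \<ominus> b n)"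
  by (simp add: a_minus_def coherent_add coherent_uminus)

lemma cosets_trunc_ker: assumes "coherent a" shows "cosets a \<in> trunc_ker n \<longleftrightarrow> a n \<in> pw n"
proof -
  have "a n \<in> pw n \<longleftrightarrow> pw n +> a n = pw n"
    using a_rcos_zero[OF pw] ideal.rcos_const_imp_mem[OF pw] coherent_carr[OF assms] by blast
  then show ?thesis using cosets_carrier[OF assms] unfolding trunc_ker_def cosets_def by simp
qed

lemma trunc_kerE:
  assumes "x \<in> trunc_ker n"
  obtains a where "coherent a" "x = cosets a" "a n \<in> pw n"
proof -
  have "x \<in> carrier C" using assms unfolding trunc_ker_def by blast
  then obtain a where "coherent a" "x = cosets a" by (rule carrierE)
  then show ?thesis using that assms cosets_trunc_ker by blast
qed

end

text \<open>What the proof uses about the completion \<open>S\<close> of \<open>A\<close>: \<open>K n\<close> is the kernel of the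
  projection to the quotient by the \<open>n\<close>-th power \<open>pw n\<close> of the ideal.\<close>

locale completed = A: cring A + S: cring S
  for A (structure) and S (structure) +
  fixes \<iota> and K :: "nat \<Rightarrow> 'c set" and pw :: "nat \<Rightarrow> 'a set"
  assumes \<iota>_hom: "\<iota> \<in> ring_hom A S"
    and pw_ideal: "ideal (pw n) A"
    and K_ideal: "ideal (K n) S"
    and K_Suc: "K (Suc n) \<subseteq> K n"
    and K_0: "K 0 = carrier S"
    and K_sep: "(\<And>n. s \<in> K n) \<Longrightarrow> s = \<zero>\<^bsub>S\<^esub>"
    and \<iota>_K: "a \<in> carrier A \<Longrightarrow> \<iota> a \<in> K n \<longleftrightarrow> a \<in> pw n"
    and dense: "s \<in> carrier S \<Longrightarrow> \<exists>a\<in>carrier A. s \<ominus>\<^bsub>S\<^esub> \<iota> a \<in> K n"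
    and complete: "(\<And>n. w n \<in> carrier S) \<Longrightarrow> (\<And>n. w (Suc n) \<ominus>\<^bsub>S\<^esub> w n \<in> K n) \<Longrightarrow>
      \<exists>s\<in>carrier S. \<forall>n. s \<ominus>\<^bsub>S\<^esub> w n \<in> K n"

lemma (in adic) completed_completion:
  "completed R C (\<lambda>a n. pw n +> a) trunc_ker pw"
proof -
  interpret C: cring C by (rule completion_cring)
  have \<iota>: "(\<lambda>n. pw n +> a) = cosets (\<lambda>n. a)" for a unfolding cosets_def by simp
  have sub: "trunc_ker n \<subseteq> carrier C" for n unfolding trunc_ker_def by blast
  have K: "ideal (trunc_ker n) C" for n
  proof (rule idealI)
    interpret p: ideal "pw n" R by (rule pw)
    show "ring C" by (rule C.ring_axioms)
    show "subgroup (trunc_ker n) (add_monoid C)"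
    proof (rule C.add.subgroupI)
      show "trunc_ker n \<subseteq> carrier C" by (rule sub)
      have "\<zero>\<^bsub>C\<^esub> \<in> trunc_ker n" by (simp add: cosets_zero cosets_trunc_ker coherent_const)
      then show "trunc_ker n \<noteq> {}" by blast
      fix x assume "x \<in> trunc_ker n"
      then obtain a where x: "coherent a" "x = cosets a" "a n \<in> pw n" by (rule trunc_kerE)
      show "\<ominus>\<^bsub>C\<^esub> x \<in> trunc_ker n"
        using x by (simp add: cosets_uminus cosets_trunc_ker coherent_uminus)
      fix y assume "y \<in> trunc_ker n"
      then obtain b where y: "coherent b" "y = cosets b" "b n \<in> pw n" by (rule trunc_kerE)
      show "x \<oplus>\<^bsub>C\<^esub> y \<in> trunc_ker n"
        using x y by (simp add: cosets_add cosets_trunc_ker coherent_add)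
    qed
    fix x y assume "x \<in> trunc_ker n"
    then obtain a where x: "coherent a" "x = cosets a" "a n \<in> pw n" by (rule trunc_kerE)
    assume "y \<in> carrier C"
    then obtain b where y: "coherent b" "y = cosets b" by (rule carrierE)
    show "y \<otimes>\<^bsub>C\<^esub> x \<in> trunc_ker n" "x \<otimes>\<^bsub>C\<^esub> y \<in> trunc_ker n"
      using x y coherent_carr
      by (simp_all add: cosets_mult cosets_trunc_ker coherent_mult p.I_l_closed p.I_r_closed)
  qed
  show ?thesis
  proof (intro completed.intro completed_axioms.intro is_cring completion_cring pw K, unfold \<iota>)
    show "(\<lambda>a. cosets (\<lambda>n. a)) \<in> ring_hom R C"
      by (intro ring_hom_memI)
        (simp_all add: cosets_add cosets_mult cosets_one coherent_const cosets_carrier)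
    {
      fix n
      interpret p: ideal "pw n" R by (rule pw)
      show "trunc_ker (Suc n) \<subseteq> trunc_ker n"
      proof
        fix x assume "x \<in> trunc_ker (Suc n)"
        then obtain a where x: "coherent a" "x = cosets a" "a (Suc n) \<in> pw (Suc n)" by (rule trunc_kerE)
        then have "a (Suc n) \<ominus> (a (Suc n) \<ominus> a n) \<in> pw n"
          using ideal_power_Suc_subset[OF I, of n] unfolding coherent_def
          by (simp add: a_minus_def subset_iff)
        moreover have "a (Suc n) \<ominus> (a (Suc n) \<ominus> a n) = a n"
          using coherent_carr[OF x(1), of n] coherent_carr[OF x(1), of "Suc n"] by algebra
        ultimately show "x \<in> trunc_ker n" using x cosets_trunc_ker by simp
      qed
    }
    show "trunc_ker 0 = carrier C"
    proof
      show "carrier C \<subseteq> trunc_ker 0"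
        using cosets_trunc_ker coherent_carr ideal_power_0 by (auto elim!: carrierE)
    qed (rule sub)
    show "s = \<zero>\<^bsub>C\<^esub>" if s: "\<And>n. s \<in> trunc_ker n" for s
      using s unfolding trunc_ker_def adic_completion_def by (auto simp: FactRing_def)
    show "cosets (\<lambda>n. a) \<in> trunc_ker n \<longleftrightarrow> a \<in> pw n" if "a \<in> carrier R" for a n
      using that cosets_trunc_ker coherent_const by simp
    show "\<exists>a\<in>carrier R. s \<ominus>\<^bsub>C\<^esub> cosets (\<lambda>n. a) \<in> trunc_ker n" if "s \<in> carrier C" for s n
    proof -
      obtain a where s: "coherent a" "s = cosets a" using \<open>s \<in> carrier C\<close> by (rule carrierE)
      have an: "a n \<in> carrier R" using coherent_carr s by blast
      then have "s \<ominus>\<^bsub>C\<^esub> cosets (\<lambda>k. a n) \<in> trunc_ker n"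
        using s an additive_subgroup.zero_closed[OF ideal.axioms(1)[OF pw]]
        by (simp add: cosets_minus coherent_const cosets_trunc_ker coherent_minus)
      then show ?thesis using an by blast
    qed
    show "\<exists>s\<in>carrier C. \<forall>n. s \<ominus>\<^bsub>C\<^esub> w n \<in> trunc_ker n"
      if w: "\<And>n. w n \<in> carrier C" "\<And>n. w (Suc n) \<ominus>\<^bsub>C\<^esub> w n \<in> trunc_ker n" for w
    proof -
      have "\<forall>n. \<exists>a. coherent a \<and> w n = cosets a" using w(1) by (metis carrierE)
      then obtain a where a: "\<And>n. coherent (a n)" "\<And>n. w n = cosets (a n)" by metis
      have d: "a (Suc n) n \<ominus> a n n \<in> pw n" for n
        using w(2)[of n] a by (simp add: cosets_minus cosets_trunc_ker coherent_minus)
      \<comment> \<open>the limit takes its \<open>n\<close>-th coset from \<open>w n\<close>\<close>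
      let ?s = "\<lambda>n. a n n"
      have c: "a k n \<in> carrier R" for k n using a coherent_carr by blast
      have coh: "coherent ?s"
        unfolding coherent_def
      proof (intro allI conjI c)
        fix n
        interpret p: ideal "pw n" R by (rule pw)
        have "a (Suc n) (Suc n) \<ominus> a n n = (a (Suc n) (Suc n) \<ominus> a (Suc n) n) \<oplus> (a (Suc n) n \<ominus> a n n)"
          using c[of "Suc n" "Suc n"] c[of "Suc n" n] c[of n n] by algebra
        also have "\<dots> \<in> pw n" using d a(1) unfolding coherent_def by (intro p.a_closed) auto
        finally show "a (Suc n) (Suc n) \<ominus> a n n \<in> pw n" .
      qed
      have "a n n \<ominus> a n n \<in> pw n" for n
      using c[of n n] additive_subgroup.zero_closed[OF ideal.axioms(1)[OF pw]] by simp
      then have "cosets ?s \<ominus>\<^bsub>C\<^esub> w n \<in> trunc_ker n" for n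
        unfolding a(2) using coh a(1) by (simp add: cosets_minus cosets_trunc_ker coherent_minus)
      then show ?thesis using cosets_carrier coh by blast
    qed
  qed
qed

context ideal
begin

lemmas I_add_closed = additive_subgroup.a_closed[OF is_additive_subgroup]
  and I_neg_closed = additive_subgroup.a_inv_closed[OF is_additive_subgroup]

lemma I_minus_closed: "x \<in> I \<Longrightarrow> y \<in> I \<Longrightarrow> x \<ominus> y \<in> I"
  by (simp add: a_minus_def)

lemma diff_sym: "a \<ominus> b \<in> I \<Longrightarrow> a \<in> carrier R \<Longrightarrow> b \<in> carrier R \<Longrightarrow> b \<ominus> a \<in> I"
  using I_neg_closed[of "a \<ominus> b"] by (simp add: a_minus_def minus_add a_comm)

lemma diff_trans:
  assumes "a \<ominus> b \<in> I" "b \<ominus> c \<in> I" "a \<in> carrier R" "b \<in> carrier R" "c \<in> carrier R"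
  shows "a \<ominus> c \<in> I"
proof -
  have "a \<ominus> c = (a \<ominus> b) \<oplus> (b \<ominus> c)" using assms(3-) by algebra
  then show ?thesis using assms by simp
qed

lemma diff_mem_iff:
  assumes "a \<ominus> b \<in> I" "a \<in> carrier R" "b \<in> carrier R"
  shows "a \<in> I \<longleftrightarrow> b \<in> I"
proof
  assume "a \<in> I"
  moreover have "b = a \<ominus> (a \<ominus> b)" using assms(2,3) by algebra
  ultimately show "b \<in> I" using assms(1) I_minus_closed by metis
next
  assume "b \<in> I"
  moreover have "a = b \<oplus> (a \<ominus> b)" using assms(2,3) by algebra
  ultimately show "a \<in> I" using assms(1) I_add_closed by metis
qed

lemma diff_add:
  assumes "a \<ominus> b \<in> I" "c \<ominus> d \<in> I"
    "a \<in> carrier R" "b \<in> carrier R" "c \<in> carrier R" "d \<in> carrier R"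
  shows "(a \<oplus> c) \<ominus> (b \<oplus> d) \<in> I"
proof -
  have "(a \<oplus> c) \<ominus> (b \<oplus> d) = (a \<ominus> b) \<oplus> (c \<ominus> d)" using assms(3-) by algebra
  then show ?thesis using assms by simp
qed

lemma diff_lmult:
  assumes "a \<ominus> b \<in> I" "a \<in> carrier R" "b \<in> carrier R" "c \<in> carrier R"
  shows "c \<otimes> a \<ominus> c \<otimes> b \<in> I"
proof -
  have "c \<otimes> a \<ominus> c \<otimes> b = c \<otimes> (a \<ominus> b)" using assms(2-) by algebra
  then show ?thesis using assms I_l_closed by simp
qed

end

section \<open>Complete local rings\<close>

lemma (in cring) ideal_prod_genideal_insert:
  assumes "y \<in> carrier R" "Y \<subseteq> carrier R" and J: "ideal J R" and e: "e \<in> (Idl (insert y Y)) \<cdot> J"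
  shows "\<exists>d\<in>J. \<exists>e'\<in>(Idl Y) \<cdot> J. e = y \<otimes> d \<oplus> e'"
  using e
proof (induction rule: ideal_prod.induct)
  interpret J: ideal J R by fact
  have Y: "ideal (Idl Y) R" using genideal_ideal assms(2) .
  have YJ: "ideal ((Idl Y) \<cdot> J) R" using ideal_prod_is_ideal Y J .
  {
    case (prod i x)
    then obtain c z where c: "c \<in> carrier R" and z: "z \<in> Idl Y" and i: "i = c \<otimes> y \<oplus> z"
      using genideal_insert[OF assms(1,2)] by blast
    have "z \<in> carrier R" "x \<in> carrier R" using z prod ideal.Icarr[OF Y] J.Icarr by auto
    then have "i \<otimes> x = y \<otimes> (c \<otimes> x) \<oplus> z \<otimes> x" unfolding i using c assms(1) by algebra
    then show ?case using prod z c J.I_l_closed ideal_prod.prod[of z "Idl Y" x J R] by blast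
  next
    case (sum s1 s2)
    then obtain d1 e1 d2 e2 where d: "d1 \<in> J" "d2 \<in> J" and e: "e1 \<in> (Idl Y) \<cdot> J" "e2 \<in> (Idl Y) \<cdot> J"
      and s: "s1 = y \<otimes> d1 \<oplus> e1" "s2 = y \<otimes> d2 \<oplus> e2" by blast
    have "e1 \<in> carrier R" "e2 \<in> carrier R" "d1 \<in> carrier R" "d2 \<in> carrier R"
      using d e ideal.Icarr[OF YJ] J.Icarr by auto
    then have "s1 \<oplus> s2 = y \<otimes> (d1 \<oplus> d2) \<oplus> (e1 \<oplus> e2)" unfolding s using assms(1) by algebra
    then show ?case using d e J.a_closed additive_subgroup.a_closed[OF ideal.axioms(1)[OF YJ]] by blast
  }
qed

primrec partial_sum :: "('a, 'm) ring_scheme \<Rightarrow> (nat \<Rightarrow> 'a) \<Rightarrow> nat \<Rightarrow> 'a"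
  where "partial_sum R e 0 = \<zero>\<^bsub>R\<^esub>"
  | "partial_sum R e (Suc n) = partial_sum R e n \<oplus>\<^bsub>R\<^esub> e n"

lemma (in ring) partial_sum_closed:
  "(\<And>j. e j \<in> carrier R) \<Longrightarrow> partial_sum R e n \<in> carrier R"
  by (induction n) auto

context completed
begin

abbreviation S_mult (infixl "\<boxtimes>" 70) where "x \<boxtimes> y \<equiv> x \<otimes>\<^bsub>S\<^esub> y"
abbreviation S_add (infixl "\<boxplus>" 65) where "x \<boxplus> y \<equiv> x \<oplus>\<^bsub>S\<^esub> y"
abbreviation S_minus (infixl "\<boxminus>" 65) where "x \<boxminus> y \<equiv> x \<ominus>\<^bsub>S\<^esub> y"

sublocale K: ideal "K n" S for n by (rule K_ideal)
sublocale hom: ring_hom_ring A S \<iota>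
  by (rule ring_hom_ringI2[OF A.ring_axioms S.ring_axioms \<iota>_hom])

lemma K_mono: "m \<le> n \<Longrightarrow> K n \<subseteq> K m"
  using K_Suc by (rule lift_Suc_antimono_le)

lemma K_carr: "s \<in> K n \<Longrightarrow> s \<in> carrier S" by (rule K.Icarr)

lemma convergent_sum:
  assumes d: "\<And>j. d j \<in> K (j + k)"
  shows "\<exists>D\<in>K k. \<forall>n. D \<boxminus> partial_sum S d n \<in> K (n + k)"
proof -
  have dc: "d j \<in> carrier S" for j using d K_carr by blast
  note pc = S.partial_sum_closed[of d, OF dc]
  have step: "partial_sum S d (n + i) \<boxminus> partial_sum S d n \<in> K (n + k)" for n i
  proof (induction i)
    case 0
    then show ?case using pc by simp
  next
    case (Suc i)
    have "d (n + i) \<in> K (n + k)" using d[of "n + i"] K_mono[of "n + k" "n + i + k"] by auto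
    then have "(partial_sum S d (n + i) \<boxminus> partial_sum S d n) \<boxplus> d (n + i) \<in> K (n + k)"
      using Suc by simp
    moreover have "(partial_sum S d (n + i) \<boxminus> partial_sum S d n) \<boxplus> d (n + i)
        = partial_sum S d (n + Suc i) \<boxminus> partial_sum S d n"
      using pc[of "n + i"] pc[of n] dc[of "n + i"] unfolding add_Suc_right partial_sum.simps by algebra
    ultimately show ?case by simp
  qed
  have "partial_sum S d (Suc n) \<boxminus> partial_sum S d n \<in> K n" for n
    using step[of n 1] K_mono[of n "n + k"] by auto
  then obtain D where D: "D \<in> carrier S" "\<And>n. D \<boxminus> partial_sum S d n \<in> K n"
    using complete[of "partial_sum S d"] pc by blast
  have main: "D \<boxminus> partial_sum S d n \<in> K (n + k)" for n
    using K.diff_trans[OF D(2)[of "n + k"] step] D(1) pc by blast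
  moreover have "D \<in> K k" using main[of 0] D(1) by (simp add: a_minus_def)
  ultimately show ?thesis by blast
qed

text \<open>Finitely generated ideals are closed, because the coefficients of each generator can be
  summed separately.\<close>

lemma convergent_sum_in_fg_ideal:
  assumes "finite Y" "Y \<subseteq> carrier S" and e: "\<And>j. e j \<in> (Idl\<^bsub>S\<^esub> Y) \<cdot>\<^bsub>S\<^esub> K (j + k)"
  shows "\<exists>s\<in>(Idl\<^bsub>S\<^esub> Y) \<cdot>\<^bsub>S\<^esub> K k. \<forall>n. s \<boxminus> partial_sum S e n \<in> K (n + k)"
  using assms
proof (induction Y arbitrary: e rule: finite_induct)
  case empty
  have "Idl\<^bsub>S\<^esub> {} = {\<zero>\<^bsub>S\<^esub>}"
    using S.genideal_minimal[OF S.zeroideal, of "{}"] S.genideal_ideal[of "{}"]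
      additive_subgroup.zero_closed[OF ideal.axioms(1)] by blast
  then have "(Idl\<^bsub>S\<^esub> {}) \<cdot>\<^bsub>S\<^esub> K i = {\<zero>\<^bsub>S\<^esub>}" for i
    using S.ideal_prod_commute[OF S.zeroideal K_ideal] S.ideal_prod_zero[OF K_ideal] by simp
  then have "e j = \<zero>\<^bsub>S\<^esub>" and *: "\<zero>\<^bsub>S\<^esub> \<in> (Idl\<^bsub>S\<^esub> {}) \<cdot>\<^bsub>S\<^esub> K k" for j using empty by auto
  then have "partial_sum S e n = \<zero>\<^bsub>S\<^esub>" for n by (induction n) auto
  then have "\<forall>n. \<zero>\<^bsub>S\<^esub> \<boxminus> partial_sum S e n \<in> K (n + k)" by simp
  then show ?case using * by blast
next
  case (insert y Y)
  have y: "y \<in> carrier S" and Y: "Y \<subseteq> carrier S" using insert.prems by auto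
  have "\<exists>d\<in>K (j + k). \<exists>e'\<in>(Idl\<^bsub>S\<^esub> Y) \<cdot>\<^bsub>S\<^esub> K (j + k). e j = y \<boxtimes> d \<boxplus> e'" for j
    using S.ideal_prod_genideal_insert[OF y Y K_ideal insert.prems(2)] .
  then obtain d e' where d: "\<And>j. d j \<in> K (j + k)"
    and e': "\<And>j. e' j \<in> (Idl\<^bsub>S\<^esub> Y) \<cdot>\<^bsub>S\<^esub> K (j + k)" and ej: "\<And>j. e j = y \<boxtimes> d j \<boxplus> e' j"
    by metis
  have IY: "ideal (Idl\<^bsub>S\<^esub> Y) S" using S.genideal_ideal Y .
  have IYK: "ideal ((Idl\<^bsub>S\<^esub> Y) \<cdot>\<^bsub>S\<^esub> K i) S" for i using S.ideal_prod_is_ideal IY K_ideal .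
  obtain s where s: "s \<in> (Idl\<^bsub>S\<^esub> Y) \<cdot>\<^bsub>S\<^esub> K k" "\<And>n. s \<boxminus> partial_sum S e' n \<in> K (n + k)"
    using insert.IH[OF Y e'] by blast
  obtain D where D: "D \<in> K k" "\<And>n. D \<boxminus> partial_sum S d n \<in> K (n + k)"
    using convergent_sum[of d, OF d] by blast
  have dc: "d j \<in> carrier S" and ec: "e' j \<in> carrier S" for j
    using d e' ideal.Icarr[OF IYK] K_carr by blast+
  note pd = S.partial_sum_closed[of d, OF dc] and pe = S.partial_sum_closed[of e', OF ec]
  have Dc: "D \<in> carrier S" and sc: "s \<in> carrier S" using D s K_carr ideal.Icarr[OF IYK] by blast+
  have ps: "partial_sum S e n = y \<boxtimes> partial_sum S d n \<boxplus> partial_sum S e' n" for n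
  proof (induction n)
    case 0
    then show ?case using y by simp
  next
    case (Suc n)
    then show ?case using y dc[of n] ec[of n] pd[of n] pe[of n]
      unfolding partial_sum.simps ej by (simp add: S.r_distr S.a_ac)
  qed
  let ?J = "\<lambda>i. (Idl\<^bsub>S\<^esub> (insert y Y)) \<cdot>\<^bsub>S\<^esub> K i"
  have IyY: "ideal (Idl\<^bsub>S\<^esub> (insert y Y)) S" using S.genideal_ideal insert.prems(1) .
  then have J: "ideal (?J i) S" for i using S.ideal_prod_is_ideal K_ideal by blast
  have "y \<in> Idl\<^bsub>S\<^esub> (insert y Y)" using S.genideal_self[OF insert.prems(1)] by blast
  then have "y \<boxtimes> D \<in> ?J k" using D(1) by (rule ideal_prod.prod)
  moreover have "(Idl\<^bsub>S\<^esub> Y) \<cdot>\<^bsub>S\<^esub> K k \<subseteq> ?J k"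
  proof
    fix x assume "x \<in> (Idl\<^bsub>S\<^esub> Y) \<cdot>\<^bsub>S\<^esub> K k"
    then show "x \<in> ?J k"
    proof (induction rule: ideal_prod.induct)
      case (prod i j)
      then have "i \<in> Idl\<^bsub>S\<^esub> (insert y Y)"
        using S.subset_Idl_subset[OF insert.prems(1), of Y] by blast
      then show ?case using prod(2) by (rule ideal_prod.prod)
    qed (rule ideal_prod.sum)
  qed
  ultimately have mem: "y \<boxtimes> D \<boxplus> s \<in> ?J k"
    using additive_subgroup.a_closed[OF ideal.axioms(1)[OF J]] s(1) by blast
  have "(y \<boxtimes> D \<boxplus> s) \<boxminus> partial_sum S e n \<in> K (n + k)" for n
    unfolding ps
    using K.diff_add[OF K.diff_lmult[OF D(2) Dc pd y] s(2)] Dc sc pd pe y by simp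
  then show ?case using mem by blast
qed

end

locale complete_local = completed A S \<iota> K pw
  for A (structure) and S (structure) and \<iota> and K :: "nat \<Rightarrow> 'c set" and pw :: "nat \<Rightarrow> 'a set" +
  fixes X
  assumes X: "finite X" "X \<subseteq> carrier A"
    and pw_Suc: "pw (Suc n) = pw n \<cdot>\<^bsub>A\<^esub> (Idl\<^bsub>A\<^esub> X)"
    and A_Units: "a \<in> carrier A \<Longrightarrow> a \<notin> pw (Suc 0) \<Longrightarrow> a \<in> Units A"
begin

lemma \<iota>_minus: "a \<in> carrier A \<Longrightarrow> b \<in> carrier A \<Longrightarrow> \<iota> (a \<ominus>\<^bsub>A\<^esub> b) = \<iota> a \<boxminus> \<iota> b"
  by (simp add: a_minus_def)

lemma \<iota>_pw_Suc:
  assumes "c \<in> pw (Suc n)"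
  shows "\<iota> c \<in> (Idl\<^bsub>S\<^esub> (\<iota> ` X)) \<cdot>\<^bsub>S\<^esub> K n"
proof -
  have IX: "\<iota> ` X \<subseteq> carrier S" using X by auto
  have IIX: "ideal (Idl\<^bsub>S\<^esub> (\<iota> ` X)) S" using S.genideal_ideal IX .
  have "X \<subseteq> {a \<in> carrier A. \<iota> a \<in> Idl\<^bsub>S\<^esub> (\<iota> ` X)}"
    using S.genideal_self[OF IX] X by blast
  then have X': "Idl\<^bsub>A\<^esub> X \<subseteq> {a \<in> carrier A. \<iota> a \<in> Idl\<^bsub>S\<^esub> (\<iota> ` X)}"
    using hom.ideal_vimage[OF IIX] A.genideal_minimal by blast
  have "c \<in> carrier A \<and> \<iota> c \<in> (Idl\<^bsub>S\<^esub> (\<iota> ` X)) \<cdot>\<^bsub>S\<^esub> K n"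
    using assms unfolding pw_Suc
  proof (induction rule: ideal_prod.induct)
    case (prod i j)
    then have i: "i \<in> carrier A" "\<iota> i \<in> K n" using ideal.Icarr[OF pw_ideal] \<iota>_K by auto
    have j: "j \<in> carrier A" "\<iota> j \<in> Idl\<^bsub>S\<^esub> (\<iota> ` X)" using X' prod by auto
    have "\<iota> (i \<otimes>\<^bsub>A\<^esub> j) = \<iota> j \<boxtimes> \<iota> i" using i j by (simp add: S.m_comm)
    also have "\<dots> \<in> (Idl\<^bsub>S\<^esub> (\<iota> ` X)) \<cdot>\<^bsub>S\<^esub> K n" using j(2) i(2) by (rule ideal_prod.prod)
    finally show ?case using i j by simp
  next
    case (sum s1 s2)
    then show ?case by (auto intro: ideal_prod.sum)
  qed
  then show ?thesis by simp
qed

text \<open>An element of \<open>K (n + 1)\<close> is the sum of the differences of its successive approximations in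
  \<open>A\<close>; these lie in increasing powers of the ideal generated by \<open>X\<close>.  Hence the kernels \<open>K n\<close> are
  the powers of the ideal that \<open>X\<close> generates in the completion, which holds only because \<open>X\<close> is
  finite.\<close>

lemma K_Suc_generated:
  assumes f: "f \<in> K (Suc n)"
  shows "f \<in> (Idl\<^bsub>S\<^esub> (\<iota> ` X)) \<cdot>\<^bsub>S\<^esub> K n"
proof -
  have fc: "f \<in> carrier S" using f K_carr by blast
  have IX: "\<iota> ` X \<subseteq> carrier S" using X by auto
  have "\<forall>j. \<exists>a\<in>carrier A. f \<boxminus> \<iota> a \<in> K (Suc n + j)" using dense fc by blast
  then obtain b where b: "\<And>j. b j \<in> carrier A" "\<And>j. f \<boxminus> \<iota> (b j) \<in> K (Suc n + j)" by metis
  define a where "a j = (case j of 0 \<Rightarrow> \<zero>\<^bsub>A\<^esub> | Suc i \<Rightarrow> b (Suc i))" for j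
  have a: "a j \<in> carrier A" "f \<boxminus> \<iota> (a j) \<in> K (Suc n + j)" for j
    using b(1) b(2)[of j] f fc unfolding a_def by (cases j; simp add: a_minus_def)+
  define e where "e j = \<iota> (a (Suc j) \<ominus>\<^bsub>A\<^esub> a j)" for j
  have "e j \<in> (Idl\<^bsub>S\<^esub> (\<iota> ` X)) \<cdot>\<^bsub>S\<^esub> K (j + n)" for j
  proof -
    have "f \<boxminus> \<iota> (a (Suc j)) \<in> K (Suc n + j)"
      using a(2)[of "Suc j"] K_mono[of "Suc n + j" "Suc n + Suc j"] by auto
    then have "\<iota> (a (Suc j)) \<boxminus> f \<in> K (Suc n + j)"
      using K.diff_sym a(1) fc hom.hom_closed by blast
    then have "\<iota> (a (Suc j)) \<boxminus> \<iota> (a j) \<in> K (Suc n + j)"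
      using K.diff_trans[OF _ a(2)] a(1) fc hom.hom_closed by blast
    then have "e j \<in> K (Suc n + j)" unfolding e_def using a(1) by (simp add: \<iota>_minus)
    then have "a (Suc j) \<ominus>\<^bsub>A\<^esub> a j \<in> pw (Suc (j + n))"
      using \<iota>_K[of "a (Suc j) \<ominus>\<^bsub>A\<^esub> a j"] a(1) unfolding e_def by (simp add: add.commute)
    then show ?thesis unfolding e_def by (rule \<iota>_pw_Suc)
  qed
  then obtain s where s: "s \<in> (Idl\<^bsub>S\<^esub> (\<iota> ` X)) \<cdot>\<^bsub>S\<^esub> K n"
    "\<And>j. s \<boxminus> partial_sum S e j \<in> K (j + n)"
    using convergent_sum_in_fg_ideal[OF finite_imageI[OF X(1)] IX] by blast
  have sc: "s \<in> carrier S"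
    using s(1) S.ideal_prod_in_carrier[OF S.genideal_ideal[OF IX] K_ideal] by blast
  have ps: "partial_sum S e j = \<iota> (a j)" for j
  proof (induction j)
    case 0
    then show ?case by (simp add: a_def)
  next
    case (Suc j)
    have "\<iota> (a j) \<boxplus> (\<iota> (a (Suc j)) \<boxminus> \<iota> (a j)) = \<iota> (a (Suc j))"
      using hom.hom_closed[OF a(1)[of j]] hom.hom_closed[OF a(1)[of "Suc j"]] by algebra
    then show ?case using Suc a(1) by (simp add: e_def \<iota>_minus)
  qed
  have "f \<boxminus> s \<in> K j" for j
  proof -
    have "f \<boxminus> \<iota> (a j) \<in> K j" using a(2) K_mono[of j "Suc n + j"] by auto
    moreover have "s \<boxminus> \<iota> (a j) \<in> K j"
      using subsetD[OF K_mono s(2)[of j], of j] unfolding ps by simp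
    then have "\<iota> (a j) \<boxminus> s \<in> K j"
      by (rule K.diff_sym[OF _ sc hom.hom_closed[OF a(1)]])
    ultimately show ?thesis using K.diff_trans fc sc a(1) hom.hom_closed by blast
  qed
  then have "f \<boxminus> s = \<zero>\<^bsub>S\<^esub>" by (rule K_sep)
  then show ?thesis using fc sc s(1) by simp
qed

text \<open>Inverses of approximations of \<open>s\<close> in \<open>A\<close> converge to an inverse of \<open>s\<close>.\<close>

lemma Units_notin_K:
  assumes s: "s \<in> carrier S" "s \<notin> K (Suc 0)"
  shows "s \<in> Units S"
proof -
  have "\<forall>n. \<exists>a\<in>carrier A. s \<boxminus> \<iota> a \<in> K (Suc n)" using dense s(1) by blast
  then obtain a where a: "\<And>n. a n \<in> carrier A" "\<And>n. s \<boxminus> \<iota> (a n) \<in> K (Suc n)" by metis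
  have "a n \<in> Units A" for n
  proof -
    have "s \<boxminus> \<iota> (a n) \<in> K (Suc 0)" using a(2)[of n] K_mono[of "Suc 0" "Suc n"] by auto
    then have "\<iota> (a n) \<notin> K (Suc 0)" using K.diff_mem_iff s a(1) hom.hom_closed by blast
    then show ?thesis using A_Units a(1) \<iota>_K by blast
  qed
  define b where "b n = inv\<^bsub>A\<^esub> (a n)" for n
  have b: "b n \<in> carrier A" "b n \<otimes>\<^bsub>A\<^esub> a n = \<one>\<^bsub>A\<^esub>" for n
    using \<open>a n \<in> Units A\<close> unfolding b_def by auto
  have ba: "\<iota> (b n) \<boxtimes> \<iota> (a n) = \<one>\<^bsub>S\<^esub>" for n
    using b[of n] a(1)[of n] hom.hom_mult[of "b n" "a n"] hom.hom_one by simp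
  have c: "\<iota> (a n) \<in> carrier S" "\<iota> (b n) \<in> carrier S" for n using a b by auto
  have "\<iota> (b (Suc n)) \<boxminus> \<iota> (b n) \<in> K n" for n
  proof -
    have "s \<boxminus> \<iota> (a (Suc n)) \<in> K n" "s \<boxminus> \<iota> (a n) \<in> K n"
      using a(2)[of "Suc n"] a(2)[of n] K_mono[of n "Suc n"] K_mono[of n "Suc (Suc n)"] by auto
    then have "\<iota> (a n) \<boxminus> \<iota> (a (Suc n)) \<in> K n"
      using K.diff_trans[OF K.diff_sym] s(1) c by blast
    then have "(\<iota> (b (Suc n)) \<boxtimes> \<iota> (b n)) \<boxtimes> (\<iota> (a n) \<boxminus> \<iota> (a (Suc n))) \<in> K n"
      using K.I_l_closed c by simp
    moreover have "(\<iota> (b (Suc n)) \<boxtimes> \<iota> (b n)) \<boxtimes> (\<iota> (a n) \<boxminus> \<iota> (a (Suc n)))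
      = \<iota> (b (Suc n)) \<boxtimes> (\<iota> (b n) \<boxtimes> \<iota> (a n)) \<boxminus> \<iota> (b n) \<boxtimes> (\<iota> (b (Suc n)) \<boxtimes> \<iota> (a (Suc n)))"
      using c[of n] c[of "Suc n"] by algebra
    ultimately show ?thesis using c unfolding ba by simp
  qed
  then obtain s' where s': "s' \<in> carrier S" "\<And>n. s' \<boxminus> \<iota> (b n) \<in> K n"
    using complete[of "\<lambda>n. \<iota> (b n)"] c by blast
  have "s \<boxtimes> s' \<boxminus> \<one>\<^bsub>S\<^esub> \<in> K n" for n
  proof -
    have "s \<boxminus> \<iota> (a n) \<in> K n" using a(2)[of n] K_Suc by blast
    then have "(s \<boxminus> \<iota> (a n)) \<boxtimes> s' \<boxplus> \<iota> (a n) \<boxtimes> (s' \<boxminus> \<iota> (b n)) \<in> K n"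
      using s' c by (intro K.I_add_closed K.I_l_closed K.I_r_closed) auto
    moreover have "(s \<boxminus> \<iota> (a n)) \<boxtimes> s' \<boxplus> \<iota> (a n) \<boxtimes> (s' \<boxminus> \<iota> (b n))
       = s \<boxtimes> s' \<boxminus> \<iota> (b n) \<boxtimes> \<iota> (a n)"
      using c[of n] s(1) s'(1) by algebra
    ultimately show ?thesis unfolding ba by simp
  qed
  then have "s \<boxtimes> s' \<boxminus> \<one>\<^bsub>S\<^esub> = \<zero>\<^bsub>S\<^esub>" by (rule K_sep)
  then have "s \<boxtimes> s' = \<one>\<^bsub>S\<^esub>" using s s' by simp
  moreover from this have "s' \<boxtimes> s = \<one>\<^bsub>S\<^esub>" using S.m_comm s s' by simp
  ultimately have "\<exists>x\<in>carrier S. x \<boxtimes> s = \<one>\<^bsub>S\<^esub> \<and> s \<boxtimes> x = \<one>\<^bsub>S\<^esub>"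
    using s'(1) by (intro bexI[of _ s'] conjI)
  then show ?thesis using s(1) by (simp add: Units_def)
qed

end

section \<open>Local rings with a discrete valuation ring as quotient\<close>

text \<open>The conditions \<open>M_decomp\<close> and \<open>factor\<close> say in terms of \<open>S\<close> that the quotient of \<open>S\<close> by \<open>P\<close> is a
  discrete valuation ring with uniformizer \<open>t\<close>: its maximal ideal is generated by \<open>t\<close>, and its
  nonzero elements are powers of \<open>t\<close> times units.\<close>

locale dvr_quotient = local_ring S M for S (structure) and M +
  fixes P and t
  assumes P_prime: "primeideal P S" and P_M: "P \<subseteq> M"
    and t_M: "t \<in> M" and t_P: "t \<notin> P"
    and M_decomp: "f \<in> M \<Longrightarrow> \<exists>g\<in>carrier S. f \<ominus> t \<otimes> g \<in> P"
    and factor: "f \<in> carrier S \<Longrightarrow> f \<notin> P \<Longrightarrow>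
      \<exists>i::nat. \<exists>u\<in>carrier S - M. f \<ominus> t [^] i \<otimes> u \<in> P"
    and P_fg: "\<exists>Y\<subseteq>carrier S. finite Y \<and> Idl Y = P"

context dvr_quotient
begin

sublocale P: primeideal P S by (rule P_prime)

abbreviation Q where "Q \<equiv> symbolic_power S P 2"

lemma t_carr [simp]: "t \<in> carrier S" using t_M by simp

lemma Q_iff: "x \<in> Q \<longleftrightarrow> x \<in> carrier S \<and> (\<exists>s\<in>carrier S - P. s \<otimes> x \<in> P \<cdot> P)"
  unfolding symbolic_power_def ideal_power_2[OF P.ideal_axioms] by blast

lemma one_notin_P: "\<one> \<notin> P"
  using P_M one_notin by blast

lemma PP: "ideal (P \<cdot> P) S" using ideal_prod_is_ideal P.ideal_axioms by blast

lemma PP_Q: assumes "x \<in> P \<cdot> P" shows "x \<in> Q"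
proof -
  have "x \<in> carrier S" using assms ideal.Icarr[OF PP] by blast
  then show ?thesis using assms one_notin_P unfolding Q_iff by (auto intro!: bexI[of _ \<one>])
qed

lemma P_mult_Q: "p \<in> P \<Longrightarrow> q \<in> P \<Longrightarrow> p \<otimes> q \<in> Q"
  using PP_Q ideal_prod.prod by metis

lemma Q_ideal: "ideal Q S"
proof (rule idealI)
  interpret PP: ideal "P \<cdot> P" S by (rule PP)
  show "ring S" by (rule ring_axioms)
  show "subgroup Q (add_monoid S)"
  proof (rule add.subgroupI)
    show "Q \<subseteq> carrier S" using Q_iff by blast
    show "Q \<noteq> {}" using PP_Q[OF PP.zero_closed] by blast
    fix x assume x: "x \<in> Q"
    then obtain s where s: "x \<in> carrier S" "s \<in> carrier S" "s \<notin> P" "s \<otimes> x \<in> P \<cdot> P"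
      unfolding Q_iff by blast
    then have "s \<otimes> \<ominus> x \<in> P \<cdot> P" using PP.I_neg_closed[OF s(4)] by (simp add: r_minus)
    then show "\<ominus> x \<in> Q" unfolding Q_iff using s by blast
    fix y assume y: "y \<in> Q"
    then obtain r where r: "y \<in> carrier S" "r \<in> carrier S" "r \<notin> P" "r \<otimes> y \<in> P \<cdot> P"
      unfolding Q_iff by blast
    have "(s \<otimes> r) \<otimes> (x \<oplus> y) = r \<otimes> (s \<otimes> x) \<oplus> s \<otimes> (r \<otimes> y)"
      using s(1,2) r(1,2) by (simp add: r_distr m_ac)
    also have "\<dots> \<in> P \<cdot> P"
      using PP.I_add_closed[OF PP.I_l_closed[OF s(4) r(2)] PP.I_l_closed[OF r(4) s(2)]] .
    finally show "x \<oplus> y \<in> Q" unfolding Q_iff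
      using s(1-3) r(1-3) P.I_prime[of s r] by (intro conjI bexI[of _ "s \<otimes> r"]) auto
  qed
  fix x a assume x: "x \<in> Q" and a: "a \<in> carrier S"
  then obtain s where s: "x \<in> carrier S" "s \<in> carrier S" "s \<notin> P" "s \<otimes> x \<in> P \<cdot> P"
    unfolding Q_iff by blast
  have "s \<otimes> (a \<otimes> x) = a \<otimes> (s \<otimes> x)" using s(1,2) a by (simp add: m_ac)
  then have "s \<otimes> (a \<otimes> x) \<in> P \<cdot> P" using PP.I_l_closed[OF s(4) a] by simp
  then show "a \<otimes> x \<in> Q" unfolding Q_iff using s(1-3) a by blast
  then show "x \<otimes> a \<in> Q" using m_comm[OF a s(1)] by simp
qed

sublocale Q: ideal Q S by (rule Q_ideal)

lemma Q_P: "Q \<subseteq> P"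
proof
  fix x assume "x \<in> Q"
  then obtain s where s: "x \<in> carrier S" "s \<in> carrier S" "s \<notin> P" "s \<otimes> x \<in> P \<cdot> P"
    unfolding Q_iff by blast
  then have "s \<otimes> x \<in> P" using ideal_prod_inter[OF P.ideal_axioms P.ideal_axioms] by blast
  then show "x \<in> P" using P.I_prime s by blast
qed

text \<open>\<open>P / Q\<close> is a torsion-free module over the quotient by \<open>P\<close>; this is why the second symbolic power
  is taken instead of the square.\<close>

lemma Q_cancel:
  assumes s: "s \<in> carrier S" "s \<notin> P" and x: "x \<in> carrier S" "s \<otimes> x \<in> Q"
  shows "x \<in> Q"
proof -
  obtain r where r: "r \<in> carrier S" "r \<notin> P" "r \<otimes> (s \<otimes> x) \<in> P \<cdot> P"
    using x(2) unfolding Q_iff by blast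
  then have "(r \<otimes> s) \<otimes> x \<in> P \<cdot> P" using s x by (simp add: m_assoc)
  moreover have "r \<otimes> s \<in> carrier S - P" using r s P.I_prime by blast
  ultimately show ?thesis unfolding Q_iff using x by blast
qed

lemma t_cancel_P: "h \<in> carrier S \<Longrightarrow> t \<otimes> h \<in> P \<Longrightarrow> h \<in> P"
  using P.I_prime[of t h] t_P by simp

text \<open>Submodules of \<open>P / Q\<close> are represented by ideals containing \<open>Q\<close>; \<open>H T\<close> stands for the one
  spanned by \<open>T\<close>.\<close>

definition H :: "'a set \<Rightarrow> 'a set"
  where "H T = Idl (T \<union> Q)"

lemma H_ideal: "T \<subseteq> carrier S \<Longrightarrow> ideal (H T) S"
  unfolding H_def using Q.a_subset by (intro genideal_ideal) auto

lemma H_self: "T \<subseteq> carrier S \<Longrightarrow> T \<subseteq> H T" "T \<subseteq> carrier S \<Longrightarrow> Q \<subseteq> H T"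
  unfolding H_def using Q.a_subset genideal_self[of "T \<union> Q"] by auto

lemma H_least: "ideal J S \<Longrightarrow> T \<subseteq> J \<Longrightarrow> Q \<subseteq> J \<Longrightarrow> H T \<subseteq> J"
  unfolding H_def by (intro genideal_minimal) auto

lemma H_insert:
  assumes "g \<in> carrier S" "T \<subseteq> carrier S" "x \<in> H (insert g T)"
  shows "\<exists>c\<in>carrier S. \<exists>z\<in>H T. x = c \<otimes> g \<oplus> z"
  using assms genideal_insert[of g "T \<union> Q" x] Q.a_subset unfolding H_def by auto

lemma one_minus_M: assumes m: "m \<in> M" shows "\<one> \<ominus> m \<in> carrier S" "\<one> \<ominus> m \<notin> M"
proof -
  have mc: "m \<in> carrier S" using m N.Icarr by blast
  then show "\<one> \<ominus> m \<in> carrier S" by simp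
  have "(\<one> \<ominus> m) \<oplus> m = \<one>" using mc by algebra
  then show "\<one> \<ominus> m \<notin> M" using N.I_add_closed[of "\<one> \<ominus> m" m] m one_notin by auto
qed

lemma exists_basis:
  obtains G where "G \<subseteq> P" "finite G" "H G = P" "\<And>g. g \<in> G \<Longrightarrow> g \<notin> H (G - {g})"
proof -
  obtain Y where Y: "finite Y" "Idl Y = P" "Y \<subseteq> carrier S" using P_fg by blast
  have YP: "Y \<subseteq> P" using Y genideal_self by blast
  have HP: "H T \<subseteq> P" if "T \<subseteq> P" for T using H_least[OF P.ideal_axioms that Q_P] .
  have "P \<subseteq> H Y" using genideal_minimal[OF H_ideal[OF Y(3)] H_self(1)[OF Y(3)]] Y(2) by simp
  then have HY: "H Y = P" using HP[OF YP] by blast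
  have "\<exists>G\<subseteq>T. H G = P \<and> (\<forall>g\<in>G. g \<notin> H (G - {g}))" if "finite T" "T \<subseteq> P" "H T = P" for T
    using that
  proof (induction T rule: finite_psubset_induct)
    case (psubset T)
    show ?case
    proof (cases "\<forall>g\<in>T. g \<notin> H (T - {g})")
      case False
      then obtain g where g: "g \<in> T" "g \<in> H (T - {g})" by blast
      have Tc: "T - {g} \<subseteq> carrier S" using psubset.prems(1) P.Icarr by blast
      have "T \<subseteq> H (T - {g})" using H_self(1)[OF Tc] g by blast
      then have "H T \<subseteq> H (T - {g})" using H_least[OF H_ideal[OF Tc]] H_self(2)[OF Tc] by blast
      then have "H (T - {g}) = P" using HP[of "T - {g}"] psubset.prems by blast
      moreover have "T - {g} \<subset> T" "T - {g} \<subseteq> P" using g psubset.prems(1) by auto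
      ultimately show ?thesis using psubset.IH[of "T - {g}"] by blast
    qed (use psubset.prems in blast)
  qed
  from this[OF Y(1) YP HY] obtain G where "G \<subseteq> Y" "H G = P" "\<forall>g\<in>G. g \<notin> H (G - {g})" by blast
  then show ?thesis using that[of G] YP finite_subset[OF _ Y(1)] by blast
qed

end

text \<open>A minimal set of generators of \<open>P / Q\<close>.  Being finitely generated and torsion-free over a
  discrete valuation ring, \<open>P / Q\<close> is free with this basis; the lemmas below prove the independence
  over the fraction field.\<close>

locale dvr_quotient_basis = dvr_quotient +
  fixes G
  assumes G: "G \<subseteq> P" "finite G" "H G = P" and G_min: "g \<in> G \<Longrightarrow> g \<notin> H (G - {g})"
begin

lemma G_carr: "G \<subseteq> carrier S" using G(1) P.Icarr by blast

lemma G_carr': "G - {g} \<subseteq> carrier S" using G_carr by blast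

lemma P_decomp:
  assumes "g \<in> G" "p \<in> P"
  shows "\<exists>c\<in>carrier S. \<exists>z\<in>H (G - {g}). p = c \<otimes> g \<oplus> z"
proof -
  have "insert g (G - {g}) = G" using assms by blast
  then show ?thesis using H_insert[of g "G - {g}" p] G_carr assms G(3) by auto
qed

text \<open>Nakayama's lemma for one generator: a relation \<open>g = w t + h\<close> puts \<open>w\<close> into \<open>P\<close>, since \<open>P\<close> is
  prime, so \<open>w = d g + h'\<close> and \<open>g\<close> is redundant because \<open>1 - t d\<close> is a unit.\<close>

lemma indep_mod_t:
  assumes g: "g \<in> G"
  shows "g \<notin> H (insert t (G - {g}))"
proof
  assume "g \<in> H (insert t (G - {g}))"
  then obtain w h where w: "w \<in> carrier S" "h \<in> H (G - {g})" "g = w \<otimes> t \<oplus> h"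
    using H_insert[OF t_carr G_carr'] by blast
  interpret J: ideal "H (G - {g})" S by (rule H_ideal[OF G_carr'])
  have HP: "H (G - {g}) \<subseteq> P" using H_least[OF P.ideal_axioms _ Q_P] G(1) by blast
  have gP: "g \<in> P" and gc: "g \<in> carrier S" using g G(1) G_carr by auto
  have hc: "h \<in> carrier S" using w(2) J.Icarr by blast
  have "t \<otimes> w = g \<ominus> h" unfolding w(3) using w(1) hc t_carr by algebra
  then have "w \<in> P" using t_cancel_P[OF w(1)] P.I_minus_closed[OF gP] HP w(2) by auto
  then obtain d h' where d: "d \<in> carrier S" "h' \<in> H (G - {g})" "w = d \<otimes> g \<oplus> h'"
    using P_decomp[OF g] by blast
  have h'c: "h' \<in> carrier S" using d(2) J.Icarr by blast
  have tdM: "t \<otimes> d \<in> M" using N.I_r_closed[OF t_M d(1)] .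
  have "(\<one> \<ominus> t \<otimes> d) \<otimes> g = g \<ominus> t \<otimes> (d \<otimes> g)" using d(1) gc t_carr by algebra
  also have "\<dots> = (w \<otimes> t \<oplus> h) \<ominus> t \<otimes> (d \<otimes> g)" using w(3) by simp
  also have "\<dots> = ((d \<otimes> g \<oplus> h') \<otimes> t \<oplus> h) \<ominus> t \<otimes> (d \<otimes> g)" using d(3) by simp
  also have "\<dots> = t \<otimes> h' \<oplus> h" using d(1) gc h'c hc t_carr by algebra
  finally have "(\<one> \<ominus> t \<otimes> d) \<otimes> g \<in> H (G - {g})"
    using J.I_add_closed[OF J.I_l_closed[OF d(2) t_carr] w(2)] by simp
  then have "g \<in> H (G - {g})" by (rule unit_solve[OF one_minus_M[OF tdM] gc J.ideal_axioms])
  then show False using G_min g by blast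
qed

text \<open>A submodule of \<open>P / Q\<close> spanned by part of the basis is saturated: dividing one of its
  elements by \<open>t\<close> does not leave it.\<close>

lemma saturated:
  assumes "finite T" "T \<subseteq> G" "x \<in> H T" "p \<in> P" "x \<ominus> t \<otimes> p \<in> Q"
  shows "\<exists>y\<in>H T. x \<ominus> t \<otimes> y \<in> Q"
  using assms
proof (induction T arbitrary: x p rule: finite_induct)
  case empty
  have "H {} \<subseteq> Q" using H_least[OF Q_ideal] by blast
  moreover have "\<zero> \<in> H {}" using additive_subgroup.zero_closed[OF ideal.axioms(1)[OF H_ideal]] by blast
  moreover have "x \<in> Q" using empty calculation(1) by blast
  then have "x \<ominus> t \<otimes> \<zero> \<in> Q" using Q.Icarr by (simp add: a_minus_def)
  ultimately show ?case by blast
next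
  case (insert h T)
  have Tc: "T \<subseteq> carrier S" "insert h T \<subseteq> carrier S" using insert.prems(1) G_carr by auto
  have hG: "h \<in> G" and hc: "h \<in> carrier S" and hP: "h \<in> P" using insert.prems(1) G_carr G(1) by auto
  interpret JT: ideal "H T" S by (rule H_ideal[OF Tc(1)])
  interpret JhT: ideal "H (insert h T)" S by (rule H_ideal[OF Tc(2)])
  have sub: "H T \<subseteq> H (insert h T)"
    using H_least[OF JhT.ideal_axioms] H_self[OF Tc(2)] by blast
  have pc: "p \<in> carrier S" using insert.prems P.Icarr by blast
  obtain c z where c: "c \<in> carrier S" "z \<in> H T" "x = c \<otimes> h \<oplus> z"
    using H_insert[OF hc Tc(1) insert.prems(2)] by blast
  have zc: "z \<in> carrier S" using c(2) JT.Icarr by blast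
  have "c \<in> M"
  proof (rule ccontr)
    assume cM: "c \<notin> M"
    let ?U = "insert t (G - {h})"
    have U: "?U \<subseteq> carrier S" using G_carr by auto
    interpret J: ideal "H ?U" S by (rule H_ideal[OF U])
    have "T \<subseteq> H ?U" using insert.hyps(2) insert.prems(1) H_self(1)[OF U] by blast
    then have "z \<in> H ?U" using H_least[OF J.ideal_axioms _ H_self(2)[OF U]] c(2) by blast
    moreover have "x \<ominus> t \<otimes> p \<in> H ?U" using insert.prems(4) H_self(2)[OF U] by blast
    moreover have "t \<in> H ?U" using H_self(1)[OF U] by blast
    then have "t \<otimes> p \<in> H ?U" using J.I_r_closed pc by blast
    ultimately have "((x \<ominus> t \<otimes> p) \<oplus> t \<otimes> p) \<ominus> z \<in> H ?U"
      using J.I_add_closed J.I_minus_closed by blast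
    moreover have "((x \<ominus> t \<otimes> p) \<oplus> t \<otimes> p) \<ominus> z = c \<otimes> h"
      unfolding c(3) using c(1) hc zc pc t_carr by algebra
    ultimately have "c \<otimes> h \<in> H ?U" by simp
    then have "h \<in> H ?U" by (rule unit_solve[OF c(1) cM hc J.ideal_axioms])
    then show False using indep_mod_t[OF hG] by blast
  qed
  then obtain c' where c': "c' \<in> carrier S" "c \<ominus> t \<otimes> c' \<in> P" using M_decomp by blast
  have q: "(c \<ominus> t \<otimes> c') \<otimes> h \<in> Q" using P_mult_Q[OF c'(2) hP] .
  have "p \<ominus> c' \<otimes> h \<in> P" using P.I_minus_closed[OF insert.prems(3) P.I_l_closed[OF hP c'(1)]] .
  moreover have "z \<ominus> t \<otimes> (p \<ominus> c' \<otimes> h) = (x \<ominus> t \<otimes> p) \<ominus> (c \<ominus> t \<otimes> c') \<otimes> h"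
    unfolding c(3) using c(1) c'(1) hc zc pc t_carr by algebra
  then have "z \<ominus> t \<otimes> (p \<ominus> c' \<otimes> h) \<in> Q" using Q.I_minus_closed[OF insert.prems(4) q] by simp
  ultimately obtain y where y: "y \<in> H T" "z \<ominus> t \<otimes> y \<in> Q"
    using insert.IH[of z "p \<ominus> c' \<otimes> h"] insert.prems(1) c(2) by blast
  have yc: "y \<in> carrier S" using y(1) JT.Icarr by blast
  have "x \<ominus> t \<otimes> (c' \<otimes> h \<oplus> y) = (c \<ominus> t \<otimes> c') \<otimes> h \<oplus> (z \<ominus> t \<otimes> y)"
    unfolding c(3) using c(1) c'(1) hc zc yc t_carr by algebra
  then have "x \<ominus> t \<otimes> (c' \<otimes> h \<oplus> y) \<in> Q" using Q.I_add_closed[OF q y(2)] by simp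
  moreover have "h \<in> H (insert h T)" using H_self(1)[OF Tc(2)] by blast
  then have "c' \<otimes> h \<oplus> y \<in> H (insert h T)"
    using JhT.I_add_closed[OF JhT.I_l_closed[OF _ c'(1)]] sub y(1) by blast
  ultimately show ?case by blast
qed

text \<open>By saturation a relation for \<open>t\<^sup>i g\<close> can be divided by \<open>t\<close>, down to one for \<open>g\<close>.\<close>

lemma indep_t_pow:
  assumes g: "g \<in> G"
  shows "t [^] (i::nat) \<otimes> g \<notin> H (G - {g})"
proof (induction i)
  case 0
  then show ?case using G_min[OF g] g G_carr by auto
next
  case (Suc i)
  interpret J: ideal "H (G - {g})" S by (rule H_ideal[OF G_carr'])
  have gc: "g \<in> carrier S" and gP: "g \<in> P" using g G_carr G(1) by auto
  let ?x = "t [^] i \<otimes> g"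
  have xc: "?x \<in> carrier S" and xP: "?x \<in> P" using P.I_l_closed[OF gP] gc by auto
  show ?case
  proof
    assume "t [^] Suc i \<otimes> g \<in> H (G - {g})"
    moreover have "t [^] Suc i \<otimes> g = t \<otimes> ?x" using gc by (simp add: m_ac)
    ultimately have "t \<otimes> ?x \<in> H (G - {g})" by simp
    moreover have "t \<otimes> ?x \<ominus> t \<otimes> ?x \<in> Q" using xc by simp
    ultimately obtain y where y: "y \<in> H (G - {g})" "t \<otimes> ?x \<ominus> t \<otimes> y \<in> Q"
      using saturated[of "G - {g}" "t \<otimes> ?x" ?x] xP G(2) by blast
    have yc: "y \<in> carrier S" using y(1) J.Icarr by blast
    have "t \<otimes> (?x \<ominus> y) = t \<otimes> ?x \<ominus> t \<otimes> y" using xc yc t_carr by algebra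
    then have "?x \<ominus> y \<in> Q" using Q_cancel[OF t_carr t_P, of "?x \<ominus> y"] y(2) xc yc by simp
    then have "?x \<ominus> y \<in> H (G - {g})" using H_self(2)[OF G_carr'] by blast
    then have "?x \<in> H (G - {g})" using J.diff_mem_iff xc yc y(1) by blast
    then show False using Suc by blast
  qed
qed

lemma indep_localized:
  assumes g: "g \<in> G" and c: "c \<in> carrier S" "c \<notin> P"
  shows "c \<otimes> g \<notin> H (G - {g})"
proof
  assume cg: "c \<otimes> g \<in> H (G - {g})"
  interpret J: ideal "H (G - {g})" S by (rule H_ideal[OF G_carr'])
  have gc: "g \<in> carrier S" and gP: "g \<in> P" using g G_carr G(1) by auto
  obtain i :: nat and u where u: "u \<in> carrier S" "u \<notin> M" "c \<ominus> t [^] i \<otimes> u \<in> P"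
    using factor[OF c] by blast
  have T: "t [^] i \<in> carrier S" by simp
  have "(c \<ominus> t [^] i \<otimes> u) \<otimes> g \<in> H (G - {g})"
    using P_mult_Q[OF u(3) gP] H_self(2)[OF G_carr'] by blast
  then have "c \<otimes> g \<ominus> (c \<ominus> t [^] i \<otimes> u) \<otimes> g \<in> H (G - {g})" using J.I_minus_closed cg by blast
  moreover have "c \<otimes> g \<ominus> (c \<ominus> t [^] i \<otimes> u) \<otimes> g = u \<otimes> (t [^] i \<otimes> g)"
    using c(1) u(1) T gc by algebra
  ultimately have "u \<otimes> (t [^] i \<otimes> g) \<in> H (G - {g})" by simp
  then have "t [^] i \<otimes> g \<in> H (G - {g})"
    by (rule unit_solve[OF u(1,2) _ J.ideal_axioms, rotated]) (use T gc in simp)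
  then show False using indep_t_pow[OF g] by blast
qed

text \<open>The cotangent space of the localization at \<open>P\<close> is \<open>P / Q\<close> with scalars extended to the
  fraction field of the quotient by \<open>P\<close>, so \<open>G\<close> becomes a basis of it.\<close>

lemma embedding_dimension_localization:
  "has_embedding_dimension (localization_at S P) (card G)"
proof -
  interpret D: mult_closed S "carrier S - P" by (rule P.mult_closed_compl)
  let ?N = "{D.frac p s | p s. p \<in> P \<and> s \<in> carrier S - P}"
  interpret L: local_ring D.L ?N
    using P.local_ring_localization_at unfolding localization_at_def .
  let ?\<phi> = "\<lambda>x. D.frac x \<one>"
  interpret \<phi>: ring_hom_ring S D.L ?\<phi>
    by (rule ring_hom_ringI2[OF ring_axioms L.ring_axioms D.localization_hom])
  have \<phi>N: "?\<phi> p \<in> ?N" if "p \<in> P" for p using that D.S_one by blast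
  have scale: "D.frac p s \<in> J" if J: "ideal J D.L" and p: "p \<in> carrier S" "s \<in> carrier S - P" "?\<phi> p \<in> J"
    for J p s
    using ideal.I_l_closed[OF J p(3) D.frac_carr[OF one_closed p(2)]] D.frac_decompose[OF p(1,2)] by simp
  obtain Y where Y: "finite Y" "Idl Y = P" "Y \<subseteq> carrier S" using P_fg by blast
  have YP: "Y \<subseteq> P" using Y genideal_self by blast
  have Y': "?\<phi> ` Y \<subseteq> carrier D.L" using Y(3) by auto
  have gen: "Idl\<^bsub>D.L\<^esub> (?\<phi> ` Y) = ?N"
  proof
    show "Idl\<^bsub>D.L\<^esub> (?\<phi> ` Y) \<subseteq> ?N" using \<phi>N YP by (intro L.genideal_minimal L.N) auto
    have I: "ideal (Idl\<^bsub>D.L\<^esub> (?\<phi> ` Y)) D.L" using L.genideal_ideal Y' .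
    have "Idl Y \<subseteq> {x \<in> carrier S. ?\<phi> x \<in> Idl\<^bsub>D.L\<^esub> (?\<phi> ` Y)}"
      using L.genideal_self[OF Y'] Y(3) by (intro genideal_minimal \<phi>.ideal_vimage I) auto
    then have "P \<subseteq> {x \<in> carrier S. ?\<phi> x \<in> Idl\<^bsub>D.L\<^esub> (?\<phi> ` Y)}" using Y(2) by simp
    then show "?N \<subseteq> Idl\<^bsub>D.L\<^esub> (?\<phi> ` Y)" using scale[OF I] by blast
  qed
  have G': "?\<phi> ` G \<subseteq> carrier D.L" using G_carr by auto
  have indep: "?\<phi> g \<notin> L.cl (?\<phi> ` (G - {g}))" if g: "g \<in> G" for g
  proof -
    let ?J = "{D.frac r s | r s. r \<in> carrier S \<and> s \<in> carrier S - P \<and>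
      (\<exists>c\<in>carrier S - P. c \<otimes> r \<in> H (G - {g}))}"
    note J = D.extended_ideal[OF H_ideal[OF G_carr'[of g]]]
    have mem: "D.frac r s \<in> ?J" if "r \<in> H (G - {g})" "s \<in> carrier S - P" for r s
    proof -
      have rc: "r \<in> carrier S" using that ideal.Icarr[OF H_ideal[OF G_carr']] by blast
      then have "\<one> \<otimes> r \<in> H (G - {g})" using that by simp
      then show ?thesis using rc that(2) D.S_one by blast
    qed
    have "?\<phi> ` (G - {g}) \<subseteq> ?J" using mem D.S_one H_self(1)[OF G_carr'] by blast
    moreover have "?N \<cdot>\<^bsub>D.L\<^esub> ?N \<subseteq> ?J"
    proof
      fix y assume "y \<in> ?N \<cdot>\<^bsub>D.L\<^esub> ?N"
      then show "y \<in> ?J"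
      proof (induction rule: ideal_prod.induct)
        case (prod i j)
        then obtain p s p' s' where ps: "p \<in> P" "s \<in> carrier S - P" "i = D.frac p s"
          "p' \<in> P" "s' \<in> carrier S - P" "j = D.frac p' s'" by blast
        have "i \<otimes>\<^bsub>D.L\<^esub> j = D.frac (p \<otimes> p') (s \<otimes> s')"
          unfolding ps(3,6) by (rule D.mult_frac[OF P.Icarr[OF ps(1)] ps(2) P.Icarr[OF ps(4)] ps(5)])
        moreover have "p \<otimes> p' \<in> H (G - {g})" using P_mult_Q[OF ps(1,4)] H_self(2)[OF G_carr'] by blast
        ultimately show ?case using mem D.S_mult[OF ps(2,5)] by simp
      next
        case (sum s1 s2)
        then show ?case using additive_subgroup.a_closed[OF ideal.axioms(1)[OF J(1)]] by blast
      qed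
    qed
    ultimately have "L.cl (?\<phi> ` (G - {g})) \<subseteq> ?J" by (intro L.cl_least J(1))
    moreover have "?\<phi> g \<notin> ?J"
      using J(2)[of g \<one>] indep_localized[OF g] G_carr g D.S_one by blast
    ultimately show ?thesis by blast
  qed
  have inj: "inj_on ?\<phi> G"
  proof (rule inj_onI, rule ccontr)
    fix g g' assume g: "g \<in> G" "g' \<in> G" "?\<phi> g = ?\<phi> g'" "g \<noteq> g'"
    then have "?\<phi> g \<in> ?\<phi> ` (G - {g})" by blast
    moreover have "?\<phi> ` (G - {g}) \<subseteq> carrier D.L" using G' by blast
    ultimately show False using indep[OF g(1)] L.cl_self(1) by blast
  qed
  have "L.indep (?\<phi> ` G)"
    unfolding L.indep_def
  proof (intro conjI ballI)
    show "?\<phi> ` G \<subseteq> ?N" using G(1) \<phi>N by blast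
    fix x assume "x \<in> ?\<phi> ` G"
    then obtain g where g: "g \<in> G" "x = ?\<phi> g" by blast
    have "?\<phi> ` G - {x} = ?\<phi> ` (G - {g})" using inj g by (auto simp: inj_on_def)
    then show "x \<notin> L.cl (?\<phi> ` G - {x})" using indep[OF g(1)] g(2) by simp
  qed
  moreover have "?N \<subseteq> L.cl (?\<phi> ` G)"
  proof -
    note cl = L.cl_ideal[OF G']
    have I: "ideal {x \<in> carrier S. ?\<phi> x \<in> L.cl (?\<phi> ` G)} S" (is "ideal ?I S") using \<phi>.ideal_vimage[OF cl] .
    have "P \<cdot> P \<subseteq> ?I"
    proof
      fix y assume "y \<in> P \<cdot> P"
      then show "y \<in> ?I"
      proof (induction rule: ideal_prod.induct)
        case (prod i j)
        have ij: "i \<in> carrier S" "j \<in> carrier S" using prod P.Icarr by auto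
        have "?\<phi> i \<otimes>\<^bsub>D.L\<^esub> ?\<phi> j \<in> ?N \<cdot>\<^bsub>D.L\<^esub> ?N" using \<phi>N prod by (intro ideal_prod.prod)
        then have "?\<phi> (i \<otimes> j) \<in> L.cl (?\<phi> ` G)" using L.cl_self(2)[OF G'] \<phi>.hom_mult[OF ij] by auto
        then show ?case using ij by simp
      next
        case (sum s1 s2)
        then show ?case using additive_subgroup.a_closed[OF ideal.axioms(1)[OF I]] by blast
      qed
    qed
    have "Q \<subseteq> ?I"
    proof
      fix q assume "q \<in> Q"
      then obtain c where c: "q \<in> carrier S" "c \<in> carrier S - P" "c \<otimes> q \<in> P \<cdot> P" unfolding Q_iff by blast
      then have "?\<phi> (c \<otimes> q) \<in> L.cl (?\<phi> ` G)" using \<open>P \<cdot> P \<subseteq> ?I\<close> by blast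
      then have "D.frac (c \<otimes> q) (c \<otimes> \<one>) \<in> L.cl (?\<phi> ` G)" using scale[OF cl, of "c \<otimes> q" c] c by simp
      then have "?\<phi> q \<in> L.cl (?\<phi> ` G)" using D.frac_cancel[OF c(1) D.S_one c(2)] by simp
      then show "q \<in> ?I" using c(1) by blast
    qed
    moreover have "G \<subseteq> ?I" using L.cl_self(1)[OF G'] G_carr by blast
    ultimately have "P \<subseteq> ?I" using H_least[OF I] G(3) by blast
    then show ?thesis using scale[OF cl] by blast
  qed
  ultimately have "has_embedding_dimension D.L (card (?\<phi> ` G))"
    using L.has_embedding_dimension_basis[OF finite_imageI[OF Y(1)] Y' gen] G(2) by blast
  then show ?thesis unfolding localization_at_def using card_image[OF inj] by simp
qed

end

section \<open>The kernel of the completed inclusion\<close>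

text \<open>The uniformizer \<open>t\<close> of \<open>V\<close> is an element of \<open>A\<close>, so that the completion of \<open>V\<close> can be described by
  divisibility by powers of \<open>t\<close>.  The condition \<open>fill\<close>, that is \<open>V = A + t V\<close>, is where the equality
  \<open>V = A + m V\<close> of tight domination enters.\<close>

locale tight = F: field F + complete_local "F\<lparr>carrier := A\<rparr>" S \<iota> K pw X
  for F (structure) and A and S and \<iota> and K :: "nat \<Rightarrow> 'c set" and pw X +
  fixes V and t
  assumes subring_A: "subring A F" and subring_V: "subring V F" and A_V: "A \<subseteq> V"
    and t: "t \<in> A" "t \<noteq> \<zero>"
    and t_pw: "t [^] (n::nat) \<in> pw n"
    and pw_V: "a \<in> pw n \<Longrightarrow> \<exists>v\<in>V. a = t [^] n \<otimes> v"
    and fill: "v \<in> V \<Longrightarrow> \<exists>a\<in>A. \<exists>v'\<in>V. v = a \<oplus> t \<otimes> v'"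
    and V_sep: "v \<in> V \<Longrightarrow> (\<And>n::nat. \<exists>v'\<in>V. v = t [^] n \<otimes> v') \<Longrightarrow> v = \<zero>"
    and t_nonunit: "v \<in> V \<Longrightarrow> t \<otimes> v \<noteq> \<one>"
begin

lemma A_carr: "a \<in> A \<Longrightarrow> a \<in> carrier F" and V_carr: "a \<in> V \<Longrightarrow> a \<in> carrier F"
  using subringE(1)[OF subring_A] subringE(1)[OF subring_V] by auto

lemma A_ring: "\<zero> \<in> A" "\<one> \<in> A" "a \<in> A \<Longrightarrow> \<ominus> a \<in> A"
    "a \<in> A \<Longrightarrow> b \<in> A \<Longrightarrow> a \<otimes> b \<in> A" "a \<in> A \<Longrightarrow> b \<in> A \<Longrightarrow> a \<oplus> b \<in> A"
  using subringE[OF subring_A] by auto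

lemma A_minus: "a \<in> A \<Longrightarrow> b \<in> A \<Longrightarrow> a \<ominus> b \<in> A"
  by (simp add: a_minus_def A_ring)

lemma V_ring: "\<zero> \<in> V" "\<one> \<in> V" "a \<in> V \<Longrightarrow> \<ominus> a \<in> V"
    "a \<in> V \<Longrightarrow> b \<in> V \<Longrightarrow> a \<otimes> b \<in> V" "a \<in> V \<Longrightarrow> b \<in> V \<Longrightarrow> a \<oplus> b \<in> V"
  using subringE[OF subring_V] by auto

lemma t_pow_A: "t [^] (n::nat) \<in> A"
  by (induction n) (auto simp: A_ring t)

lemma t_carr: "t \<in> carrier F" using t A_carr by blast

lemma t_pow_nonzero: "t [^] (n::nat) \<noteq> \<zero>"
  by (induction n) (auto simp: t t_carr F.integral_iff)

lemma \<iota>_closed [simp]: "a \<in> A \<Longrightarrow> \<iota> a \<in> carrier S"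
  and \<iota>_add: "a \<in> A \<Longrightarrow> b \<in> A \<Longrightarrow> \<iota> (a \<oplus> b) = \<iota> a \<boxplus> \<iota> b"
  and \<iota>_mult: "a \<in> A \<Longrightarrow> b \<in> A \<Longrightarrow> \<iota> (a \<otimes> b) = \<iota> a \<boxtimes> \<iota> b"
  and \<iota>_zero: "\<iota> \<zero> = \<zero>\<^bsub>S\<^esub>" and \<iota>_one: "\<iota> \<one> = \<one>\<^bsub>S\<^esub>"
  using hom.hom_closed[of a] hom.hom_add[of a b] hom.hom_mult[of a b] hom.hom_zero hom.hom_one
  by simp_all

lemma \<iota>_neg: assumes "a \<in> A" shows "\<iota> (\<ominus> a) = \<ominus>\<^bsub>S\<^esub> \<iota> a"
proof -
  have "\<iota> (\<ominus> a) \<boxplus> \<iota> a = \<iota> (\<ominus> a \<oplus> a)" using assms by (simp add: \<iota>_add A_ring)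
  also have "\<dots> = \<zero>\<^bsub>S\<^esub>" using A_carr[OF assms] by (simp add: F.l_neg \<iota>_zero)
  finally have "\<ominus>\<^bsub>S\<^esub> \<iota> a = \<iota> (\<ominus> a)" using assms by (intro S.minus_equality) (simp_all add: A_ring)
  then show ?thesis ..
qed

lemma \<iota>_diff: "a \<in> A \<Longrightarrow> b \<in> A \<Longrightarrow> \<iota> (a \<ominus> b) = \<iota> a \<boxminus> \<iota> b"
  by (simp add: a_minus_def \<iota>_add \<iota>_neg A_ring)

lemma \<iota>_t_pow: "\<iota> (t [^] (n::nat)) = \<iota> t [^]\<^bsub>S\<^esub> n"
  by (induction n) (auto simp: \<iota>_one \<iota>_mult t t_pow_A)

lemma dense_A: "s \<in> carrier S \<Longrightarrow> \<exists>a\<in>A. s \<boxminus> \<iota> a \<in> K n"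
  using dense by simp

lemma \<iota>_K_A: "a \<in> A \<Longrightarrow> \<iota> a \<in> K n \<longleftrightarrow> a \<in> pw n"
  using \<iota>_K by simp

definition W :: "nat \<Rightarrow> 'a set"
  where "W n = {t [^] n \<otimes> v | v. v \<in> V}"

lemma W_I: "v \<in> V \<Longrightarrow> t [^] n \<otimes> v \<in> W n"
  unfolding W_def by blast

lemma W_V: "W n \<subseteq> V"
  unfolding W_def using t_pow_A[of n] A_V V_ring(4)[of "t [^] n"] by blast

lemma W_add: assumes "a \<in> W n" "b \<in> W n" shows "a \<oplus> b \<in> W n"
proof -
  obtain v w where v: "v \<in> V" "w \<in> V" "a = t [^] n \<otimes> v" "b = t [^] n \<otimes> w"
    using assms unfolding W_def by auto
  then have "a \<oplus> b = t [^] n \<otimes> (v \<oplus> w)" using V_carr t_carr by (simp add: F.r_distr)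
  then show ?thesis using W_I[OF V_ring(5)[OF v(1,2)]] by simp
qed

lemma W_mult: assumes "a \<in> W n" "b \<in> V" shows "b \<otimes> a \<in> W n"
proof -
  obtain v where v: "v \<in> V" "a = t [^] n \<otimes> v" using assms unfolding W_def by auto
  then have "b \<otimes> a = t [^] n \<otimes> (b \<otimes> v)" using V_carr assms(2) t_carr by (simp add: F.m_ac)
  then show ?thesis using W_I[OF V_ring(4)[OF assms(2) v(1)]] by simp
qed

lemma W_neg: assumes "a \<in> W n" shows "\<ominus> a \<in> W n"
  using W_mult[OF assms V_ring(3)[OF V_ring(2)]] V_carr[OF subsetD[OF W_V assms]]
  by (simp add: F.l_minus)

lemma W_diff: "a \<in> W n \<Longrightarrow> b \<in> W n \<Longrightarrow> a \<ominus> b \<in> W n"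
  by (simp add: a_minus_def W_add W_neg)

lemma pw_W: "pw n \<subseteq> W n"
  using pw_V unfolding W_def by blast

lemma pw_1: "W 1 \<inter> A \<subseteq> pw 1"
proof
  fix a assume a: "a \<in> W 1 \<inter> A"
  then obtain v where v: "v \<in> V" "a = t \<otimes> v" unfolding W_def using t_carr by auto
  show "a \<in> pw 1"
  proof (rule ccontr)
    assume "a \<notin> pw 1"
    then have "a \<in> Units (F\<lparr>carrier := A\<rparr>)" using A_Units[of a] a by simp
    then obtain b where "b \<in> A" "a \<otimes> b = \<one>" unfolding Units_def by auto
    then have "t \<otimes> (v \<otimes> b) = \<one>" "v \<otimes> b \<in> V"
      using v V_carr A_carr t_carr V_ring A_V by (auto simp: F.m_assoc)
    then show False using t_nonunit by blast
  qed
qed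

text \<open>The kernel of the map of completions, by approximation: its elements are congruent to
  elements of \<open>A\<close> that are divisible in \<open>V\<close> by arbitrarily high powers of \<open>t\<close>.\<close>

definition P :: "'c set"
  where "P = {f \<in> carrier S. \<forall>n. \<exists>a\<in>A. a \<in> W n \<and> f \<boxminus> \<iota> a \<in> K n}"

lemma P_carr: "f \<in> P \<Longrightarrow> f \<in> carrier S" unfolding P_def by blast

lemma P_approx: assumes f: "f \<in> P" "a \<in> A" "f \<boxminus> \<iota> a \<in> K n" shows "a \<in> W n"
proof -
  obtain b where b: "b \<in> A" "b \<in> W n" "f \<boxminus> \<iota> b \<in> K n" using f(1) unfolding P_def by blast
  have "\<iota> a \<boxminus> f \<in> K n" using K.diff_sym f P_carr \<iota>_closed by blast
  then have "\<iota> (a \<ominus> b) \<in> K n"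
    using K.diff_trans[OF _ b(3)] f P_carr b \<iota>_closed by (simp add: \<iota>_diff)
  then have "a \<ominus> b \<in> W n" using \<iota>_K_A f b pw_W A_minus by blast
  then have "(a \<ominus> b) \<oplus> b \<in> W n" using W_add b by blast
  moreover have "(a \<ominus> b) \<oplus> b = a" using A_carr[OF f(2)] A_carr[OF b(1)] by algebra
  ultimately show ?thesis by simp
qed

lemma P_ideal: "ideal P S"
proof (rule idealI)
  show "ring S" by (rule S.ring_axioms)
  show "subgroup P (add_monoid S)"
  proof (rule S.add.subgroupI)
    show "P \<subseteq> carrier S" using P_carr by blast
    have "\<zero> \<in> W n" for n unfolding W_def using V_ring t_carr by (auto intro!: exI[of _ \<zero>])
    then have "\<zero>\<^bsub>S\<^esub> \<in> P" unfolding P_def using A_ring by (auto intro!: bexI[of _ \<zero>] simp: \<iota>_zero)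
    then show "P \<noteq> {}" by blast
    fix f assume f: "f \<in> P"
    note fc = P_carr[OF f]
    have "\<exists>a\<in>A. a \<in> W n \<and> \<ominus>\<^bsub>S\<^esub> f \<boxminus> \<iota> a \<in> K n" for n
    proof -
      obtain a where a: "a \<in> A" "a \<in> W n" "f \<boxminus> \<iota> a \<in> K n" using f unfolding P_def by blast
      have "\<ominus>\<^bsub>S\<^esub> f \<boxminus> \<iota> (\<ominus> a) = \<ominus>\<^bsub>S\<^esub> (f \<boxminus> \<iota> a)"
        unfolding \<iota>_neg[OF a(1)] using fc \<iota>_closed[OF a(1)] by algebra
      then show ?thesis using a A_ring(3) W_neg K.I_neg_closed[OF a(3)] by metis
    qed
    then show "\<ominus>\<^bsub>S\<^esub> f \<in> P" unfolding P_def using fc by simp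
    fix g assume g: "g \<in> P"
    note gc = P_carr[OF g]
    have "\<exists>a\<in>A. a \<in> W n \<and> (f \<boxplus> g) \<boxminus> \<iota> a \<in> K n" for n
    proof -
      obtain a where a: "a \<in> A" "a \<in> W n" "f \<boxminus> \<iota> a \<in> K n" using f unfolding P_def by blast
      obtain b where b: "b \<in> A" "b \<in> W n" "g \<boxminus> \<iota> b \<in> K n" using g unfolding P_def by blast
      have "(f \<boxplus> g) \<boxminus> \<iota> (a \<oplus> b) \<in> K n"
        unfolding \<iota>_add[OF a(1) b(1)] using K.diff_add[OF a(3) b(3)] fc gc a b by simp
      then show ?thesis using a b A_ring(5) W_add by blast
    qed
    then show "f \<boxplus> g \<in> P" unfolding P_def using fc gc by simp
  qed
  fix f x assume f: "f \<in> P" and x: "x \<in> carrier S"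
  note fc = P_carr[OF f]
  have "\<exists>a\<in>A. a \<in> W n \<and> x \<boxtimes> f \<boxminus> \<iota> a \<in> K n" for n
  proof -
    obtain a where a: "a \<in> A" "a \<in> W n" "f \<boxminus> \<iota> a \<in> K n" using f unfolding P_def by blast
    obtain b where b: "b \<in> A" "x \<boxminus> \<iota> b \<in> K n" using dense_A x by blast
    have "x \<boxtimes> f \<boxminus> \<iota> (b \<otimes> a) = f \<boxtimes> (x \<boxminus> \<iota> b) \<boxplus> \<iota> b \<boxtimes> (f \<boxminus> \<iota> a)"
      unfolding \<iota>_mult[OF b(1) a(1)] using fc x \<iota>_closed[OF a(1)] \<iota>_closed[OF b(1)] by algebra
    also have "\<dots> \<in> K n"
      using K.I_l_closed[OF b(2) fc] K.I_l_closed[OF a(3) \<iota>_closed[OF b(1)]] by (rule K.I_add_closed)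
    finally show ?thesis using a b A_ring(4) W_mult A_V by blast
  qed
  then show "x \<boxtimes> f \<in> P" unfolding P_def using fc x by simp
  then show "f \<boxtimes> x \<in> P" using S.m_comm fc x by simp
qed

sublocale P: ideal P S by (rule P_ideal)

lemma \<iota>_in_P: assumes "a \<in> A" "\<iota> a \<in> P" shows "a = \<zero>"
proof (rule V_sep)
  show "a \<in> V" using assms A_V by blast
  fix n :: nat
  have "a \<in> W n" using P_approx[OF assms(2,1), of n] assms by simp
  then show "\<exists>v'\<in>V. a = t [^] n \<otimes> v'" unfolding W_def by blast
qed

lemma P_K1: "P \<subseteq> K 1"
proof
  fix f assume f: "f \<in> P"
  then obtain a where a: "a \<in> A" "a \<in> W 1" "f \<boxminus> \<iota> a \<in> K 1" unfolding P_def by blast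
  then have "\<iota> a \<in> K 1" using pw_1 \<iota>_K_A by blast
  then show "f \<in> K 1" using K.diff_mem_iff[OF a(3)] P_carr f a by simp
qed

lemma t_K: "\<iota> t \<in> K 1"
  using t_pw[of 1] t t_carr \<iota>_K_A by simp

text \<open>Repeated use of \<open>fill\<close> expands \<open>v\<close> as a series \<open>b\<^sub>0 + b\<^sub>1 t + b\<^sub>2 t\<^sup>2 + \<dots>\<close> with coefficients in \<open>A\<close>,
  which converges in the completion of \<open>A\<close>.  So \<open>V\<close> lies in the image of that completion.\<close>

lemma lift_V:
  assumes v: "v \<in> V"
  shows "\<exists>s\<in>carrier S. \<forall>n. \<exists>a\<in>A. s \<boxminus> \<iota> a \<in> K n \<and> v \<ominus> a \<in> W n"
proof -
  let ?ok = "\<lambda>(n::nat) x. fst x \<in> A \<and> snd x \<in> V \<and> v = fst x \<oplus> t [^] n \<otimes> snd x"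
  have base: "\<exists>x. ?ok 0 x" using v V_carr A_ring(1) by (intro exI[of _ "(\<zero>, v)"]) simp
  have step: "\<exists>y. ?ok (Suc n) y \<and> fst y \<ominus> fst x \<in> pw n" if x: "?ok n x" for n x
  proof -
    obtain a v' where x': "x = (a, v')" "a \<in> A" "v' \<in> V" "v = a \<oplus> t [^] n \<otimes> v'"
      using x by (cases x) auto
    obtain b v'' where b: "b \<in> A" "v'' \<in> V" "v' = b \<oplus> t \<otimes> v''" using fill x' by blast
    note c = A_carr[OF x'(2)] V_carr[OF b(2)] A_carr[OF b(1)] A_carr[OF t_pow_A[of n]] t_carr
    have "v = (a \<oplus> t [^] n \<otimes> b) \<oplus> t [^] Suc n \<otimes> v''"
      unfolding x'(4) b(3) using c by (simp add: F.r_distr F.a_ac F.m_ac)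
    moreover have "a \<oplus> t [^] n \<otimes> b \<in> A" using x' b t_pow_A A_ring by blast
    moreover have "(a \<oplus> t [^] n \<otimes> b) \<ominus> a = t [^] n \<otimes> b" using c by algebra
    moreover have "t [^] n \<otimes> b \<in> pw n" using ideal.I_r_closed[OF pw_ideal t_pw, of b] b by simp
    ultimately show ?thesis using b by (intro exI[of _ "(a \<oplus> t [^] n \<otimes> b, v'')"]) (auto simp: x'(1))
  qed
  have "\<exists>x. \<forall>n. ?ok n (x n) \<and> fst (x (Suc n)) \<ominus> fst (x n) \<in> pw n"
    by (rule dependent_nat_choice[OF base step])
  then obtain x where x: "\<And>n. ?ok n (x n)" "\<And>n. fst (x (Suc n)) \<ominus> fst (x n) \<in> pw n"
    by metis
  define a where "a n = fst (x n)" for n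
  have a: "a n \<in> A" "a (Suc n) \<ominus> a n \<in> pw n" for n
    using x(1)[of n] x(2)[of n] unfolding a_def by simp_all
  have va: "v \<ominus> a n \<in> W n" for n
  proof -
    obtain v' where v': "v' \<in> V" "v = a n \<oplus> t [^] n \<otimes> v'"
      using x(1)[of n] unfolding a_def by blast
    have "v \<ominus> a n = t [^] n \<otimes> v'"
      unfolding v'(2) using A_carr[OF a(1)[of n]] V_carr[OF v'(1)] A_carr[OF t_pow_A[of n]] by algebra
    then show ?thesis using v'(1) unfolding W_def by blast
  qed
  have "\<iota> (a (Suc n)) \<boxminus> \<iota> (a n) \<in> K n" for n
    using a(2)[of n] a(1) \<iota>_K_A[of "a (Suc n) \<ominus> a n"] A_minus by (simp add: \<iota>_diff)
  then obtain s where s: "s \<in> carrier S" "\<And>n. s \<boxminus> \<iota> (a n) \<in> K n"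
    using complete[of "\<lambda>n. \<iota> (a n)"] a(1) \<iota>_closed by blast
  with va a show ?thesis by blast
qed

lemma X_A: "X \<subseteq> A" using X by simp

lemma X_pw: "x \<in> X \<Longrightarrow> x \<in> pw 1"
proof -
  assume x: "x \<in> X"
  have "\<one> \<in> pw 0" using \<iota>_K_A[of \<one> 0] A_ring by (simp add: K_0)
  moreover have "x \<in> Idl\<^bsub>F\<lparr>carrier := A\<rparr>\<^esub> X" using A.genideal_self[OF X(2)] x by blast
  ultimately have "\<one> \<otimes>\<^bsub>F\<lparr>carrier := A\<rparr>\<^esub> x \<in> pw (Suc 0)" unfolding pw_Suc by (rule ideal_prod.prod)
  then show "x \<in> pw 1" using A_carr[OF subsetD[OF X_A x]] by simp
qed

lemma K1_decomp_ideal: "ideal {f \<in> carrier S. \<exists>g\<in>carrier S. f \<boxminus> \<iota> t \<boxtimes> g \<in> P} S" (is "ideal ?J S")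
proof -
  have tS: "\<iota> t \<in> carrier S" using t by simp
  have "?J = PIdl\<^bsub>S\<^esub> (\<iota> t) <+>\<^bsub>S\<^esub> P"
  proof
    show "?J \<subseteq> PIdl\<^bsub>S\<^esub> (\<iota> t) <+>\<^bsub>S\<^esub> P"
    proof
      fix f assume "f \<in> ?J"
      then obtain g where g: "f \<in> carrier S" "g \<in> carrier S" "f \<boxminus> \<iota> t \<boxtimes> g \<in> P" by blast
      have "f = g \<boxtimes> \<iota> t \<boxplus> (f \<boxminus> \<iota> t \<boxtimes> g)" using g(1,2) tS by algebra
      moreover have "g \<boxtimes> \<iota> t \<in> PIdl\<^bsub>S\<^esub> (\<iota> t)" using g unfolding cgenideal_def by blast
      ultimately show "f \<in> PIdl\<^bsub>S\<^esub> (\<iota> t) <+>\<^bsub>S\<^esub> P" using g(3) set_add_closedI[where R = S] by metis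
    qed
    show "PIdl\<^bsub>S\<^esub> (\<iota> t) <+>\<^bsub>S\<^esub> P \<subseteq> ?J"
    proof
      fix f assume "f \<in> PIdl\<^bsub>S\<^esub> (\<iota> t) <+>\<^bsub>S\<^esub> P"
      then obtain g p where g: "g \<in> carrier S" "p \<in> P" "f = g \<boxtimes> \<iota> t \<boxplus> p"
        unfolding set_add_def' cgenideal_def by auto
      have "f \<boxminus> \<iota> t \<boxtimes> g = p" unfolding g(3) using g(1) P_carr[OF g(2)] tS by algebra
      then have "f \<boxminus> \<iota> t \<boxtimes> g \<in> P" using g(2) by simp
      moreover have "f \<in> carrier S" using g P_carr tS by simp
      ultimately show "f \<in> ?J" using g(1) by blast
    qed
  qed
  then show ?thesis using S.add_ideals[OF S.cgenideal_ideal[OF tS] P_ideal] by simp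
qed

lemma K1_generated: "K 1 \<subseteq> Idl\<^bsub>S\<^esub> (\<iota> ` X)"
proof -
  have "\<iota> ` X \<subseteq> carrier S" using X_A by auto
  then have "(Idl\<^bsub>S\<^esub> (\<iota> ` X)) \<cdot>\<^bsub>S\<^esub> K 0 \<subseteq> Idl\<^bsub>S\<^esub> (\<iota> ` X)"
    using S.ideal_prod_inter[OF S.genideal_ideal K_ideal] by blast
  then show ?thesis using K_Suc_generated[of _ 0] by auto
qed

text \<open>A generator \<open>x\<close> of the maximal ideal of \<open>A\<close> is \<open>t v\<close> for some \<open>v\<close> in \<open>V\<close>; lifting \<open>v\<close> to \<open>s\<close>
  makes \<open>x\<close> congruent to \<open>t s\<close> modulo \<open>P\<close>.\<close>

lemma K1_decomp:
  assumes f: "f \<in> K 1"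
  shows "\<exists>g\<in>carrier S. f \<boxminus> \<iota> t \<boxtimes> g \<in> P"
proof -
  let ?J = "{f \<in> carrier S. \<exists>g\<in>carrier S. f \<boxminus> \<iota> t \<boxtimes> g \<in> P}"
  have tS: "\<iota> t \<in> carrier S" using t by simp
  have "\<iota> x \<in> ?J" if x: "x \<in> X" for x
  proof -
    have xA: "x \<in> A" using x X_A by blast
    obtain v where v: "v \<in> V" "x = t \<otimes> v" using pw_V[OF X_pw[OF x]] t_carr by auto
    obtain s where s: "s \<in> carrier S" "\<And>n. \<exists>a\<in>A. s \<boxminus> \<iota> a \<in> K n \<and> v \<ominus> a \<in> W n"
      using lift_V[OF v(1)] by blast
    have "\<exists>a\<in>A. a \<in> W n \<and> (\<iota> x \<boxminus> \<iota> t \<boxtimes> s) \<boxminus> \<iota> a \<in> K n" for n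
    proof -
      obtain a where a: "a \<in> A" "s \<boxminus> \<iota> a \<in> K n" "v \<ominus> a \<in> W n" using s(2) by blast
      have "x \<ominus> t \<otimes> a = t \<otimes> (v \<ominus> a)"
        unfolding v(2) using t_carr V_carr[OF v(1)] A_carr[OF a(1)] by algebra
      then have "x \<ominus> t \<otimes> a \<in> W n" using W_mult[OF a(3)] t A_V by auto
      moreover have "x \<ominus> t \<otimes> a \<in> A" using A_minus[OF xA A_ring(4)[OF t(1) a(1)]] .
      moreover have "(\<iota> x \<boxminus> \<iota> t \<boxtimes> s) \<boxminus> \<iota> (x \<ominus> t \<otimes> a) = \<ominus>\<^bsub>S\<^esub> (\<iota> t \<boxtimes> (s \<boxminus> \<iota> a))"
      proof -
        have e: "\<iota> (x \<ominus> t \<otimes> a) = \<iota> x \<boxminus> \<iota> t \<boxtimes> \<iota> a"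
          using xA a t by (simp add: \<iota>_diff \<iota>_mult A_ring)
        show ?thesis unfolding e using tS s(1) \<iota>_closed[OF xA] \<iota>_closed[OF a(1)] by algebra
      qed
      moreover have "\<ominus>\<^bsub>S\<^esub> (\<iota> t \<boxtimes> (s \<boxminus> \<iota> a)) \<in> K n"
        using K.I_neg_closed[OF K.I_l_closed[OF a(2) tS]] .
      ultimately show ?thesis by (intro bexI[of _ "x \<ominus> t \<otimes> a"]) simp_all
    qed
    then have "\<iota> x \<boxminus> \<iota> t \<boxtimes> s \<in> P" unfolding P_def using xA tS s(1) by simp
    then show ?thesis using s(1) \<iota>_closed[OF xA] by blast
  qed
  then have "Idl\<^bsub>S\<^esub> (\<iota> ` X) \<subseteq> ?J" by (intro S.genideal_minimal K1_decomp_ideal) auto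
  then show ?thesis using f K1_generated by blast
qed

lemma mem_P_if_all_powers:
  assumes f: "f \<in> carrier S" and "\<And>i::nat. \<exists>g\<in>carrier S. f \<boxminus> \<iota> t [^]\<^bsub>S\<^esub> i \<boxtimes> g \<in> P"
  shows "f \<in> P"
proof -
  have "\<exists>a\<in>A. a \<in> W n \<and> f \<boxminus> \<iota> a \<in> K n" for n
  proof -
    let ?T = "\<iota> (t [^] n)"
    obtain g where g: "g \<in> carrier S" "f \<boxminus> ?T \<boxtimes> g \<in> P"
      using assms(2)[of n] unfolding \<iota>_t_pow by blast
    obtain b where b: "b \<in> A" "g \<boxminus> \<iota> b \<in> K n" using dense_A g by blast
    obtain c where c: "c \<in> A" "c \<in> W n" "(f \<boxminus> ?T \<boxtimes> g) \<boxminus> \<iota> c \<in> K n"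
      using g(2) unfolding P_def by blast
    have TS: "?T \<in> carrier S" using t_pow_A by simp
    have b': "t [^] n \<otimes> b \<in> W n" "t [^] n \<otimes> b \<in> A"
      using W_I[OF subsetD[OF A_V b(1)]] A_ring(4)[OF t_pow_A b(1)] .
    have a: "c \<oplus> t [^] n \<otimes> b \<in> W n" "c \<oplus> t [^] n \<otimes> b \<in> A"
      using W_add[OF c(2) b'(1)] A_ring(5)[OF c(1) b'(2)] .
    have e: "\<iota> (c \<oplus> t [^] n \<otimes> b) = \<iota> c \<boxplus> ?T \<boxtimes> \<iota> b"
      using b c t_pow_A by (simp add: \<iota>_add \<iota>_mult A_ring)
    have "f \<boxminus> \<iota> (c \<oplus> t [^] n \<otimes> b) = ((f \<boxminus> ?T \<boxtimes> g) \<boxminus> \<iota> c) \<boxplus> ?T \<boxtimes> (g \<boxminus> \<iota> b)"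
      unfolding e using f g(1) TS \<iota>_closed[OF b(1)] \<iota>_closed[OF c(1)] by algebra
    also have "\<dots> \<in> K n" using c(3) K.I_l_closed[OF b(2) TS] by (rule K.I_add_closed)
    finally show ?thesis using a by blast
  qed
  then show ?thesis unfolding P_def using f by simp
qed

lemma factor_P:
  assumes f: "f \<in> carrier S" "f \<notin> P"
  shows "\<exists>i::nat. \<exists>u\<in>carrier S - K 1. f \<boxminus> \<iota> t [^]\<^bsub>S\<^esub> i \<boxtimes> u \<in> P"
proof -
  let ?Q = "\<lambda>i::nat. \<exists>g\<in>carrier S. f \<boxminus> \<iota> t [^]\<^bsub>S\<^esub> i \<boxtimes> g \<in> P"
  have Q0: "?Q 0" using f(1) by (intro bexI[of _ f]) simp_all
  have "\<exists>i. ?Q i \<and> \<not> ?Q (Suc i)"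
  proof (rule ccontr)
    assume "\<nexists>i. ?Q i \<and> \<not> ?Q (Suc i)"
    then have step: "?Q i \<Longrightarrow> ?Q (Suc i)" for i by blast
    have "?Q i" for i by (induction i) (fact Q0, fact step)
    then show False using mem_P_if_all_powers[OF f(1)] f(2) by blast
  qed
  then obtain i where i: "?Q i" "\<not> ?Q (Suc i)" by blast
  then obtain u where u: "u \<in> carrier S" "f \<boxminus> \<iota> t [^]\<^bsub>S\<^esub> i \<boxtimes> u \<in> P" by blast
  have "u \<notin> K 1"
  proof
    assume "u \<in> K 1"
    then obtain h where h: "h \<in> carrier S" "u \<boxminus> \<iota> t \<boxtimes> h \<in> P" using K1_decomp by blast
    let ?T = "\<iota> t [^]\<^bsub>S\<^esub> i"
    have tS: "\<iota> t \<in> carrier S" using t by simp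
    then have TS: "?T \<in> carrier S" by simp
    have "f \<boxminus> (?T \<boxtimes> \<iota> t) \<boxtimes> h = (f \<boxminus> ?T \<boxtimes> u) \<boxplus> ?T \<boxtimes> (u \<boxminus> \<iota> t \<boxtimes> h)"
      using f(1) u(1) h(1) tS TS by algebra
    also have "\<dots> \<in> P" using u(2) P.I_l_closed[OF h(2) TS] by (rule P.I_add_closed)
    finally have "f \<boxminus> \<iota> t [^]\<^bsub>S\<^esub> Suc i \<boxtimes> h \<in> P" by simp
    then show False using i(2) h(1) by blast
  qed
  then show ?thesis using u by blast
qed

lemma K1_not_one: "\<one>\<^bsub>S\<^esub> \<notin> K 1"
proof
  assume "\<one>\<^bsub>S\<^esub> \<in> K 1"
  then have "\<one> \<in> pw 1" using \<iota>_K_A[of \<one> 1] A_ring by (simp add: \<iota>_one)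
  then obtain v where "v \<in> V" "\<one> = t \<otimes> v" using pw_V[of \<one> 1] t_carr by auto
  then show False using t_nonunit[of v] by simp
qed

lemma t_pow_notin_P: "\<iota> t [^]\<^bsub>S\<^esub> (n::nat) \<notin> P"
  using \<iota>_in_P[OF t_pow_A] t_pow_nonzero unfolding \<iota>_t_pow by blast

sublocale local_ring S "K 1"
  using K1_not_one Units_notin_K K_ideal by unfold_locales auto

text \<open>Elements outside \<open>P\<close> are powers of \<open>t\<close> times units modulo \<open>P\<close>, and no power of \<open>t\<close> lies in \<open>P\<close>
  because \<open>P\<close> meets \<open>A\<close> in zero only.\<close>

lemma P_prime: "primeideal P S"
proof (rule primeidealI[OF P_ideal S.cring_axioms])
  show "carrier S \<noteq> P" using P_K1 K1_not_one by auto
  fix f g assume f: "f \<in> carrier S" and g: "g \<in> carrier S" and fg: "f \<boxtimes> g \<in> P"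
  show "f \<in> P \<or> g \<in> P"
  proof (rule ccontr)
    assume "\<not> (f \<in> P \<or> g \<in> P)"
    then obtain i j :: nat and u u' where u: "u \<in> carrier S" "u \<notin> K 1" "f \<boxminus> \<iota> t [^]\<^bsub>S\<^esub> i \<boxtimes> u \<in> P"
      and u': "u' \<in> carrier S" "u' \<notin> K 1" "g \<boxminus> \<iota> t [^]\<^bsub>S\<^esub> j \<boxtimes> u' \<in> P"
      using factor_P[OF f] factor_P[OF g] by blast
    let ?T = "\<iota> t [^]\<^bsub>S\<^esub> i" and ?T' = "\<iota> t [^]\<^bsub>S\<^esub> j"
    have tS: "\<iota> t \<in> carrier S" using t by simp
    then have T: "?T \<in> carrier S" "?T' \<in> carrier S" by auto
    have "u' \<boxtimes> (u \<boxtimes> (?T \<boxtimes> ?T')) =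
        f \<boxtimes> g \<boxminus> (g \<boxtimes> (f \<boxminus> ?T \<boxtimes> u) \<boxplus> (?T \<boxtimes> u) \<boxtimes> (g \<boxminus> ?T' \<boxtimes> u'))"
      using f g u(1) u'(1) T by algebra
    moreover have "f \<boxtimes> g \<boxminus> (g \<boxtimes> (f \<boxminus> ?T \<boxtimes> u) \<boxplus> (?T \<boxtimes> u) \<boxtimes> (g \<boxminus> ?T' \<boxtimes> u')) \<in> P"
      by (rule P.I_minus_closed[OF fg P.I_add_closed[OF P.I_l_closed[OF u(3) g]
        P.I_l_closed[OF u'(3) S.m_closed[OF T(1) u(1)]]]])
    ultimately have "u' \<boxtimes> (u \<boxtimes> (?T \<boxtimes> ?T')) \<in> P" by (rule ssubst)
    then have "u \<boxtimes> (?T \<boxtimes> ?T') \<in> P"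
      by (rule unit_solve[OF u'(1,2) _ P_ideal, rotated]) (use T u(1) in simp)
    then have "?T \<boxtimes> ?T' \<in> P" by (rule unit_solve[OF u(1,2) _ P_ideal, rotated]) (use T in simp)
    then have "\<iota> t [^]\<^bsub>S\<^esub> (i + j) \<in> P" using tS by (simp add: S.nat_pow_mult)
    then show False using t_pow_notin_P by blast
  qed
qed

lemma t_cancel_P:
  assumes "h \<in> carrier S" "\<iota> t \<boxtimes> h \<in> P" shows "h \<in> P"
  using primeideal.I_prime[OF P_prime, of "\<iota> t" h] assms t t_pow_notin_P[of 1] by auto

text \<open>If \<open>X\<close> generates the maximal ideal of \<open>A\<close> and \<open>x\<close> is congruent to \<open>t g x\<close> modulo \<open>P\<close>, then the
  differences \<open>x - t g x\<close> generate \<open>P\<close>: an element \<open>f\<close> of \<open>P\<close> is \<open>y + t f'\<close> with \<open>y\<close> in the ideal of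
  these differences and \<open>f'\<close> again in \<open>P\<close>, and the resulting series for \<open>f\<close> converges in that
  ideal.  This replaces the theorem that the completion is Noetherian.\<close>

lemma P_finitely_generated: "\<exists>Y\<subseteq>carrier S. finite Y \<and> Idl\<^bsub>S\<^esub> Y = P"
proof -
  have tS: "\<iota> t \<in> carrier S" using t by simp
  have "\<forall>x\<in>X. \<exists>g\<in>carrier S. \<iota> x \<boxminus> \<iota> t \<boxtimes> g \<in> P"
    using K1_decomp X_pw \<iota>_K_A X_A by blast
  then obtain g where g: "\<And>x. x \<in> X \<Longrightarrow> g x \<in> carrier S"
    "\<And>x. x \<in> X \<Longrightarrow> \<iota> x \<boxminus> \<iota> t \<boxtimes> g x \<in> P" by metis
  define Y where "Y = (\<lambda>x. \<iota> x \<boxminus> \<iota> t \<boxtimes> g x) ` X"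
  have Y: "finite Y" "Y \<subseteq> P" "Y \<subseteq> carrier S" unfolding Y_def using X(1) g P_carr by auto
  have IY: "ideal (Idl\<^bsub>S\<^esub> Y) S" using S.genideal_ideal Y(3) .
  interpret IY: ideal "Idl\<^bsub>S\<^esub> Y" S by (rule IY)
  have YP: "Idl\<^bsub>S\<^esub> Y \<subseteq> P" using S.genideal_minimal[OF P_ideal Y(2)] .
  let ?J = "Idl\<^bsub>S\<^esub> (insert (\<iota> t) Y)"
  have iY: "insert (\<iota> t) Y \<subseteq> carrier S" using Y tS by simp
  interpret J: ideal ?J S using S.genideal_ideal iY .
  have "\<iota> x \<in> ?J" if x: "x \<in> X" for x
  proof -
    have "\<iota> x \<boxminus> \<iota> t \<boxtimes> g x \<in> ?J" "\<iota> t \<in> ?J"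
      using S.genideal_self[OF iY] x unfolding Y_def by auto
    then have "(\<iota> x \<boxminus> \<iota> t \<boxtimes> g x) \<boxplus> \<iota> t \<boxtimes> g x \<in> ?J"
      using g x J.I_r_closed by (intro J.I_add_closed) auto
    moreover have "(\<iota> x \<boxminus> \<iota> t \<boxtimes> g x) \<boxplus> \<iota> t \<boxtimes> g x = \<iota> x"
      using \<iota>_closed[OF subsetD[OF X_A x]] tS g(1)[OF x] by algebra
    ultimately show ?thesis by simp
  qed
  then have "K 1 \<subseteq> ?J"
    using S.genideal_minimal[OF J.ideal_axioms, of "\<iota> ` X"] K1_generated by blast
  then have step: "\<exists>f'\<in>P. \<exists>y\<in>Idl\<^bsub>S\<^esub> Y. f = y \<boxplus> \<iota> t \<boxtimes> f'" if f: "f \<in> P" for f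
  proof -
    obtain h y where h: "h \<in> carrier S" "y \<in> Idl\<^bsub>S\<^esub> Y" "f = h \<boxtimes> \<iota> t \<boxplus> y"
      using f P_K1 \<open>K 1 \<subseteq> ?J\<close> S.genideal_insert[OF tS Y(3), of f] by blast
    have "f \<boxminus> y \<in> P" using f h(2) YP P.I_minus_closed by blast
    moreover have "f \<boxminus> y = \<iota> t \<boxtimes> h" unfolding h(3) using h(1) IY.Icarr[OF h(2)] tS by algebra
    ultimately have "h \<in> P" using t_cancel_P h(1) by simp
    moreover have "f = y \<boxplus> \<iota> t \<boxtimes> h" unfolding h(3) using h(1) IY.Icarr[OF h(2)] tS by algebra
    ultimately show ?thesis using h(2) by blast
  qed
  have "f \<in> Idl\<^bsub>S\<^esub> Y" if f: "f \<in> P" for f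
  proof -
    obtain r y where r: "\<And>f. f \<in> P \<Longrightarrow> r f \<in> P" "\<And>f. f \<in> P \<Longrightarrow> y f \<in> Idl\<^bsub>S\<^esub> Y"
      "\<And>f. f \<in> P \<Longrightarrow> f = y f \<boxplus> \<iota> t \<boxtimes> r f" using step by metis
    define h where "h n = (r ^^ n) f" for n
    have h: "h n \<in> P" for n unfolding h_def by (induction n) (auto simp: f r)
    have hS: "h (Suc n) = r (h n)" for n unfolding h_def by simp
    let ?T = "\<lambda>n::nat. \<iota> t [^]\<^bsub>S\<^esub> n"
    have TK: "?T n \<in> K n" for n using \<iota>_K_A[OF t_pow_A] t_pw unfolding \<iota>_t_pow by blast
    have TS: "?T n \<in> carrier S" for n using tS by simp
    define e where "e n = ?T n \<boxtimes> y (h n)" for n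
    have yc: "y (h n) \<in> carrier S" for n using r(2)[OF h] IY.Icarr by blast
    have "e n \<in> (Idl\<^bsub>S\<^esub> Y) \<cdot>\<^bsub>S\<^esub> K (n + 0)" for n
      unfolding e_def using ideal_prod.prod[OF r(2)[OF h[of n]] TK[of n], of S] yc TS S.m_comm by simp
    then obtain s where s: "s \<in> (Idl\<^bsub>S\<^esub> Y) \<cdot>\<^bsub>S\<^esub> K 0" "\<And>n. s \<boxminus> partial_sum S e n \<in> K n"
      using convergent_sum_in_fg_ideal[OF Y(1,3), of e 0] by auto
    have sY: "s \<in> Idl\<^bsub>S\<^esub> Y" using s(1) S.ideal_prod_inter[OF IY K_ideal] by blast
    then have sc: "s \<in> carrier S" by (rule IY.Icarr)
    have ec: "e n \<in> carrier S" for n unfolding e_def using yc TS by simp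
    have fc: "f \<in> carrier S" using f P_carr by blast
    have ps: "f = partial_sum S e n \<boxplus> ?T n \<boxtimes> h n" for n
    proof (induction n)
      case 0
      then show ?case using fc by (simp add: h_def)
    next
      case (Suc n)
      have c: "h n \<in> carrier S" "h (Suc n) \<in> carrier S" using h P_carr by auto
      have "partial_sum S e (Suc n) \<boxplus> ?T (Suc n) \<boxtimes> h (Suc n) =
          partial_sum S e n \<boxplus> ?T n \<boxtimes> (y (h n) \<boxplus> \<iota> t \<boxtimes> h (Suc n))"
        using S.partial_sum_closed[of e n, OF ec] c TS[of n] tS yc[of n]
        by (simp add: e_def S.r_distr S.a_assoc S.m_assoc)
      also have "\<dots> = f" unfolding hS r(3)[OF h[of n], symmetric] using Suc by simp
      finally show ?case ..
    qed
    have "f \<boxminus> s \<in> K n" for n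
    proof -
      note pc = S.partial_sum_closed[of e n, OF ec]
      have hc: "h n \<in> carrier S" using h P_carr by auto
      have "f \<boxminus> partial_sum S e n = ?T n \<boxtimes> h n"
        by (subst ps[of n]) (use pc TS[of n] hc in algebra)
      then have "f \<boxminus> partial_sum S e n \<in> K n" using K.I_r_closed[OF TK hc] by simp
      then show ?thesis using K.diff_trans[OF _ K.diff_sym[OF s(2) sc pc]] fc sc pc by blast
    qed
    then have "f \<boxminus> s = \<zero>\<^bsub>S\<^esub>" by (rule K_sep)
    then show ?thesis using fc sc sY by simp
  qed
  then have "Idl\<^bsub>S\<^esub> Y = P" using YP by blast
  then show ?thesis using Y by blast
qed

lemma dvr_quotient_completion: "dvr_quotient S (K 1) P (\<iota> t)"
proof (intro dvr_quotient.intro dvr_quotient_axioms.intro)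
  show "local_ring S (K 1)" by unfold_locales
  show "\<iota> t \<notin> P" using t_pow_notin_P[of 1] t by simp
qed (fact P_prime P_K1 t_K K1_decomp factor_P P_finitely_generated)+

end

section \<open>The intersection with the quotient field\<close>

locale tight_basis = tight +
  fixes G
  assumes basis: "dvr_quotient_basis S (K 1) P (\<iota> t) G"
begin

sublocale B: dvr_quotient_basis S "K 1" P "\<iota> t" G by (rule basis)

abbreviation Q where "Q \<equiv> symbolic_power S P 2"

lemma \<iota>_notin_P: "b \<in> A \<Longrightarrow> b \<noteq> \<zero> \<Longrightarrow> \<iota> b \<notin> P"
  using \<iota>_in_P by blast

lemma Q_K1: "Q \<subseteq> K 1"
  using B.Q_P P_K1 by blast

text \<open>\<open>represents x s\<close> says that \<open>x\<close>, an element of the quotient field, equals the class of \<open>s\<close>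
  modulo \<open>Q\<close> inside the total quotient ring of the quotient of \<open>S\<close> by \<open>Q\<close>.  This relation is the
  graph of the embedding of \<open>R\<close> into that quotient.\<close>

definition represents :: "'a \<Rightarrow> 'c \<Rightarrow> bool"
  where "represents x s \<longleftrightarrow> x \<in> carrier F \<and> s \<in> carrier S \<and>
    (\<exists>b\<in>A. b \<noteq> \<zero> \<and> x \<otimes> b \<in> A \<and> \<iota> (x \<otimes> b) \<boxminus> \<iota> b \<boxtimes> s \<in> Q)"

text \<open>The relation does not depend on the denominator, since nonzero elements of \<open>A\<close> lie outside
  \<open>P\<close> and can be cancelled modulo \<open>Q\<close>.\<close>

lemma representsD:
  assumes "represents x s" and b: "b \<in> A" "b \<noteq> \<zero>" "x \<otimes> b \<in> A"
  shows "\<iota> (x \<otimes> b) \<boxminus> \<iota> b \<boxtimes> s \<in> Q"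
proof -
  obtain c where x: "x \<in> carrier F" "s \<in> carrier S" and c: "c \<in> A" "c \<noteq> \<zero>" "x \<otimes> c \<in> A"
    "\<iota> (x \<otimes> c) \<boxminus> \<iota> c \<boxtimes> s \<in> Q"
    using assms(1) unfolding represents_def by blast
  have "x \<otimes> b \<otimes> c = x \<otimes> c \<otimes> b" using x(1) A_carr[OF b(1)] A_carr[OF c(1)] by (simp add: F.m_ac)
  then have e: "\<iota> (x \<otimes> b) \<boxtimes> \<iota> c = \<iota> (x \<otimes> c) \<boxtimes> \<iota> b"
    using \<iota>_mult[OF b(3) c(1)] \<iota>_mult[OF c(3) b(1)] by simp
  note s = \<iota>_closed[OF b(1)] \<iota>_closed[OF c(1)] \<iota>_closed[OF b(3)] \<iota>_closed[OF c(3)] x(2)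
  have "\<iota> c \<boxtimes> (\<iota> (x \<otimes> b) \<boxminus> \<iota> b \<boxtimes> s) =
      \<iota> (x \<otimes> b) \<boxtimes> \<iota> c \<boxminus> \<iota> b \<boxtimes> (\<iota> c \<boxtimes> s)" using s by algebra
  also have "\<dots> = \<iota> b \<boxtimes> (\<iota> (x \<otimes> c) \<boxminus> \<iota> c \<boxtimes> s)" unfolding e using s by algebra
  finally have "\<iota> c \<boxtimes> (\<iota> (x \<otimes> b) \<boxminus> \<iota> b \<boxtimes> s) \<in> Q"
    using B.Q.I_l_closed[OF c(4) s(1)] by (simp only:)
  then show ?thesis
    by (rule B.Q_cancel[OF s(2) \<iota>_notin_P[OF c(1,2)], rotated]) (use s in simp)
qed

lemma represents_carr: "represents x s \<Longrightarrow> x \<in> carrier F" "represents x s \<Longrightarrow> s \<in> carrier S"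
  unfolding represents_def by auto

lemma represents_A: assumes "a \<in> A" shows "represents a (\<iota> a)"
  unfolding represents_def using assms A_carr A_ring \<iota>_closed[OF assms]
  by (auto intro!: bexI[of _ \<one>] simp: \<iota>_one)

lemma represents_unique:
  assumes "represents x s" "represents x s'"
  shows "s \<boxminus> s' \<in> Q"
proof -
  obtain b where b: "b \<in> A" "b \<noteq> \<zero>" "x \<otimes> b \<in> A" using assms(1) unfolding represents_def by blast
  have s: "s \<in> carrier S" "s' \<in> carrier S" using represents_carr assms by auto
  have "\<iota> b \<boxtimes> (s \<boxminus> s') =
      (\<iota> (x \<otimes> b) \<boxminus> \<iota> b \<boxtimes> s') \<boxminus> (\<iota> (x \<otimes> b) \<boxminus> \<iota> b \<boxtimes> s)"
    using s \<iota>_closed[OF b(1)] \<iota>_closed[OF b(3)] by algebra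
  then have "\<iota> b \<boxtimes> (s \<boxminus> s') \<in> Q"
    using B.Q.I_minus_closed[OF representsD[OF assms(2) b] representsD[OF assms(1) b]] by (simp only:)
  then show ?thesis
    by (rule B.Q_cancel[OF \<iota>_closed[OF b(1)] \<iota>_notin_P[OF b(1,2)], rotated]) (use s in simp)
qed

lemma represents_add:
  assumes "represents x s" "represents y r"
  shows "represents (x \<oplus> y) (s \<boxplus> r)"
proof -
  obtain b where b: "b \<in> A" "b \<noteq> \<zero>" "x \<otimes> b \<in> A" "\<iota> (x \<otimes> b) \<boxminus> \<iota> b \<boxtimes> s \<in> Q"
    using assms(1) unfolding represents_def by blast
  obtain c where c: "c \<in> A" "c \<noteq> \<zero>" "y \<otimes> c \<in> A" "\<iota> (y \<otimes> c) \<boxminus> \<iota> c \<boxtimes> r \<in> Q"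
    using assms(2) unfolding represents_def by blast
  note f = represents_carr(1)[OF assms(1)] represents_carr(1)[OF assms(2)] A_carr[OF b(1)] A_carr[OF c(1)]
  note s = represents_carr(2)[OF assms(1)] represents_carr(2)[OF assms(2)]
    \<iota>_closed[OF b(1)] \<iota>_closed[OF c(1)] \<iota>_closed[OF b(3)] \<iota>_closed[OF c(3)]
  have e: "(x \<oplus> y) \<otimes> (b \<otimes> c) = (x \<otimes> b) \<otimes> c \<oplus> (y \<otimes> c) \<otimes> b" using f by algebra
  have A: "(x \<otimes> b) \<otimes> c \<in> A" "(y \<otimes> c) \<otimes> b \<in> A" "b \<otimes> c \<in> A" using b c A_ring by auto
  have "\<iota> ((x \<oplus> y) \<otimes> (b \<otimes> c)) = \<iota> (x \<otimes> b) \<boxtimes> \<iota> c \<boxplus> \<iota> (y \<otimes> c) \<boxtimes> \<iota> b"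
    unfolding e using \<iota>_add[OF A(1,2)] \<iota>_mult[OF b(3) c(1)] \<iota>_mult[OF c(3) b(1)] by simp
  then have "\<iota> ((x \<oplus> y) \<otimes> (b \<otimes> c)) \<boxminus> \<iota> (b \<otimes> c) \<boxtimes> (s \<boxplus> r) =
     \<iota> (x \<otimes> b) \<boxtimes> \<iota> c \<boxplus> \<iota> (y \<otimes> c) \<boxtimes> \<iota> b \<boxminus> (\<iota> b \<boxtimes> \<iota> c) \<boxtimes> (s \<boxplus> r)"
    using \<iota>_mult[OF b(1) c(1)] by simp
  also have "\<dots> = \<iota> c \<boxtimes> (\<iota> (x \<otimes> b) \<boxminus> \<iota> b \<boxtimes> s) \<boxplus> \<iota> b \<boxtimes> (\<iota> (y \<otimes> c) \<boxminus> \<iota> c \<boxtimes> r)"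
    using s by algebra
  finally have "\<iota> ((x \<oplus> y) \<otimes> (b \<otimes> c)) \<boxminus> \<iota> (b \<otimes> c) \<boxtimes> (s \<boxplus> r) \<in> Q"
    using B.Q.I_add_closed[OF B.Q.I_l_closed[OF b(4) s(4)] B.Q.I_l_closed[OF c(4) s(3)]] by (simp only:)
  moreover have "b \<otimes> c \<noteq> \<zero>" using b c f F.integral_iff by blast
  moreover have "(x \<oplus> y) \<otimes> (b \<otimes> c) \<in> A" unfolding e using A_ring(5)[OF A(1,2)] .
  ultimately show ?thesis unfolding represents_def using A(3) f(1,2) s(1,2) by blast
qed

lemma represents_mult:
  assumes "represents x s" "represents y r"
  shows "represents (x \<otimes> y) (s \<boxtimes> r)"
proof -
  obtain b where b: "b \<in> A" "b \<noteq> \<zero>" "x \<otimes> b \<in> A" "\<iota> (x \<otimes> b) \<boxminus> \<iota> b \<boxtimes> s \<in> Q"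
    using assms(1) unfolding represents_def by blast
  obtain c where c: "c \<in> A" "c \<noteq> \<zero>" "y \<otimes> c \<in> A" "\<iota> (y \<otimes> c) \<boxminus> \<iota> c \<boxtimes> r \<in> Q"
    using assms(2) unfolding represents_def by blast
  note f = represents_carr(1)[OF assms(1)] represents_carr(1)[OF assms(2)] A_carr[OF b(1)] A_carr[OF c(1)]
  note s = represents_carr(2)[OF assms(1)] represents_carr(2)[OF assms(2)]
    \<iota>_closed[OF b(1)] \<iota>_closed[OF c(1)] \<iota>_closed[OF b(3)] \<iota>_closed[OF c(3)]
  have e: "(x \<otimes> y) \<otimes> (b \<otimes> c) = (x \<otimes> b) \<otimes> (y \<otimes> c)" using f by (simp add: F.m_ac)
  have A: "(x \<otimes> b) \<otimes> (y \<otimes> c) \<in> A" "b \<otimes> c \<in> A" using b c A_ring by auto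
  have "\<iota> ((x \<otimes> y) \<otimes> (b \<otimes> c)) \<boxminus> \<iota> (b \<otimes> c) \<boxtimes> (s \<boxtimes> r) =
     \<iota> (x \<otimes> b) \<boxtimes> \<iota> (y \<otimes> c) \<boxminus> (\<iota> b \<boxtimes> \<iota> c) \<boxtimes> (s \<boxtimes> r)"
    unfolding e using \<iota>_mult[OF b(1) c(1)] \<iota>_mult[OF b(3) c(3)] by simp
  also have "\<dots> = \<iota> (y \<otimes> c) \<boxtimes> (\<iota> (x \<otimes> b) \<boxminus> \<iota> b \<boxtimes> s) \<boxplus>
      (\<iota> b \<boxtimes> s) \<boxtimes> (\<iota> (y \<otimes> c) \<boxminus> \<iota> c \<boxtimes> r)"
    using s by algebra
  finally have "\<iota> ((x \<otimes> y) \<otimes> (b \<otimes> c)) \<boxminus> \<iota> (b \<otimes> c) \<boxtimes> (s \<boxtimes> r) \<in> Q"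
    using B.Q.I_add_closed[OF B.Q.I_l_closed[OF b(4) s(6)] B.Q.I_l_closed[OF c(4) S.m_closed[OF s(3,1)]]] by (simp only:)
  moreover have "b \<otimes> c \<noteq> \<zero>" using b c f F.integral_iff by blast
  moreover have "(x \<otimes> y) \<otimes> (b \<otimes> c) \<in> A" unfolding e using A(1) .
  ultimately show ?thesis unfolding represents_def using A(2) f(1,2) s(1,2) by blast
qed

lemma represents_neg:
  assumes "represents x s" shows "represents (\<ominus> x) (\<ominus>\<^bsub>S\<^esub> s)"
proof -
  have "represents (\<ominus> \<one> \<otimes> x) (\<iota> (\<ominus> \<one>) \<boxtimes> s)"
    using represents_mult[OF represents_A assms] A_ring by simp
  then show ?thesis
    using represents_carr[OF assms] A_ring by (simp add: \<iota>_neg \<iota>_one F.l_minus S.l_minus)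
qed

lemma represents_cong:
  assumes x: "represents x s" and r: "r \<in> carrier S" "s \<boxminus> r \<in> Q"
  shows "represents x r"
proof -
  obtain b where b: "b \<in> A" "b \<noteq> \<zero>" "x \<otimes> b \<in> A" "\<iota> (x \<otimes> b) \<boxminus> \<iota> b \<boxtimes> s \<in> Q"
    using x unfolding represents_def by blast
  note c = represents_carr[OF x] \<iota>_closed[OF b(1)] \<iota>_closed[OF b(3)]
  have "\<iota> (x \<otimes> b) \<boxminus> \<iota> b \<boxtimes> r = (\<iota> (x \<otimes> b) \<boxminus> \<iota> b \<boxtimes> s) \<boxplus> \<iota> b \<boxtimes> (s \<boxminus> r)"
    using c(2-) r(1) by algebra
  then have "\<iota> (x \<otimes> b) \<boxminus> \<iota> b \<boxtimes> r \<in> Q"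
    using B.Q.I_add_closed[OF b(4) B.Q.I_l_closed[OF r(2) c(3)]] by (simp only:)
  then show ?thesis unfolding represents_def using b(1-3) c(1) r(1) by blast
qed

text \<open>Divisibility by an element of \<open>A\<close> can be tested in \<open>S\<close> modulo \<open>Q\<close>.\<close>

lemma represents_divide:
  assumes x: "represents x s" and c: "c \<in> A" "c \<noteq> \<zero>"
    and r: "r \<in> carrier S" "s \<boxminus> \<iota> c \<boxtimes> r \<in> Q"
  shows "represents (x \<otimes> inv c) r"
proof -
  have "represents x (\<iota> c \<boxtimes> r)" using represents_cong[OF x _ r(2)] c r by simp
  then obtain b where b: "b \<in> A" "b \<noteq> \<zero>" "x \<otimes> b \<in> A"
    "\<iota> (x \<otimes> b) \<boxminus> \<iota> b \<boxtimes> (\<iota> c \<boxtimes> r) \<in> Q"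
    unfolding represents_def by blast
  have xc: "x \<in> carrier F" using represents_carr x by blast
  have cU: "c \<in> Units F" using c A_carr F.field_Units by blast
  note f = A_carr[OF b(1)] A_carr[OF c(1)] F.Units_inv_closed[OF cU]
  have "(x \<otimes> inv c) \<otimes> (b \<otimes> c) = (x \<otimes> b) \<otimes> (inv c \<otimes> c)" using xc f by (simp add: F.m_ac)
  also have "\<dots> = x \<otimes> b" using cU xc f by simp
  finally have e: "(x \<otimes> inv c) \<otimes> (b \<otimes> c) = x \<otimes> b" .
  have "\<iota> (b \<otimes> c) \<boxtimes> r = \<iota> b \<boxtimes> (\<iota> c \<boxtimes> r)"
    using b c r by (simp add: \<iota>_mult S.m_assoc)
  then have "\<iota> ((x \<otimes> inv c) \<otimes> (b \<otimes> c)) \<boxminus> \<iota> (b \<otimes> c) \<boxtimes> r \<in> Q" using b(4) e by simp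
  moreover have "b \<otimes> c \<noteq> \<zero>" using b c f F.integral_iff by blast
  moreover have "b \<otimes> c \<in> A" using A_ring(4)[OF b(1) c(1)] .
  moreover have "(x \<otimes> inv c) \<otimes> (b \<otimes> c) \<in> A" using b(3) e by simp
  moreover have "x \<otimes> inv c \<in> carrier F" using xc f by simp
  ultimately show ?thesis unfolding represents_def using r(1) by blast
qed

lemma represents_inverse:
  assumes x: "represents x s" and s: "s \<notin> K 1"
  shows "x \<noteq> \<zero>" "represents (inv x) (inv\<^bsub>S\<^esub> s)"
proof -
  obtain b where b: "b \<in> A" "b \<noteq> \<zero>" "x \<otimes> b \<in> A" "\<iota> (x \<otimes> b) \<boxminus> \<iota> b \<boxtimes> s \<in> Q"
    using x unfolding represents_def by blast
  note c = represents_carr[OF x] \<iota>_closed[OF b(1)] \<iota>_closed[OF b(3)] A_carr[OF b(1)]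
  have sU: "s \<in> Units S" using Units_N c(2) s by blast
  let ?r = "inv\<^bsub>S\<^esub> s"
  have r: "?r \<in> carrier S" "s \<boxtimes> ?r = \<one>\<^bsub>S\<^esub>" using sU by auto
  show x0: "x \<noteq> \<zero>"
  proof
    assume "x = \<zero>"
    then have "represents \<zero> s" using x by simp
    moreover have "represents \<zero> \<zero>\<^bsub>S\<^esub>" using represents_A[OF A_ring(1)] by (simp add: \<iota>_zero)
    ultimately have "s \<boxminus> \<zero>\<^bsub>S\<^esub> \<in> Q" by (rule represents_unique)
    then show False using Q_K1 c(2) s by (auto simp: a_minus_def)
  qed
  then have xU: "x \<in> Units F" using c F.field_Units by blast
  have e: "inv x \<otimes> (x \<otimes> b) = b"
    using F.m_assoc[OF F.Units_inv_closed[OF xU] c(1,5)] F.Units_l_inv[OF xU] F.l_one[OF c(5)]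
    by (simp only:)
  have "\<iota> b \<boxminus> \<iota> (x \<otimes> b) \<boxtimes> ?r = \<iota> b \<boxtimes> (s \<boxtimes> ?r) \<boxminus> \<iota> (x \<otimes> b) \<boxtimes> ?r"
    unfolding r(2) using c by simp
  also have "\<dots> = \<ominus>\<^bsub>S\<^esub> (?r \<boxtimes> (\<iota> (x \<otimes> b) \<boxminus> \<iota> b \<boxtimes> s))"
    using c(2-4) r(1) by algebra
  finally have "\<iota> b \<boxminus> \<iota> (x \<otimes> b) \<boxtimes> ?r \<in> Q"
    using B.Q.I_neg_closed[OF B.Q.I_l_closed[OF b(4) r(1)]] by (simp only:)
  moreover have "x \<otimes> b \<noteq> \<zero>" using b c x0 F.integral_iff by blast
  ultimately show "represents (inv x) ?r"
    unfolding represents_def using b(1,3) e xU r(1) by (intro conjI bexI[of _ "x \<otimes> b"]) auto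
qed

definition R_set :: "'a set"
  where "R_set = {x. \<exists>s. represents x s}"

abbreviation RR where "RR \<equiv> F\<lparr>carrier := R_set\<rparr>"

lemma R_set_iff:
  "R_set = {a \<otimes> inv b | a b. a \<in> A \<and> b \<in> A - {\<zero>} \<and> \<iota> a \<in> PIdl\<^bsub>S\<^esub> (\<iota> b) <+>\<^bsub>S\<^esub> Q}" (is "_ = ?R")
proof
  show "R_set \<subseteq> ?R"
  proof
    fix x assume "x \<in> R_set"
    then obtain s b where x: "x \<in> carrier F" "s \<in> carrier S"
      and b: "b \<in> A" "b \<noteq> \<zero>" "x \<otimes> b \<in> A" "\<iota> (x \<otimes> b) \<boxminus> \<iota> b \<boxtimes> s \<in> Q"
      unfolding R_set_def represents_def by blast
    have bU: "b \<in> Units F" using b A_carr F.field_Units by blast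
    have "x = x \<otimes> b \<otimes> inv b" using bU x b A_carr by (simp add: F.m_assoc)
    moreover have "\<iota> (x \<otimes> b) = s \<boxtimes> \<iota> b \<boxplus> (\<iota> (x \<otimes> b) \<boxminus> \<iota> b \<boxtimes> s)"
      using \<iota>_closed[OF b(1)] \<iota>_closed[OF b(3)] x(2) by algebra
    moreover have "s \<boxtimes> \<iota> b \<in> PIdl\<^bsub>S\<^esub> (\<iota> b)" using x unfolding cgenideal_def by blast
    ultimately have "\<iota> (x \<otimes> b) \<in> PIdl\<^bsub>S\<^esub> (\<iota> b) <+>\<^bsub>S\<^esub> Q"
      using b(4) set_add_closedI[where R = S] by metis
    with \<open>x = x \<otimes> b \<otimes> inv b\<close> b show "x \<in> ?R" by blast
  qed
  show "?R \<subseteq> R_set"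
  proof
    fix x assume "x \<in> ?R"
    then obtain a b where ab: "x = a \<otimes> inv b" "a \<in> A" "b \<in> A" "b \<noteq> \<zero>"
      "\<iota> a \<in> PIdl\<^bsub>S\<^esub> (\<iota> b) <+>\<^bsub>S\<^esub> Q" by blast
    then obtain s q where s: "s \<in> carrier S" "q \<in> Q" "\<iota> a = s \<boxtimes> \<iota> b \<boxplus> q"
      unfolding set_add_def' cgenideal_def by auto
    have "\<iota> a \<boxminus> \<iota> b \<boxtimes> s = q"
      unfolding s(3) using s(1) \<iota>_closed[OF ab(3)] B.Q.Icarr[OF s(2)] by algebra
    then have "represents x s"
      unfolding ab(1) using represents_divide[OF represents_A[OF ab(2)] ab(3,4) s(1)] s(2) by simp
    then show "x \<in> R_set" unfolding R_set_def by blast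
  qed
qed

lemma R_subring: "subring R_set F"
proof (rule F.subringI)
  show "R_set \<subseteq> carrier F" unfolding R_set_def using represents_carr by blast
  show "\<one> \<in> R_set" unfolding R_set_def using represents_A A_ring by blast
  show "\<ominus> x \<in> R_set" if "x \<in> R_set" for x
    using that represents_neg unfolding R_set_def by blast
  show "x \<otimes> y \<in> R_set" "x \<oplus> y \<in> R_set" if "x \<in> R_set" "y \<in> R_set" for x y
    using that represents_mult represents_add unfolding R_set_def by blast+
qed

lemma R_cring: "cring RR"
  using F.subring_is_domain[OF R_subring] domain.axioms(1) by blast

definition contraction :: "'c set \<Rightarrow> 'a set"
  where "contraction J = {x. \<exists>s\<in>J. represents x s}"

lemma RR_neg: assumes "x \<in> R_set" shows "\<ominus>\<^bsub>RR\<^esub> x = \<ominus> x"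
proof -
  interpret R: cring RR by (rule R_cring)
  have xc: "x \<in> carrier F" using assms subringE(1)[OF R_subring] by blast
  show ?thesis using R.minus_equality[of "\<ominus> x" x] assms xc subringE(5)[OF R_subring]
    by (simp add: F.l_neg)
qed

lemma contraction_ideal:
  assumes J: "ideal J S"
  shows "ideal (contraction J) RR"
proof (rule idealI)
  interpret J: ideal J S by (rule J)
  interpret R: cring RR by (rule R_cring)
  show "ring RR" by (rule R.ring_axioms)
  have sub: "contraction J \<subseteq> R_set" unfolding contraction_def R_set_def by blast
  show "subgroup (contraction J) (add_monoid RR)"
  proof (rule R.add.subgroupI)
    show "contraction J \<subseteq> carrier RR" using sub by simp
    have "represents \<zero> \<zero>\<^bsub>S\<^esub>" using represents_A[OF A_ring(1)] by (simp add: \<iota>_zero)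
    then show "contraction J \<noteq> {}" unfolding contraction_def using J.zero_closed by blast
    fix x assume x: "x \<in> contraction J"
    then obtain s where s: "s \<in> J" "represents x s" unfolding contraction_def by blast
    have "\<ominus> x \<in> contraction J"
      unfolding contraction_def using represents_neg[OF s(2)] J.I_neg_closed[OF s(1)] by blast
    then show "\<ominus>\<^bsub>RR\<^esub> x \<in> contraction J" using RR_neg x sub by auto
    fix y assume "y \<in> contraction J"
    then obtain r where r: "r \<in> J" "represents y r" unfolding contraction_def by blast
    have "x \<oplus> y \<in> contraction J"
      unfolding contraction_def using represents_add[OF s(2) r(2)] J.I_add_closed[OF s(1) r(1)] by blast
    then show "x \<oplus>\<^bsub>RR\<^esub> y \<in> contraction J" by simp
  qed
  fix x a assume x: "x \<in> contraction J" and a: "a \<in> carrier RR"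
  obtain s where s: "s \<in> J" "represents x s" using x unfolding contraction_def by blast
  obtain r where r: "represents a r" using a unfolding R_set_def by auto
  have "a \<otimes> x \<in> contraction J"
    unfolding contraction_def
    using represents_mult[OF r s(2)] J.I_l_closed[OF s(1) represents_carr(2)[OF r]] by blast
  then show *: "a \<otimes>\<^bsub>RR\<^esub> x \<in> contraction J" by simp
  show "x \<otimes>\<^bsub>RR\<^esub> a \<in> contraction J" using * R.m_comm[of a x] a x sub by auto
qed

lemma contraction_iff:
  assumes J: "ideal J S" "Q \<subseteq> J" and x: "represents x s"
  shows "x \<in> contraction J \<longleftrightarrow> s \<in> J"
proof
  interpret J: ideal J S by (rule J)
  assume "x \<in> contraction J"
  then obtain r where r: "r \<in> J" "represents x r" unfolding contraction_def by blast
  have "s \<boxminus> r \<in> J" using represents_unique[OF x r(2)] J by blast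
  then show "s \<in> J" using J.diff_mem_iff represents_carr(2)[OF x] represents_carr(2)[OF r(2)] r(1) by blast
qed (use x in \<open>auto simp: contraction_def\<close>)

lemma local_ring_R: "local_ring RR (contraction (K 1))"
proof (intro local_ring.intro local_ring_axioms.intro R_cring)
  note mem = contraction_iff[OF K_ideal Q_K1]
  show "ideal (contraction (K 1)) RR" by (rule contraction_ideal[OF K_ideal])
  have "represents \<one> \<one>\<^bsub>S\<^esub>" using represents_A[OF A_ring(2)] by (simp add: \<iota>_one)
  then have "\<one> \<notin> contraction (K 1)" using mem K1_not_one by blast
  then show "\<one>\<^bsub>RR\<^esub> \<notin> contraction (K 1)" by simp
  fix x assume "x \<in> carrier RR" "x \<notin> contraction (K 1)"
  then obtain s where s: "represents x s" "s \<notin> K 1" using mem unfolding R_set_def by auto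
  have x: "x \<in> R_set" "inv x \<in> R_set" using s(1) represents_inverse(2)[OF s] unfolding R_set_def by auto
  have "x \<in> Units F" using represents_inverse(1)[OF s] represents_carr[OF s(1)] F.field_Units by blast
  then have "inv x \<otimes> x = \<one>" "x \<otimes> inv x = \<one>" by auto
  then show "x \<in> Units RR" unfolding Units_def using x by (simp, blast)
qed

end

context tight_basis
begin

lemma tS: "\<iota> t \<in> carrier S" using t by simp

lemma K_Suc_prod: "K (Suc n) \<subseteq> K 1 \<cdot>\<^bsub>S\<^esub> K n"
proof
  fix f assume "f \<in> K (Suc n)"
  then have "f \<in> (Idl\<^bsub>S\<^esub> (\<iota> ` X)) \<cdot>\<^bsub>S\<^esub> K n" by (rule K_Suc_generated)
  then show "f \<in> K 1 \<cdot>\<^bsub>S\<^esub> K n"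
  proof (induction rule: ideal_prod.induct)
    case (prod i j)
    have "\<iota> ` X \<subseteq> K 1" using X_pw \<iota>_K_A X_A by blast
    then have "Idl\<^bsub>S\<^esub> (\<iota> ` X) \<subseteq> K 1" by (rule S.genideal_minimal[OF K_ideal])
    then show ?case using prod by (intro ideal_prod.prod) auto
  qed (rule ideal_prod.sum)
qed

definition t2Q :: "'c set"
  where "t2Q = B.H {\<iota> t \<boxtimes> \<iota> t}"

lemma t2Q_ideal: "ideal t2Q S" and t2_t2Q: "\<iota> t \<boxtimes> \<iota> t \<in> t2Q" and Q_t2Q: "Q \<subseteq> t2Q"
  using B.H_ideal[of "{\<iota> t \<boxtimes> \<iota> t}"] B.H_self[of "{\<iota> t \<boxtimes> \<iota> t}"] tS
  unfolding t2Q_def by auto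

sublocale t2Q: ideal t2Q S by (rule t2Q_ideal)

lemma t2Q_least: "ideal J S \<Longrightarrow> \<iota> t \<boxtimes> \<iota> t \<in> J \<Longrightarrow> Q \<subseteq> J \<Longrightarrow> t2Q \<subseteq> J"
  unfolding t2Q_def by (intro B.H_least) auto

lemma t2Q_decomp:
  assumes "x \<in> t2Q"
  shows "\<exists>c\<in>carrier S. x \<boxminus> (\<iota> t \<boxtimes> \<iota> t) \<boxtimes> c \<in> Q"
proof -
  obtain c z where c: "c \<in> carrier S" "z \<in> B.H {}" "x = c \<boxtimes> (\<iota> t \<boxtimes> \<iota> t) \<boxplus> z"
    using B.H_insert[of "\<iota> t \<boxtimes> \<iota> t" "{}" x] assms tS unfolding t2Q_def by auto
  have z: "z \<in> Q" using B.H_least[OF B.Q_ideal, of "{}"] c(2) by auto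
  have "x \<boxminus> (\<iota> t \<boxtimes> \<iota> t) \<boxtimes> c = z"
    unfolding c(3) using c(1) B.Q.Icarr[OF z] tS by algebra
  then show ?thesis using c(1) z by auto
qed

lemma K1_split:
  assumes "f \<in> K 1"
  obtains g p where "g \<in> carrier S" "p \<in> P" "f = \<iota> t \<boxtimes> g \<boxplus> p"
proof -
  obtain g where g: "g \<in> carrier S" "f \<boxminus> \<iota> t \<boxtimes> g \<in> P" using K1_decomp assms by blast
  moreover have "f = \<iota> t \<boxtimes> g \<boxplus> (f \<boxminus> \<iota> t \<boxtimes> g)"
    using K_carr[OF assms] g(1) tS by algebra
  ultimately show ?thesis using that by blast
qed

text \<open>A product of three elements \<open>t g + p\<close> of the maximal ideal is a multiple of \<open>t\<^sup>2\<close>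
  modulo \<open>Q\<close>, since every term with two factors from \<open>P\<close> lies in \<open>Q\<close>.\<close>

lemma triple_product:
  assumes "i \<in> K 1" "j \<in> K 1" "k \<in> K 1"
  shows "i \<boxtimes> (j \<boxtimes> k) \<in> t2Q"
proof -
  obtain g p where i: "g \<in> carrier S" "p \<in> P" "i = \<iota> t \<boxtimes> g \<boxplus> p" using K1_split assms(1) .
  obtain g' p' where j: "g' \<in> carrier S" "p' \<in> P" "j = \<iota> t \<boxtimes> g' \<boxplus> p'" using K1_split assms(2) .
  obtain h r where k: "h \<in> carrier S" "r \<in> P" "k = \<iota> t \<boxtimes> h \<boxplus> r" using K1_split assms(3) .
  note c = tS i(1) j(1) k(1) P_carr[OF i(2)] P_carr[OF j(2)] P_carr[OF k(2)]
  have q: "p \<boxtimes> p' \<in> t2Q" "p \<boxtimes> r \<in> t2Q" "p' \<boxtimes> r \<in> t2Q"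
    using B.P_mult_Q i(2) j(2) k(2) Q_t2Q by auto
  let ?y = "g' \<boxtimes> r \<boxplus> h \<boxtimes> p'"
  have y: "?y \<in> carrier S" using c by simp
  have ic: "i \<in> carrier S" using K_carr assms(1) .
  have "p \<boxtimes> ?y = g' \<boxtimes> (p \<boxtimes> r) \<boxplus> h \<boxtimes> (p \<boxtimes> p')" using c(3-) by algebra
  then have py: "p \<boxtimes> ?y \<in> t2Q"
    using t2Q.I_add_closed[OF t2Q.I_l_closed[OF q(2) j(1)] t2Q.I_l_closed[OF q(1) k(1)]] by (simp only:)
  have "i \<boxtimes> (\<iota> t \<boxtimes> ?y) \<in> t2Q"
  proof -
    have "(\<iota> t \<boxtimes> g \<boxplus> p) \<boxtimes> (\<iota> t \<boxtimes> x) =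
        (g \<boxtimes> x) \<boxtimes> (\<iota> t \<boxtimes> \<iota> t) \<boxplus> \<iota> t \<boxtimes> (p \<boxtimes> x)" if "x \<in> carrier S" for x
      using that c(1,2,5) by algebra
    then have "i \<boxtimes> (\<iota> t \<boxtimes> ?y) =
        (g \<boxtimes> ?y) \<boxtimes> (\<iota> t \<boxtimes> \<iota> t) \<boxplus> \<iota> t \<boxtimes> (p \<boxtimes> ?y)"
      unfolding i(3) using y by blast
    then show ?thesis
      using t2Q.I_add_closed[OF t2Q.I_l_closed[OF t2_t2Q S.m_closed[OF i(1) y]] t2Q.I_l_closed[OF py tS]]
      by (simp only:)
  qed
  moreover have "i \<boxtimes> ((g' \<boxtimes> h) \<boxtimes> (\<iota> t \<boxtimes> \<iota> t)) \<in> t2Q"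
    using t2Q.I_l_closed[OF t2Q.I_l_closed[OF t2_t2Q S.m_closed[OF j(1) k(1)]] ic] .
  moreover have "i \<boxtimes> (p' \<boxtimes> r) \<in> t2Q" using t2Q.I_l_closed[OF q(3) ic] .
  moreover have jk: "j \<boxtimes> k = (g' \<boxtimes> h) \<boxtimes> (\<iota> t \<boxtimes> \<iota> t) \<boxplus> (\<iota> t \<boxtimes> ?y \<boxplus> p' \<boxtimes> r)"
    unfolding j(3) k(3) using c(1,3,4,6,7) by algebra
  have "i \<boxtimes> (j \<boxtimes> k) = i \<boxtimes> ((g' \<boxtimes> h) \<boxtimes> (\<iota> t \<boxtimes> \<iota> t)) \<boxplus>
      (i \<boxtimes> (\<iota> t \<boxtimes> ?y) \<boxplus> i \<boxtimes> (p' \<boxtimes> r))"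
  proof -
    have "a \<in> carrier S \<Longrightarrow> b \<in> carrier S \<Longrightarrow> d \<in> carrier S \<Longrightarrow>
      i \<boxtimes> (a \<boxplus> (b \<boxplus> d)) = i \<boxtimes> a \<boxplus> (i \<boxtimes> b \<boxplus> i \<boxtimes> d)" for a b d
      using ic by (simp add: S.r_distr)
    from this[of "(g' \<boxtimes> h) \<boxtimes> (\<iota> t \<boxtimes> \<iota> t)" "\<iota> t \<boxtimes> ?y" "p' \<boxtimes> r"]
    show ?thesis unfolding jk using c S.m_closed[OF tS y] by simp
  qed
  ultimately show ?thesis by (simp only: t2Q.I_add_closed)
qed

lemma K3_t2Q: "K (Suc (Suc 1)) \<subseteq> t2Q"
proof
  fix f assume "f \<in> K (Suc (Suc 1))"
  then have "f \<in> K 1 \<cdot>\<^bsub>S\<^esub> K (Suc 1)" using K_Suc_prod by blast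
  then show "f \<in> t2Q"
  proof (induction rule: ideal_prod.induct)
    case (prod i y)
    have "y \<in> K 1 \<cdot>\<^bsub>S\<^esub> K 1" using prod(2) K_Suc_prod by blast
    then show ?case
    proof (induction rule: ideal_prod.induct)
      case (prod j k)
      then show ?case using triple_product \<open>i \<in> K 1\<close> by blast
    next
      case (sum y1 y2)
      have c: "i \<in> carrier S" "y1 \<in> carrier S" "y2 \<in> carrier S"
        using K_carr[OF \<open>i \<in> K 1\<close>] sum.hyps S.ideal_prod_in_carrier[OF K_ideal[of 1] K_ideal[of 1]] by auto
      then show ?case using t2Q.I_add_closed[OF sum.IH] by (simp add: S.r_distr)
    qed
  qed (rule t2Q.I_add_closed)
qed

text \<open>So \<open>A\<close> maps onto the quotient of \<open>S\<close> by \<open>t\<^sup>2 S + Q\<close>, and an element of \<open>R\<close> that vanishes there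
  is \<open>t\<^sup>2\<close> times an element of \<open>R\<close>.  Therefore \<open>R\<close> and \<open>S / Q\<close> agree modulo \<open>t\<^sup>2\<close>.\<close>

lemma approx_t2Q: "s \<in> carrier S \<Longrightarrow> \<exists>a\<in>A. s \<boxminus> \<iota> a \<in> t2Q"
  using dense_A[of s "Suc (Suc 1)"] K3_t2Q by blast

lemma t2Q_K1: "t2Q \<subseteq> K 1"
  using t2Q_least[OF K_ideal[of 1] _ Q_K1] K.I_l_closed[OF t_K tS] by blast

abbreviation N where "N \<equiv> contraction (K 1)"

sublocale R: local_ring RR N by (rule local_ring_R)

lemma N_prod_subset:
  assumes J: "ideal J S" and prod: "\<And>i j. i \<in> K 1 \<Longrightarrow> j \<in> K 1 \<Longrightarrow> i \<boxtimes> j \<in> J"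
  shows "N \<cdot>\<^bsub>RR\<^esub> N \<subseteq> contraction J"
proof
  interpret C: ideal "contraction J" RR by (rule contraction_ideal[OF J])
  fix x assume "x \<in> N \<cdot>\<^bsub>RR\<^esub> N"
  then show "x \<in> contraction J"
  proof (induction rule: ideal_prod.induct)
    case (prod i j)
    then obtain s r where s: "s \<in> K 1" "represents i s" "r \<in> K 1" "represents j r"
      unfolding contraction_def by blast
    have "i \<otimes> j \<in> contraction J"
      unfolding contraction_def using represents_mult[OF s(2,4)] assms(2)[OF s(1,3)] by blast
    then show ?case by simp
  qed (rule C.I_add_closed)
qed

lemma contraction_self: "a \<in> A \<Longrightarrow> \<iota> a \<in> J \<Longrightarrow> a \<in> contraction J"
  unfolding contraction_def using represents_A by blast

text \<open>The cotangent space of \<open>S / Q\<close> has the basis consisting of \<open>t\<close> and \<open>G\<close>, and only the ring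
  modulo \<open>t\<^sup>2\<close> matters for it.  So \<open>G\<close> is approximated modulo \<open>t\<^sup>2 S + Q\<close> by elements \<open>\<alpha> g\<close> of \<open>A\<close>.  With \<open>t\<close>
  they generate the maximal ideal \<open>N\<close> of \<open>R\<close> outright: what they miss is a multiple of \<open>t\<^sup>2\<close>.  For their
  independence, \<open>N\<^sup>2\<close> and all but one of them are contained in the contraction of an ideal of \<open>S\<close>
  that does not contain the remaining one.\<close>

lemma embedding_dimension_R: "has_embedding_dimension RR (card G + 1)"
proof -
  have "\<forall>g\<in>G. \<exists>a\<in>A. g \<boxminus> \<iota> a \<in> t2Q" using approx_t2Q B.G_carr by blast
  then obtain \<alpha> where \<alpha>: "\<And>g. g \<in> G \<Longrightarrow> \<alpha> g \<in> A" "\<And>g. g \<in> G \<Longrightarrow> g \<boxminus> \<iota> (\<alpha> g) \<in> t2Q"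
    by metis
  let ?G = "insert t (\<alpha> ` G)"
  have GA: "?G \<subseteq> A" using \<alpha>(1) t by auto
  have AR: "A \<subseteq> R_set" unfolding R_set_def using represents_A by blast
  have Gc: "?G \<subseteq> carrier RR" using GA AR by auto
  have \<alpha>_iff: "g \<in> J \<longleftrightarrow> \<iota> (\<alpha> g) \<in> J" if "ideal J S" "t2Q \<subseteq> J" "g \<in> G" for g J
    using ideal.diff_mem_iff[OF that(1), of g "\<iota> (\<alpha> g)"] \<alpha>[OF that(3)] that B.G_carr \<iota>_closed by blast
  have GP: "g \<in> P" "g \<in> K 1" if "g \<in> G" for g using that B.G(1) P_K1 by auto
  have GN: "?G \<subseteq> N"
    using contraction_self[OF t(1) t_K] contraction_self[of "\<alpha> g" "K 1" for g] \<alpha>(1)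
      \<alpha>_iff[OF K_ideal t2Q_K1] GP by blast
  let ?C = "Idl\<^bsub>RR\<^esub> ?G"
  interpret C: ideal ?C RR using R.genideal_ideal[OF Gc] .
  have C_carr: "r \<in> R_set" if "r \<in> ?C" for r using C.Icarr[OF that] by simp
  \<comment> \<open>an ideal of \<open>S\<close> and not only of \<open>A\<close>, because multipliers from \<open>S\<close> can be approximated\<close>
  let ?J = "{s \<in> carrier S. \<exists>r\<in>?C. \<exists>s'. represents r s' \<and> s \<boxminus> s' \<in> t2Q}"
  have J: "ideal ?J S"
  proof (rule idealI)
    show "ring S" by (rule S.ring_axioms)
    show "subgroup ?J (add_monoid S)"
    proof (rule S.add.subgroupI)
      show "?J \<subseteq> carrier S" by blast
      have "\<zero>\<^bsub>RR\<^esub> \<in> ?C" by (rule C.zero_closed)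
      then have "\<zero> \<in> ?C" by simp
      moreover have "represents \<zero> \<zero>\<^bsub>S\<^esub>" using represents_A[OF A_ring(1)] by (simp add: \<iota>_zero)
      moreover have "\<zero>\<^bsub>S\<^esub> \<boxminus> \<zero>\<^bsub>S\<^esub> \<in> t2Q" by simp
      ultimately have "\<zero>\<^bsub>S\<^esub> \<in> ?J" by blast
      then show "?J \<noteq> {}" by blast
      fix s assume "s \<in> ?J"
      then obtain r s' where s: "s \<in> carrier S" "r \<in> ?C" "represents r s'" "s \<boxminus> s' \<in> t2Q" by blast
      note s'c = represents_carr(2)[OF s(3)]
      have "\<ominus>\<^bsub>S\<^esub> s \<boxminus> \<ominus>\<^bsub>S\<^esub> s' = \<ominus>\<^bsub>S\<^esub> (s \<boxminus> s')" using s(1) s'c by algebra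
      then have "\<ominus>\<^bsub>S\<^esub> s \<boxminus> \<ominus>\<^bsub>S\<^esub> s' \<in> t2Q" using t2Q.I_neg_closed[OF s(4)] by (simp only:)
      moreover have "\<ominus> r \<in> ?C" using C.I_neg_closed[OF s(2)] RR_neg[OF C_carr[OF s(2)]] by (simp only:)
      ultimately show "\<ominus>\<^bsub>S\<^esub> s \<in> ?J" using represents_neg[OF s(3)] s(1) by blast
      fix z assume "z \<in> ?J"
      then obtain y z' where z: "z \<in> carrier S" "y \<in> ?C" "represents y z'" "z \<boxminus> z' \<in> t2Q" by blast
      note z'c = represents_carr(2)[OF z(3)]
      have "(s \<boxplus> z) \<boxminus> (s' \<boxplus> z') \<in> t2Q" using t2Q.diff_add[OF s(4) z(4) s(1) s'c z(1) z'c] .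
      moreover have "r \<oplus> y \<in> ?C" using C.I_add_closed[OF s(2) z(2)] by simp
      ultimately show "s \<boxplus> z \<in> ?J" using represents_add[OF s(3) z(3)] s(1) z(1) by blast
    qed
    fix s x assume "s \<in> ?J" and x: "x \<in> carrier S"
    then obtain r s' where s: "s \<in> carrier S" "r \<in> ?C" "represents r s'" "s \<boxminus> s' \<in> t2Q" by blast
    note s'c = represents_carr(2)[OF s(3)]
    obtain a where a: "a \<in> A" "x \<boxminus> \<iota> a \<in> t2Q" using approx_t2Q x by blast
    have "x \<boxtimes> s \<boxminus> \<iota> a \<boxtimes> s' = x \<boxtimes> (s \<boxminus> s') \<boxplus> s' \<boxtimes> (x \<boxminus> \<iota> a)"
      using s(1) s'c x \<iota>_closed[OF a(1)] by algebra
    then have "x \<boxtimes> s \<boxminus> \<iota> a \<boxtimes> s' \<in> t2Q"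
      using t2Q.I_add_closed[OF t2Q.I_l_closed[OF s(4) x] t2Q.I_l_closed[OF a(2) s'c]] by (simp only:)
    moreover have "a \<otimes> r \<in> ?C" using C.I_l_closed[OF s(2), of a] a(1) AR by auto
    ultimately show *: "x \<boxtimes> s \<in> ?J"
      using represents_mult[OF represents_A[OF a(1)] s(3)] s(1) x by blast
    show "s \<boxtimes> x \<in> ?J" using * S.m_comm[OF x s(1)] by (simp only:)
  qed
  have t2J: "t2Q \<subseteq> ?J"
  proof
    fix q assume q: "q \<in> t2Q"
    have "\<zero>\<^bsub>RR\<^esub> \<in> ?C" by (rule C.zero_closed)
    then have "\<zero> \<in> ?C" by simp
    moreover have "represents \<zero> \<zero>\<^bsub>S\<^esub>" using represents_A[OF A_ring(1)] by (simp add: \<iota>_zero)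
    moreover have "q \<boxminus> \<zero>\<^bsub>S\<^esub> \<in> t2Q" using q by (simp add: a_minus_def)
    ultimately show "q \<in> ?J" using t2Q.Icarr[OF q] by blast
  qed
  have GJ: "\<iota> a \<in> ?J" if "a \<in> ?G" for a
  proof -
    have "a \<in> ?C" using R.genideal_self[OF Gc] that by blast
    moreover have "a \<in> A" using GA that by blast
    moreover have "\<iota> a \<boxminus> \<iota> a \<in> t2Q" using \<iota>_closed[OF \<open>a \<in> A\<close>] by simp
    ultimately show ?thesis using represents_A[OF \<open>a \<in> A\<close>] \<iota>_closed by blast
  qed
  have GJ': "G \<subseteq> ?J"
  proof
    fix g assume g: "g \<in> G"
    have "\<iota> (\<alpha> g) \<in> ?J" by (rule GJ) (use g in blast)
    then show "g \<in> ?J" by (rule \<alpha>_iff[OF J t2J g, THEN iffD2])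
  qed
  have PJ: "P \<subseteq> ?J"
    using B.H_least[OF J GJ' subset_trans[OF Q_t2Q t2J]] unfolding B.G(3) .
  have K1J: "K 1 \<subseteq> ?J"
  proof
    fix f assume "f \<in> K 1"
    then obtain g p where f: "g \<in> carrier S" "p \<in> P" "f = \<iota> t \<boxtimes> g \<boxplus> p" by (rule K1_split)
    have "\<iota> t \<boxtimes> g \<in> ?J" by (rule ideal.I_r_closed[OF J _ f(1)]) (rule GJ, blast)
    moreover have "p \<in> ?J" using PJ f(2) by blast
    ultimately show "f \<in> ?J" unfolding f(3) by (rule ideal.I_add_closed[OF J])
  qed
  have tC: "t \<in> ?C" using R.genideal_self[OF Gc] by blast
  have tR: "t \<in> R_set" using t AR by blast
  have NC: "N \<subseteq> ?C"
  proof
    fix x assume "x \<in> N"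
    then obtain s where s: "s \<in> K 1" "represents x s" unfolding contraction_def by blast
    then obtain r s' where r: "r \<in> ?C" "represents r s'" "s \<boxminus> s' \<in> t2Q" using K1J by blast
    obtain c where c: "c \<in> carrier S" "(s \<boxminus> s') \<boxminus> (\<iota> t \<boxtimes> \<iota> t) \<boxtimes> c \<in> Q"
      using t2Q_decomp[OF r(3)] by blast
    have xr: "represents (x \<ominus> r) (s \<boxminus> s')"
      unfolding a_minus_def by (rule represents_add[OF s(2) represents_neg[OF r(2)]])
    have tt: "t \<otimes> t \<in> A" "t \<otimes> t \<noteq> \<zero>" using t t_carr A_ring F.integral_iff by auto
    let ?y = "(x \<ominus> r) \<otimes> inv (t \<otimes> t)"
    have "represents ?y c"
      using represents_divide[OF xr tt c(1)] c(2) \<iota>_mult[OF t(1) t(1)] by simp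
    then have yR: "?y \<in> R_set" unfolding R_set_def by blast
    have U: "t \<otimes> t \<in> Units F" using tt A_carr F.field_Units by blast
    have f: "x \<in> carrier F" "r \<in> carrier F" using represents_carr(1) s(2) r(2) by auto
    have "?y \<otimes> t \<in> R_set" using subringE(6)[OF R_subring yR tR] .
    then have "?y \<otimes> t \<otimes> t \<in> ?C" using C.I_l_closed[OF tC, of "?y \<otimes> t"] by simp
    moreover have "?y \<otimes> t \<otimes> t = (x \<ominus> r) \<otimes> (inv (t \<otimes> t) \<otimes> (t \<otimes> t))"
      using f t_carr F.Units_inv_closed[OF U] by (simp add: F.m_assoc)
    then have "?y \<otimes> t \<otimes> t = x \<ominus> r" using U f by simp
    ultimately have "(x \<ominus> r) \<oplus> r \<in> ?C" using C.I_add_closed[OF _ r(1)] by simp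
    moreover have "(x \<ominus> r) \<oplus> r = x" using f by algebra
    ultimately show "x \<in> ?C" by simp
  qed
  have gen: "?C = N"
    using R.genideal_minimal[OF R.N GN] NC by (rule equalityI)
  \<comment> \<open>the ideal \<open>P + t\<^sup>2 S\<close> separates \<open>t\<close> from the other generators\<close>
  have t_indep: "t \<notin> R.cl (?G - {t})"
  proof
    assume tcl: "t \<in> R.cl (?G - {t})"
    let ?U = "insert (\<iota> t \<boxtimes> \<iota> t) G"
    have U: "?U \<subseteq> carrier S" using B.G_carr tS by auto
    interpret U: ideal "B.H ?U" S by (rule B.H_ideal[OF U])
    have QU: "Q \<subseteq> B.H ?U" using B.H_self(2)[OF U] .
    have t2U: "t2Q \<subseteq> B.H ?U" using t2Q_least[OF U.ideal_axioms _ QU] B.H_self(1)[OF U] by blast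
    have PU: "P \<subseteq> B.H ?U" using B.H_least[OF U.ideal_axioms _ QU, of G] B.H_self(1)[OF U] B.G(3) by blast
    have "?G - {t} \<subseteq> contraction (B.H ?U)"
      using contraction_self \<alpha>(1) \<alpha>_iff[OF U.ideal_axioms t2U] PU GP(1) by blast
    moreover have "N \<cdot>\<^bsub>RR\<^esub> N \<subseteq> contraction (B.H ?U)"
    proof (rule N_prod_subset[OF U.ideal_axioms])
      fix i j assume "i \<in> K 1" "j \<in> K 1"
      then obtain g p g' p' where i: "g \<in> carrier S" "p \<in> P" "i = \<iota> t \<boxtimes> g \<boxplus> p"
        and j: "g' \<in> carrier S" "p' \<in> P" "j = \<iota> t \<boxtimes> g' \<boxplus> p'" by (metis K1_split)
      have "i \<boxtimes> j = (g \<boxtimes> g') \<boxtimes> (\<iota> t \<boxtimes> \<iota> t) \<boxplus>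
          ((\<iota> t \<boxtimes> g \<boxplus> p) \<boxtimes> p' \<boxplus> (\<iota> t \<boxtimes> g') \<boxtimes> p)"
        unfolding i(3) j(3) using i(1) j(1) tS P_carr[OF i(2)] P_carr[OF j(2)] by algebra
      moreover have "(g \<boxtimes> g') \<boxtimes> (\<iota> t \<boxtimes> \<iota> t) \<in> B.H ?U"
        using t2Q.I_l_closed[OF t2_t2Q, of "g \<boxtimes> g'"] i(1) j(1) t2U by auto
      moreover have "(\<iota> t \<boxtimes> g \<boxplus> p) \<boxtimes> p' \<in> B.H ?U" "(\<iota> t \<boxtimes> g') \<boxtimes> p \<in> B.H ?U"
        using P.I_l_closed[OF j(2), of "\<iota> t \<boxtimes> g \<boxplus> p"] P.I_l_closed[OF i(2), of "\<iota> t \<boxtimes> g'"]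
          i(1) j(1) tS P_carr[OF i(2)] PU by auto
      ultimately show "i \<boxtimes> j \<in> B.H ?U" by (simp only: U.I_add_closed)
    qed
    ultimately have "R.cl (?G - {t}) \<subseteq> contraction (B.H ?U)"
      by (rule R.cl_least[OF contraction_ideal[OF U.ideal_axioms]])
    then have "\<iota> t \<in> B.H ?U"
      using tcl contraction_iff[OF U.ideal_axioms QU represents_A[OF t(1)]] by blast
    then obtain c z where c: "c \<in> carrier S" "z \<in> B.H G" "\<iota> t = c \<boxtimes> (\<iota> t \<boxtimes> \<iota> t) \<boxplus> z"
      using B.H_insert[OF _ B.G_carr, of "\<iota> t \<boxtimes> \<iota> t" "\<iota> t"] tS by auto
    have zP: "z \<in> P" using c(2) B.G(3) by simp
    let ?v = "\<one>\<^bsub>S\<^esub> \<boxminus> c \<boxtimes> \<iota> t"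
    have v: "?v \<in> carrier S" "?v \<notin> K 1" using B.one_minus_M[OF K.I_l_closed[OF t_K c(1)]] .
    have "\<iota> t \<boxtimes> ?v = \<iota> t \<boxminus> c \<boxtimes> (\<iota> t \<boxtimes> \<iota> t)" using tS c(1) by algebra
    also have "\<dots> = (c \<boxtimes> (\<iota> t \<boxtimes> \<iota> t) \<boxplus> z) \<boxminus> c \<boxtimes> (\<iota> t \<boxtimes> \<iota> t)" using c(3) by (simp only:)
    also have "\<dots> = z" using tS c(1) P_carr[OF zP] by algebra
    finally have "\<iota> t \<boxtimes> ?v \<in> P" using zP by (simp only:)
    then have "?v \<in> P" using t_cancel_P v(1) by blast
    then show False using P_K1 v(2) by blast
  qed
  \<comment> \<open>the ideal spanned by \<open>t\<close>, the other basis elements and \<open>Q\<close> separates \<open>\<alpha> g\<close>\<close>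
  have \<alpha>_indep: "\<alpha> g \<notin> R.cl (insert t (\<alpha> ` (G - {g})))" if g: "g \<in> G" for g
  proof
    assume acl: "\<alpha> g \<in> R.cl (insert t (\<alpha> ` (G - {g})))"
    let ?U = "insert (\<iota> t) (G - {g})"
    have U: "?U \<subseteq> carrier S" using B.G_carr tS by auto
    interpret U: ideal "B.H ?U" S by (rule B.H_ideal[OF U])
    have QU: "Q \<subseteq> B.H ?U" using B.H_self(2)[OF U] .
    have tU: "\<iota> t \<in> B.H ?U" using B.H_self(1)[OF U] by blast
    have t2U: "t2Q \<subseteq> B.H ?U"
      using t2Q_least[OF U.ideal_axioms _ QU] U.I_l_closed[OF tU tS] by blast
    have "insert t (\<alpha> ` (G - {g})) \<subseteq> contraction (B.H ?U)"
      using contraction_self[OF t(1) tU] contraction_self[of "\<alpha> h" "B.H ?U" for h] \<alpha>(1)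
        \<alpha>_iff[OF U.ideal_axioms t2U] B.H_self(1)[OF U] by blast
    moreover have "N \<cdot>\<^bsub>RR\<^esub> N \<subseteq> contraction (B.H ?U)"
    proof (rule N_prod_subset[OF U.ideal_axioms])
      fix i j assume "i \<in> K 1" "j \<in> K 1"
      then obtain g p g' p' where i: "g \<in> carrier S" "p \<in> P" "i = \<iota> t \<boxtimes> g \<boxplus> p"
        and j: "g' \<in> carrier S" "p' \<in> P" "j = \<iota> t \<boxtimes> g' \<boxplus> p'" by (metis K1_split)
      let ?w = "g \<boxtimes> (\<iota> t \<boxtimes> g' \<boxplus> p') \<boxplus> g' \<boxtimes> p"
      have w: "?w \<in> carrier S" using i(1) j(1) tS P_carr[OF i(2)] P_carr[OF j(2)] by simp
      have "i \<boxtimes> j = ?w \<boxtimes> \<iota> t \<boxplus> p \<boxtimes> p'"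
        unfolding i(3) j(3) using i(1) j(1) tS P_carr[OF i(2)] P_carr[OF j(2)] by algebra
      moreover have "?w \<boxtimes> \<iota> t \<in> B.H ?U" by (rule U.I_l_closed[OF tU w])
      moreover have "p \<boxtimes> p' \<in> B.H ?U" using B.P_mult_Q[OF i(2) j(2)] QU by blast
      ultimately show "i \<boxtimes> j \<in> B.H ?U" by (simp only: U.I_add_closed)
    qed
    ultimately have "R.cl (insert t (\<alpha> ` (G - {g}))) \<subseteq> contraction (B.H ?U)"
      by (rule R.cl_least[OF contraction_ideal[OF U.ideal_axioms]])
    then have "\<iota> (\<alpha> g) \<in> B.H ?U"
      using acl contraction_iff[OF U.ideal_axioms QU represents_A[OF \<alpha>(1)[OF g]]] by blast
    then have "g \<in> B.H ?U" using \<alpha>_iff[OF U.ideal_axioms t2U g] by blast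
    then show False using B.indep_mod_t[OF g] by blast
  qed
  have self: "insert t (\<alpha> ` (G - {g})) \<subseteq> R.cl (insert t (\<alpha> ` (G - {g})))" for g
  proof (rule R.cl_self(1))
    show "insert t (\<alpha> ` (G - {g})) \<subseteq> carrier RR" using Gc by blast
  qed
  have inj: "inj_on \<alpha> G"
  proof (rule inj_onI, rule ccontr)
    fix g g' assume g: "g \<in> G" "g' \<in> G" "\<alpha> g = \<alpha> g'" "g \<noteq> g'"
    then have "\<alpha> g \<in> insert t (\<alpha> ` (G - {g}))" by blast
    then show False using \<alpha>_indep[OF g(1)] self by blast
  qed
  have t_\<alpha>: "t \<notin> \<alpha> ` G"
  proof
    assume "t \<in> \<alpha> ` G"
    then obtain g where "g \<in> G" "\<alpha> g = t" by blast
    then show False using \<alpha>_indep[of g] self[of g] by blast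
  qed
  have "R.indep ?G"
    unfolding R.indep_def
  proof (intro conjI ballI)
    show "?G \<subseteq> N" by (rule GN)
    fix x assume "x \<in> ?G"
    then consider "x = t" | g where "g \<in> G" "x = \<alpha> g" by blast
    then show "x \<notin> R.cl (?G - {x})"
    proof cases
      case 1
      then show ?thesis using t_indep by simp
    next
      case 2
      then have "?G - {x} = insert t (\<alpha> ` (G - {g}))" using inj t_\<alpha> by (auto simp: inj_on_def)
      then show ?thesis using \<alpha>_indep[OF 2(1)] 2(2) by simp
    qed
  qed
  moreover have "N \<subseteq> R.cl ?G" using R.genideal_subset_cl[OF Gc] gen by simp
  moreover have fin: "finite ?G" using B.G(2) by simp
  ultimately have "has_embedding_dimension RR (card ?G)"
    using R.has_embedding_dimension_basis[OF fin Gc gen] by blast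
  moreover have "card ?G = card G + 1" using t_\<alpha> B.G(2) card_image[OF inj] by simp
  ultimately show ?thesis by simp
qed

end

section \<open>Tight domination\<close>

locale tight_domination = F: field F for F (structure) +
  fixes A and V
  assumes subring_A: "subring A F" and subring_V: "subring V F"
    and noetherian: "noetherian_domain (F\<lparr>carrier := A\<rparr>)"
    and quasilocal: "quasilocal_ring (F\<lparr>carrier := A\<rparr>)"
    and dvr: "discrete_valuation_ring (F\<lparr>carrier := V\<rparr>)"
    and A_V: "A \<subseteq> V"
    and dominates: "max_ideal (F\<lparr>carrier := A\<rparr>) \<subseteq> max_ideal (F\<lparr>carrier := V\<rparr>)"
    and tight: "V = A <+>\<^bsub>F\<^esub> genideal (F\<lparr>carrier := V\<rparr>) (max_ideal (F\<lparr>carrier := A\<rparr>))"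
begin

abbreviation AA where "AA \<equiv> F\<lparr>carrier := A\<rparr>"
abbreviation VV where "VV \<equiv> F\<lparr>carrier := V\<rparr>"
abbreviation m where "m \<equiv> max_ideal AA"
abbreviation n where "n \<equiv> max_ideal VV"

sublocale A: noetherian_domain AA by (rule noetherian)
sublocale V: principal_domain VV using dvr unfolding discrete_valuation_ring_def by blast
sublocale m: maximalideal m AA by (rule max_ideal_maximalideal[OF quasilocal])
sublocale n: maximalideal n VV
  using max_ideal_maximalideal dvr unfolding discrete_valuation_ring_def by blast

lemma V_carr: "v \<in> V \<Longrightarrow> v \<in> carrier F"
  using subringE(1)[OF subring_V] by blast

lemma V_ring: "\<zero> \<in> V" "\<one> \<in> V" "a \<in> V \<Longrightarrow> \<ominus> a \<in> V"
    "a \<in> V \<Longrightarrow> b \<in> V \<Longrightarrow> a \<otimes> b \<in> V" "a \<in> V \<Longrightarrow> b \<in> V \<Longrightarrow> a \<oplus> b \<in> V"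
  using subringE[OF subring_V] by auto

lemma A_carr: "a \<in> A \<Longrightarrow> a \<in> carrier F"
  using A_V V_carr by blast

lemma A_Units: "a \<in> A \<Longrightarrow> a \<notin> m \<Longrightarrow> a \<in> Units AA"
  using quasilocal_Units[OF quasilocal] by simp

lemma V_Units: assumes "v \<in> V" "v \<notin> n" obtains w where "w \<in> V" "w \<otimes> v = \<one>"
proof -
  have "v \<in> Units VV"
    using quasilocal_Units[of VV v] dvr assms unfolding discrete_valuation_ring_def by simp
  then show ?thesis using that unfolding Units_def by auto
qed

lemma one_notin_n: "\<one> \<notin> n"
  using n.one_imp_carrier n.I_notcarr by auto

lemma A_inter_n: assumes "a \<in> A" "a \<in> n" shows "a \<in> m"
proof (rule ccontr)
  assume "a \<notin> m"
  then obtain b where b: "b \<in> A" "b \<otimes> a = \<one>" using A_Units[OF assms(1)] unfolding Units_def by auto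
  then have "b \<otimes> a \<in> n" using n.I_l_closed[OF assms(2), of b] A_V by auto
  then show False using b one_notin_n by simp
qed

text \<open>In \<open>V = A + m V\<close> the component from \<open>A\<close> of an element of \<open>n\<close> lies in \<open>n\<close> too, hence in \<open>m\<close>.\<close>

lemma n_eq: "n = Idl\<^bsub>VV\<^esub> m"
proof
  have mV: "m \<subseteq> carrier VV" using dominates n.a_subset by blast
  show sub: "Idl\<^bsub>VV\<^esub> m \<subseteq> n" by (rule V.genideal_minimal[OF n.ideal_axioms dominates])
  interpret J: ideal "Idl\<^bsub>VV\<^esub> m" VV using V.genideal_ideal mV .
  show "n \<subseteq> Idl\<^bsub>VV\<^esub> m"
  proof
    fix x assume x: "x \<in> n"
    then have "x \<in> V" using n.Icarr by simp
    then obtain a y where a: "a \<in> A" "y \<in> Idl\<^bsub>VV\<^esub> m" "x = a \<oplus> y"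
      by (subst (asm) tight) (auto simp: set_add_def')
    have y: "y \<in> n" using a(2) sub by blast
    have yc: "y \<in> V" using a(2) J.Icarr by simp
    have "a = x \<ominus>\<^bsub>VV\<^esub> y" 
      using a V.minus_eq[of x y] V.a_assoc[of a y "\<ominus>\<^bsub>VV\<^esub> y"] V.r_neg[of y] V.r_zero[of a]
        V.a_inv_closed[of y] yc A_V by auto
    then have "a \<in> n" using n.I_minus_closed[OF x y] by simp
    then have "a \<in> m" using A_inter_n a by blast
    then have "a \<in> Idl\<^bsub>VV\<^esub> m" using V.genideal_self[OF mV] by blast
    then show "x \<in> Idl\<^bsub>VV\<^esub> m" using J.I_add_closed[OF _ a(2)] a(3) by simp
  qed
qed

text \<open>The maximal ideal \<open>m\<close> of \<open>A\<close> is not contained in \<open>n\<^sup>2\<close>, as otherwise \<open>n = m V\<close> would equal \<open>n\<^sup>2\<close>;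
  and every element of \<open>n\<close> outside \<open>n\<^sup>2\<close> generates \<open>n\<close>.\<close>

lemma exists_uniformizer:
  obtains t where "t \<in> m" "t \<noteq> \<zero>" "n = {t \<otimes> v | v. v \<in> V}"
proof -
  obtain t0 where t0: "t0 \<in> V" "n = PIdl\<^bsub>VV\<^esub> t0" using V.exists_gen[OF n.ideal_axioms] by auto
  have t0c: "t0 \<in> carrier F" using t0 V_carr by blast
  have t0n: "t0 \<in> n" using V.cgenideal_self[of t0] t0 by simp
  have "t0 \<noteq> \<zero>"
  proof
    assume "t0 = \<zero>"
    then have "n = {\<zero>\<^bsub>VV\<^esub>}" unfolding t0(2) cgenideal_def using V_carr V_ring(2) by (auto intro!: exI[of _ "\<one>"])
    then have "field VV" using V.zeromaximalideal_fieldI n.maximalideal_axioms by simp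
    then show False using dvr unfolding discrete_valuation_ring_def by blast
  qed
  let ?J = "PIdl\<^bsub>VV\<^esub> (t0 \<otimes> t0)"
  have tt: "t0 \<otimes> t0 \<in> V" using t0 V_ring by blast
  have J: "ideal ?J VV" using V.cgenideal_ideal[of "t0 \<otimes> t0"] tt by simp
  have "\<not> m \<subseteq> ?J"
  proof
    assume "m \<subseteq> ?J"
    then have "n \<subseteq> ?J" unfolding n_eq by (rule V.genideal_minimal[OF J])
    then obtain v where v: "v \<in> V" "t0 = v \<otimes> (t0 \<otimes> t0)" using t0n unfolding cgenideal_def by auto
    have vc: "v \<in> carrier F" using v V_carr by blast
    have "t0 \<otimes> (v \<otimes> t0) = v \<otimes> (t0 \<otimes> t0)" using t0c vc by (simp add: F.m_ac)
    then have "t0 \<otimes> (v \<otimes> t0) = t0 \<otimes> \<one>" using v(2) t0c by simp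
    then have "v \<otimes> t0 = \<one>" 
      using F.m_lcancel[OF \<open>t0 \<noteq> \<zero>\<close> t0c F.m_closed[OF vc t0c] F.one_closed] by blast
    then show False using n.I_l_closed[OF t0n, of v] v one_notin_n by simp
  qed
  then obtain t where t: "t \<in> m" "t \<notin> ?J" by blast
  then have tn: "t \<in> n" using dominates by blast
  then obtain u where u: "u \<in> V" "t = u \<otimes> t0" unfolding t0(2) cgenideal_def by auto
  note uc = V_carr[OF u(1)]
  have "u \<notin> n"
  proof
    assume "u \<in> n"
    then obtain w where w: "w \<in> V" "u = w \<otimes> t0" unfolding t0(2) cgenideal_def by auto
    then have "t = w \<otimes> (t0 \<otimes> t0)" using u t0c V_carr by (simp add: F.m_assoc)
    then show False using t(2) w(1) unfolding cgenideal_def by auto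
  qed
  then obtain w where w: "w \<in> V" "w \<otimes> u = \<one>" using V_Units u by blast
  note wc = V_carr[OF w(1)]
  have "w \<otimes> t = (w \<otimes> u) \<otimes> t0" unfolding u(2) using wc uc t0c by (simp add: F.m_assoc)
  then have wt: "w \<otimes> t = t0" using w t0c by simp
  have tc: "t \<in> carrier F" using u uc t0c by simp
  have "n = {t \<otimes> v | v. v \<in> V}"
  proof
    show "n \<subseteq> {t \<otimes> v | v. v \<in> V}"
    proof
      fix x assume "x \<in> n"
      then obtain v where v: "v \<in> V" "x = v \<otimes> t0" unfolding t0(2) cgenideal_def by auto
      have "x = t \<otimes> (v \<otimes> w)" unfolding v(2) wt[symmetric] using V_carr[OF v(1)] wc tc by (simp add: F.m_ac)
      then show "x \<in> {t \<otimes> v | v. v \<in> V}" using V_ring(4)[OF v(1) w(1)] by blast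
    qed
    show "{t \<otimes> v | v. v \<in> V} \<subseteq> n" using n.I_r_closed[OF tn] by auto
  qed
  moreover have "\<zero>\<^bsub>VV\<^esub> \<in> ?J" using additive_subgroup.zero_closed[OF ideal.axioms(1)[OF J]] .
  then have "t \<noteq> \<zero>" using t(2) by auto
  ultimately show ?thesis using that t(1) by blast
qed

end

locale tight_domination_uniformizer = tight_domination +
  fixes t
  assumes t_m: "t \<in> m" and t_nonzero: "t \<noteq> \<zero>" and n_t: "n = {t \<otimes> v | v. v \<in> V}"
begin

lemma t_A: "t \<in> A" using t_m m.Icarr by simp
lemma t_carr: "t \<in> carrier F" using t_A A_carr by blast
lemma t_V: "t \<in> V" using t_A A_V by blast

lemma t_pow_V: "t [^] (k::nat) \<in> V"
  using t_V V_ring by (induction k) auto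

lemma t_pow_carr: "t [^] (k::nat) \<in> carrier F" using t_pow_V V_carr by blast

lemma prod_powers:
  assumes "v \<in> V" "w \<in> V"
  shows "(t [^] (k::nat) \<otimes> v) \<otimes> (t \<otimes> w) = t [^] Suc k \<otimes> (v \<otimes> w)"
  using assms V_carr t_carr t_pow_carr by (simp add: F.m_ac)

lemma sum_powers:
  assumes "v \<in> V" "w \<in> V"
  shows "t [^] (k::nat) \<otimes> v \<oplus> t [^] k \<otimes> w = t [^] k \<otimes> (v \<oplus> w)"
  using assms V_carr t_pow_carr by (simp add: F.r_distr)

lemma power_n: "ideal_power VV n k = {t [^] k \<otimes> v | v. v \<in> V}"
proof (induction k)
  case 0
  have "{t [^] (0::nat) \<otimes> v | v. v \<in> V} = V" using V_carr by force
  then show ?case using V.ideal_power_0[of n] by simp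
next
  case (Suc k)
  have "ideal_power VV n k \<cdot>\<^bsub>VV\<^esub> n = {t [^] Suc k \<otimes> v | v. v \<in> V}" (is "?L = ?R")
  proof
    show "?L \<subseteq> ?R"
    proof
      fix x assume "x \<in> ?L"
      then show "x \<in> ?R"
      proof (induction rule: ideal_prod.induct)
        case (prod i j)
        then obtain v w where "v \<in> V" "w \<in> V" "i = t [^] k \<otimes> v" "j = t \<otimes> w"
          using prod(1)[unfolded Suc] prod(2)[unfolded n_t] by blast
        then have "i \<otimes> j = t [^] Suc k \<otimes> (v \<otimes> w)" "v \<otimes> w \<in> V" using prod_powers V_ring(4) by auto
        then show ?case by auto
      next
        case (sum s1 s2)
        then obtain v w where vw: "v \<in> V" "w \<in> V" "s1 = t [^] Suc k \<otimes> v" "s2 = t [^] Suc k \<otimes> w" by blast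
        have "s1 \<oplus> s2 = t [^] Suc k \<otimes> (v \<oplus> w)" unfolding vw(3,4) by (rule sum_powers[OF vw(1,2)])
        then show ?case using V_ring(5)[OF vw(1,2)] by auto
      qed
    qed
    show "?R \<subseteq> ?L"
    proof
      fix x assume "x \<in> ?R"
      then obtain v where v: "v \<in> V" "x = t [^] Suc k \<otimes> v" by blast
      have "t [^] k \<otimes> v \<in> ideal_power VV n k" unfolding Suc using v by blast
      moreover have "t \<otimes> \<one> \<in> n" unfolding n_t using V_ring by blast
      ultimately have "(t [^] k \<otimes> v) \<otimes>\<^bsub>VV\<^esub> (t \<otimes> \<one>) \<in> ?L" by (rule ideal_prod.prod)
      then show "x \<in> ?L"
        using prod_powers[OF v(1) V_ring(2), of k] V_carr[OF v(1)] unfolding v(2) by simp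
    qed
  qed
  then show ?case using V.ideal_power_Suc[of n k] by simp
qed

lemma power_m_subset: "ideal_power AA m k \<subseteq> {t [^] k \<otimes> v | v. v \<in> V}"
proof (induction k)
  case 0
  then show ?case using A.ideal_power_0[of m] A_V A_carr by force
next
  case (Suc k)
  show ?case unfolding A.ideal_power_Suc
  proof
    fix x assume "x \<in> ideal_power AA m k \<cdot>\<^bsub>AA\<^esub> m"
    then show "x \<in> {t [^] Suc k \<otimes> v | v. v \<in> V}"
    proof (induction rule: ideal_prod.induct)
      case (prod i j)
      then obtain v w where "v \<in> V" "w \<in> V" "i = t [^] k \<otimes> v" "j = t \<otimes> w"
        using Suc dominates unfolding n_t by blast
      then have "i \<otimes> j = t [^] Suc k \<otimes> (v \<otimes> w)" "v \<otimes> w \<in> V" using prod_powers V_ring(4) by auto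
      then show ?case by auto
    next
      case (sum s1 s2)
      then obtain v w where vw: "v \<in> V" "w \<in> V" "s1 = t [^] Suc k \<otimes> v" "s2 = t [^] Suc k \<otimes> w" by blast
      have "s1 \<oplus> s2 = t [^] Suc k \<otimes> (v \<oplus> w)" unfolding vw(3,4) by (rule sum_powers[OF vw(1,2)])
      then show ?case using V_ring(5)[OF vw(1,2)] by auto
    qed
  qed
qed

lemma t_pow_power_m: "t [^] (k::nat) \<in> ideal_power AA m k"
proof (induction k)
  case 0
  then show ?case using A.ideal_power_0[of m] A.one_closed by simp
next
  case (Suc k)
  then have "t [^] k \<otimes>\<^bsub>AA\<^esub> t \<in> ideal_power AA m k \<cdot>\<^bsub>AA\<^esub> m" using t_m by (rule ideal_prod.prod)
  then show ?case using A.ideal_power_Suc[of m k] by simp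
qed

lemma t_nonunit: "v \<in> V \<Longrightarrow> t \<otimes> v \<noteq> \<one>"
  using one_notin_n unfolding n_t by force

lemma cancel_t_pow:
  assumes "v \<in> V" "w \<in> V" "t \<otimes> v = t [^] Suc k \<otimes> w" shows "v = t [^] (k::nat) \<otimes> w"
proof -
  have c: "v \<in> carrier F" "w \<in> carrier F" "t [^] k \<in> carrier F" using assms V_carr t_pow_carr by auto
  have "t \<otimes> v = t \<otimes> (t [^] k \<otimes> w)" unfolding assms(3) using c t_carr by (simp add: F.m_ac)
  then show ?thesis 
    using F.m_lcancel[OF t_nonzero t_carr c(1) F.m_closed[OF c(3,2)]] by blast
qed

text \<open>Krull's intersection theorem for \<open>V\<close>: a generator \<open>c\<close> of the intersection of the powers
  of the maximal ideal would satisfy \<open>c = t c'\<close> with \<open>c'\<close> again in the intersection.\<close>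

lemma V_separated:
  assumes v: "v \<in> V" "\<And>k::nat. \<exists>v'\<in>V. v = t [^] k \<otimes> v'"
  shows "v = \<zero>"
proof -
  let ?J = "\<Inter>k. ideal_power VV n k"
  have J: "ideal ?J VV"
    using V.i_Intersect[of "range (ideal_power VV n)"] V.ideal_power_ideal[OF n.ideal_axioms] by auto
  have J_iff: "x \<in> ?J \<longleftrightarrow> (\<forall>k::nat. \<exists>w\<in>V. x = t [^] k \<otimes> w)" for x
    by (simp add: power_n Bex_def conj_commute)
  obtain c where c: "c \<in> V" "?J = PIdl\<^bsub>VV\<^esub> c" using V.exists_gen[OF J] by auto
  have cJ: "c \<in> ?J" using V.cgenideal_self[of c] c by simp
  then obtain c' where c': "c' \<in> V" "c = t [^] Suc 0 \<otimes> c'" unfolding J_iff by blast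
  have ct: "c = t \<otimes> c'" using c' t_carr by simp
  have "\<exists>w\<in>V. c' = t [^] k \<otimes> w" for k :: nat
  proof -
    obtain w where "w \<in> V" "c = t [^] Suc k \<otimes> w" using cJ unfolding J_iff by blast
    then show ?thesis using cancel_t_pow[OF c'(1)] ct by metis
  qed
  then have "c' \<in> PIdl\<^bsub>VV\<^esub> c" using c(2) J_iff by blast
  then obtain d where d: "d \<in> V" "c' = d \<otimes> c" unfolding cgenideal_def by auto
  note cc = V_carr[OF c(1)] V_carr[OF d(1)]
  have "c = \<zero>"
  proof (rule ccontr)
    assume c0: "c \<noteq> \<zero>"
    have "c \<otimes> (t \<otimes> d) = t \<otimes> (d \<otimes> c)" using cc t_carr by (simp add: F.m_ac)
    also have "\<dots> = c \<otimes> \<one>" using ct cc unfolding d(2) by simp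
    finally have "t \<otimes> d = \<one>" 
      using F.m_lcancel[OF c0 cc(1) F.m_closed[OF t_carr cc(2)] F.one_closed] by blast
    then show False using t_nonunit d by blast
  qed
  then have "?J = {\<zero>}" using c V_carr V_ring(2) unfolding cgenideal_def by (auto intro!: exI[of _ "\<one>"])
  moreover have "v \<in> ?J" unfolding J_iff using v(2) by blast
  ultimately show ?thesis by blast
qed

lemma V_fill: assumes "v \<in> V" shows "\<exists>a\<in>A. \<exists>v'\<in>V. v = a \<oplus> t \<otimes> v'"
proof -
  obtain a y where a: "a \<in> A" "y \<in> Idl\<^bsub>VV\<^esub> m" "v = a \<oplus> y"
    using assms by (subst (asm) tight) (auto simp: set_add_def')
  have "y \<in> {t \<otimes> v | v. v \<in> V}" using a(2) unfolding n_eq[symmetric] n_t .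
  then show ?thesis using a(1,3) by blast
qed

sublocale adic: adic AA m
  by unfold_locales

abbreviation Ahat where "Ahat \<equiv> completion AA"
abbreviation pw where "pw \<equiv> ideal_power AA m"

lemma tight_completion:
  obtains X where "tight F A Ahat (to_completion AA) adic.trunc_ker pw X V t"
proof -
  have "completed AA Ahat (to_completion AA) adic.trunc_ker pw"
    using adic.completed_completion unfolding completion_def to_completion_def .
  moreover obtain X where X: "X \<subseteq> carrier AA" "finite X" "m = Idl\<^bsub>AA\<^esub> X"
    using A.finetely_gen[OF m.ideal_axioms] by blast
  ultimately have cl: "complete_local AA Ahat (to_completion AA) adic.trunc_ker pw X"
    using A.ideal_power_Suc[of m] A.ideal_power_1[OF m.ideal_axioms] A_Units
    by (intro complete_local.intro complete_local_axioms.intro) auto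
  have "tight F A Ahat (to_completion AA) adic.trunc_ker pw X V t"
    using F.field_axioms cl subring_A subring_V A_V t_A t_nonzero t_pow_power_m power_m_subset V_fill
      V_separated t_nonunit
    by (intro tight.intro tight_axioms.intro) blast+
  then show ?thesis by (rule that)
qed

text \<open>If \<open>f\<close> is given by representatives \<open>a k\<close>, its image in the completion of \<open>V\<close> vanishes if and only
  if each \<open>a k\<close> lies in the \<open>k\<close>-th power of \<open>n\<close>.\<close>

lemma kernel_eq:
  assumes "tight F A Ahat (to_completion AA) adic.trunc_ker pw X V t"
  shows "a_kernel Ahat (completion VV) (completion_map VV) =
    tight.P F A Ahat (to_completion AA) adic.trunc_ker V t"
proof -
  interpret T: tight F A Ahat "to_completion AA" adic.trunc_ker pw X V t by (rule assms)
  let ?W = "\<lambda>k. ideal_power VV n k"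
  have W: "?W k = T.W k" for k unfolding power_n T.W_def ..
  have C: "Ahat = adic.C" unfolding completion_def ..
  have \<iota>: "to_completion AA a = adic.cosets (\<lambda>k. a)" for a
    unfolding to_completion_def adic.cosets_def ..
  have "f \<in> a_kernel Ahat (completion VV) (completion_map VV) \<longleftrightarrow> f \<in> T.P" if f: "f \<in> carrier Ahat" for f
  proof -
    obtain a where a: "adic.coherent a" "f = adic.cosets a" using f unfolding C by (rule adic.carrierE)
    have ac: "a k \<in> A" for k using adic.coherent_carr[OF a(1)] by simp
    have "?W k <+>\<^bsub>VV\<^esub> (pw k +>\<^bsub>AA\<^esub> a k) = ?W k \<longleftrightarrow> a k \<in> ?W k" for k
    proof -
      interpret W: ideal "?W k" VV by (rule V.ideal_power_ideal[OF n.ideal_axioms])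
      interpret p: ideal "pw k" AA by (rule adic.pw)
      have zero: "\<zero> \<in> ?W k" "\<zero> \<in> pw k" using W.zero_closed p.zero_closed by auto
      have aF: "a k \<in> carrier F" using ac A_carr by blast
      have ex: "x \<in> ?W k <+>\<^bsub>VV\<^esub> (pw k +>\<^bsub>AA\<^esub> a k) \<longleftrightarrow> (\<exists>w\<in>?W k. \<exists>q\<in>pw k. x = w \<oplus> (q \<oplus> a k))" for x
        unfolding set_add_def' a_r_coset_def' by auto
      show ?thesis
      proof
        assume "?W k <+>\<^bsub>VV\<^esub> (pw k +>\<^bsub>AA\<^esub> a k) = ?W k"
        moreover have "\<zero> \<oplus> (\<zero> \<oplus> a k) = a k" using aF by simp
        ultimately show "a k \<in> ?W k" using ex[of "a k"] zero by metis
      next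
        assume aW: "a k \<in> ?W k"
        show "?W k <+>\<^bsub>VV\<^esub> (pw k +>\<^bsub>AA\<^esub> a k) = ?W k"
        proof (intro equalityI subsetI)
          fix x assume "x \<in> ?W k <+>\<^bsub>VV\<^esub> (pw k +>\<^bsub>AA\<^esub> a k)"
          then obtain w q where x: "w \<in> ?W k" "q \<in> pw k" "x = w \<oplus> (q \<oplus> a k)" using ex by blast
          have "q \<in> ?W k" using x(2) power_m_subset power_n by blast
          then show "x \<in> ?W k" using T.W_add aW x(1) unfolding x(3) W by blast
        next
          fix x assume x: "x \<in> ?W k"
          have "x \<ominus> a k \<in> ?W k" using T.W_diff x aW unfolding W by blast
          moreover have "x \<in> carrier F" using x T.W_V V_carr unfolding W by blast
          then have "x = (x \<ominus> a k) \<oplus> (\<zero> \<oplus> a k)" using aF by algebra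
          ultimately show "x \<in> ?W k <+>\<^bsub>VV\<^esub> (pw k +>\<^bsub>AA\<^esub> a k)" using ex zero by blast
        qed
      qed
    qed
    then have "f \<in> a_kernel Ahat (completion VV) (completion_map VV) \<longleftrightarrow> (\<forall>k. a k \<in> ?W k)"
      unfolding a_kernel_def kernel_def completion_map_def a(2) adic.cosets_def fun_eq_iff
      using f unfolding a(2) adic.cosets_def
      by (simp add: completion_def adic_completion_def FactRing_def)
    also have "\<dots> \<longleftrightarrow> f \<in> T.P"
    proof
      have approx: "f \<ominus>\<^bsub>Ahat\<^esub> to_completion AA (a k) \<in> adic.trunc_ker k" for k
      proof -
        have co: "adic.coherent (\<lambda>i. a k)" using ac by (intro adic.coherent_const) simp
        have "a k \<ominus>\<^bsub>AA\<^esub> a k = \<zero>\<^bsub>AA\<^esub>" using A.minus_self[of "a k"] ac by simp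
        then have "a k \<ominus>\<^bsub>AA\<^esub> a k \<in> pw k"
          using additive_subgroup.zero_closed[OF ideal.axioms(1)[OF adic.pw]] by simp
        then show ?thesis
          unfolding C \<iota> a(2) adic.cosets_minus[OF a(1) co]
          using adic.cosets_trunc_ker[OF adic.coherent_minus[OF a(1) co]] by simp
      qed
      show "f \<in> T.P" if "\<forall>k. a k \<in> ?W k"
        using that f ac approx unfolding T.P_def W by blast
      show "\<forall>k. a k \<in> ?W k" if "f \<in> T.P"
        using T.P_approx[OF that ac approx] unfolding W by blast
    qed
    finally show ?thesis .
  qed
  moreover have "a_kernel Ahat (completion VV) (completion_map VV) \<subseteq> carrier Ahat"
    unfolding a_kernel_def kernel_def by auto
  ultimately show ?thesis using T.P_carr by blast
qed

end

theorem mainTheorem3: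
  fixes F :: "('a, 'm) ring_scheme" and A V :: "'a set"
    and Ahat :: "(nat \<Rightarrow> 'a set) ring" and P :: "(nat \<Rightarrow> 'a set) set"
    and R :: "('a, 'm) ring_scheme"
  assumes quotient_field: "is_quotient_field F A"
    and noetherian: "noetherian_domain (subring_of F A)"
    and quasilocal: "quasilocal_ring (subring_of F A)"
    and not_dvr: "\<not> discrete_valuation_ring (subring_of F A)"
    and dvr_V: "discrete_valuation_ring (subring_of F V)"
    and tight: "tightly_dominates F V A"
    and Ahat: "Ahat = completion (subring_of F A)"
    and P: "P = a_kernel Ahat (completion (subring_of F V)) (completion_map (subring_of F V))"
    and R: "R = subring_of F (field_inter_completion_quot F A (symbolic_power Ahat P 2))"
  shows "\<exists>n. has_embedding_dimension (localization_at Ahat P) n \<and>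
             has_embedding_dimension R (n + 1)"
proof -
  interpret F: field F using quotient_field unfolding is_quotient_field_def by blast
  interpret tight_domination F A V
  proof (intro tight_domination.intro tight_domination_axioms.intro)
    show "subring A F" "subring V F" "A \<subseteq> V"
      "max_ideal (subring_of F A) \<subseteq> max_ideal (subring_of F V)"
      "V = A <+>\<^bsub>F\<^esub> genideal (subring_of F V) (max_ideal (subring_of F A))"
      using tight unfolding tightly_dominates_def is_quotient_field_def Let_def by simp_all
  qed (fact F.field_axioms noetherian quasilocal dvr_V)+
  obtain t where t: "t \<in> m" "t \<noteq> \<zero>\<^bsub>F\<^esub>" "n = {t \<otimes>\<^bsub>F\<^esub> v | v. v \<in> V}" by (rule exists_uniformizer)
  interpret tight_domination_uniformizer F A V t
    by (intro tight_domination_uniformizer.intro tight_domination_uniformizer_axioms.intro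
      tight_domination_axioms t)
  obtain X where X: "tight F A (completion AA) (to_completion AA) adic.trunc_ker pw X V t"
    by (rule tight_completion)
  interpret T: tight F A "completion AA" "to_completion AA" adic.trunc_ker pw X V t by (rule X)
  have PT: "P = T.P" unfolding P Ahat by (rule kernel_eq[OF X])
  interpret D: dvr_quotient "completion AA" "adic.trunc_ker 1" T.P "to_completion AA t"
    by (rule T.dvr_quotient_completion)
  obtain G where G: "G \<subseteq> T.P" "finite G" "D.H G = T.P" "\<And>g. g \<in> G \<Longrightarrow> g \<notin> D.H (G - {g})"
    by (rule D.exists_basis) blast
  interpret tight_basis F A "completion AA" "to_completion AA" adic.trunc_ker pw X V t G
  proof (intro tight_basis.intro tight_basis_axioms.intro X)
    show "dvr_quotient_basis (completion AA) (adic.trunc_ker 1) T.P (to_completion AA t) G"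
      by (intro dvr_quotient_basis.intro dvr_quotient_basis_axioms.intro D.dvr_quotient_axioms G)
  qed
  have "field_inter_completion_quot F A (symbolic_power Ahat P 2) = R_set"
    unfolding R_set_iff field_inter_completion_quot_def Let_def PT Ahat ..
  then have "R = RR" using R by simp
  then have "has_embedding_dimension R (card G + 1)" using embedding_dimension_R by simp
  moreover have "has_embedding_dimension (localization_at Ahat P) (card G)"
    unfolding PT Ahat by (rule B.embedding_dimension_localization)
  ultimately show ?thesis by blast
qed

end
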